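(* Fix $n>0$ and a prime power $q$. For each $d$ let $a_0,\ldots,a_{n-1}$ be independent random variables uniformly distributed on $\mathbb{F}_q[t]_{\le d}$, let $f=X^{q^n}+a_{n-1}X^{q^{n-1}}+\cdots+a_0X$, and let $G_f$ be the Galois group of $f$ over $\mathbb{F}_q(t)$, viewed as a subgroup of $\mathrm{GL}_n(q)$ via its action on the roots. Then $$\lim_{d\to\infty}\mathrm{Prob}(G_f=\mathrm{GL}_n(q))=1.$$
   Context: $\mathbb{F}_q[t]_{\le d}$ is the set of polynomials of degree at most $d$. When $a_0\ne0$, the roots $Z(f)$ of $f$ form an $n$-dimensional $\mathbb{F}_q$-vector space on which $G_f$ acts faithfully and $\mathbb{F}_q$-linearly, giving $G_f\leqslant\mathrm{GL}(Z(f))\cong\mathrm{GL}_n(q)$. *)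

theory Defs
  imports
    "HOL-Probability.Product_PMF"
    "HOL-Algebra.Bij"
    "HOL-Algebra.Generated_Fields"
    "HOL-Algebra.Algebraic_Closure_Type"
    "Jordan_Normal_Form.Matrix"
begin

definition root_set :: "'k::field poly \<Rightarrow> 'k alg_closure set" where
  "root_set f = {z. poly (map_poly to_ac f) z = 0}"

definition splitting_field :: "'k::field poly \<Rightarrow> 'k alg_closure ring" where
  "splitting_field f = ring_of_type_algebra
     \<lparr>carrier := generate_field ring_of_type_algebra (range to_ac \<union> root_set f)\<rparr>"

text \<open>The group of all field automorphisms of the splitting field of \<open>f\<close> that fix the base
  field pointwise, with composition as product.  As in \<^const>\<open>AutoGroup\<close>, automorphisms are
  extensional functions on the splitting field.\<close>

definition galois_group :: "'k::field poly \<Rightarrow> ('k alg_closure \<Rightarrow> 'k alg_closure) monoid" where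
  "galois_group f = BijGroup (carrier (splitting_field f))
     \<lparr>carrier := {\<sigma> \<in> Bij (carrier (splitting_field f)).
        \<sigma> \<in> Ring.ring_hom (splitting_field f) (splitting_field f) \<and> (\<forall>x. \<sigma> (to_ac x) = to_ac x)}\<rparr>"

text \<open>A finite field with \<open>q\<close> elements is a type \<open>'a\<close> with \<open>q = CARD('a)\<close>, and its field of
  rational functions is \<open>'a poly fract\<close>.\<close>

definition const_scale ::
    "'a::field \<Rightarrow> 'a poly fract alg_closure \<Rightarrow> 'a poly fract alg_closure" where
  "const_scale c x = to_ac (to_fract [:c:]) * x"

global_interpretation const_scale: vector_space const_scale
proof
  fix a b :: 'a and x y :: "'a poly fract alg_closure"
  have "[:a + b:] = [:a:] + [:b:]" "[:a * b:] = [:a:] * [:b:]" "[:1:] = (1 :: 'a poly)"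
    by simp_all
  then show "const_scale a (x + y) = const_scale a x + const_scale a y"
    "const_scale (a + b) x = const_scale a x + const_scale b x"
    "const_scale a (const_scale b x) = const_scale (a * b) x"
    "const_scale 1 x = x"
    unfolding const_scale_def by (simp_all only: to_fract_add to_fract_mult to_fract_1
        to_ac_add to_ac_mult to_ac_1 algebra_simps mult_1)
qed

definition additive_poly :: "nat \<Rightarrow> (nat \<Rightarrow> 'a::{field,finite} poly) \<Rightarrow> 'a poly fract poly" where
  "additive_poly n a =
     Polynomial.monom 1 (CARD('a) ^ n) + (\<Sum>i<n. Polynomial.monom (to_fract (a i)) (CARD('a) ^ i))"

definition root_basis ::
    "'a::field poly fract poly \<Rightarrow> nat \<Rightarrow> (nat \<Rightarrow> 'a poly fract alg_closure) \<Rightarrow> bool" where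
  "root_basis f n b \<longleftrightarrow> inj_on b {..<n} \<and> const_scale.independent (b ` {..<n}) \<and>
     const_scale.span (b ` {..<n}) = root_set f"

definition general_linear :: "nat \<Rightarrow> 'a::field mat set" where
  "general_linear n = {M \<in> carrier_mat n n. invertible_mat M}"

text \<open>The matrices, acting on column vectors of coordinates with respect to the basis \<open>b\<close>, of the
  elements of the Galois group.\<close>

definition galois_matrices ::
    "'a::field poly fract poly \<Rightarrow> nat \<Rightarrow> (nat \<Rightarrow> 'a poly fract alg_closure) \<Rightarrow> 'a mat set" where
  "galois_matrices f n b = {M \<in> carrier_mat n n. \<exists>\<sigma> \<in> carrier (galois_group f).
     \<forall>j<n. \<sigma> (b j) = (\<Sum>i<n. const_scale (M $$ (i, j)) (b i))}"

text \<open>The choice of the basis only conjugates \<^const>\<open>galois_matrices\<close>, so ``some basis'' and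
  ``every basis'' agree as soon as there is a basis with \<open>n\<close> elements.  If the coefficient
  \<open>a\<^sub>0\<close> of the polynomial vanishes, the root space has dimension less than \<open>n\<close>, there is no such
  basis, and the property is false.\<close>

definition galois_group_is_GL :: "nat \<Rightarrow> 'a::field poly fract poly \<Rightarrow> bool" where
  "galois_group_is_GL n f \<longleftrightarrow>
     (\<exists>b. root_basis f n b \<and> galois_matrices f n b = general_linear n)"

text \<open>The joint distribution of \<open>n\<close> independent coefficients, each uniform on the polynomials of
  degree at most \<open>d\<close>; coefficient tuples are functions that are \<open>0\<close> outside \<open>{..<n}\<close>.\<close>

definition random_coeffs :: "nat \<Rightarrow> nat \<Rightarrow> (nat \<Rightarrow> 'a::{field,finite} poly) pmf" where
  "random_coeffs n d = Pi_pmf {..<n} 0 (\<lambda>_. pmf_of_set {p. Polynomial.degree p \<le> d})"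

lemma finite_degree_le: "finite {p :: 'a::{field,finite} poly. Polynomial.degree p \<le> d}"
proof (rule finite_subset)
  show "{p :: 'a poly. Polynomial.degree p \<le> d} \<subseteq> Poly ` {xs. set xs \<subseteq> UNIV \<and> length xs \<le> Suc d}"
  proof
    fix p :: "'a poly"
    assume "p \<in> {p. Polynomial.degree p \<le> d}"
    then have "length (coeffs p) \<le> Suc d"
      by (cases "p = 0") (simp_all add: length_coeffs_degree)
    then show "p \<in> Poly ` {xs. set xs \<subseteq> UNIV \<and> length xs \<le> Suc d}"
      by (metis (mono_tags, lifting) Poly_coeffs image_eqI mem_Collect_eq subset_UNIV)
  qed
  show "finite (Poly ` {xs :: 'a list. set xs \<subseteq> UNIV \<and> length xs \<le> Suc d})"
    by (intro finite_imageI finite_lists_length_le) simp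
qed

lemma pmf_degree_le:
  "pmf (pmf_of_set {p :: 'a::{field,finite} poly. Polynomial.degree p \<le> d}) p =
     (if Polynomial.degree p \<le> d then 1 / real (card {p :: 'a poly. Polynomial.degree p \<le> d}) else 0)"
proof -
  have "{p :: 'a poly. Polynomial.degree p \<le> d} \<noteq> {}"
    by (auto intro: exI[of _ 0])
  then show ?thesis
    by (simp add: finite_degree_le indicator_def)
qed

end

theory Submission
  imports Defs "Jordan_Normal_Form.Determinant" "HOL-Library.Function_Algebras"
begin

text \<open>For a point \<open>\<alpha>\<close> of the field with \<open>Q = q\<^sup>r\<close> elements at which \<open>a\<^sub>0\<close> does not vanish, all roots of
  \<open>f\<close> are power series in \<open>t - \<alpha>\<close>. Raising coefficients to the power \<open>Q\<close> permutes them and induces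
  an element of \<open>G\<^sub>f\<close> which acts on the roots as the \<open>Q\<close>-power map acts on the roots of the
  reduction of \<open>f\<close> at \<open>\<alpha>\<close>. A given conjugacy class of \<open>GL\<^sub>n(q)\<close> contains the Frobenius matrix of a
  random polynomial over the field with \<open>Q\<close> elements with probability bounded away from \<open>0\<close>.
  Reductions at points of distinct large prime degrees are independent once \<open>d\<close> is large, so with
  probability tending to \<open>1\<close> the group \<open>G\<^sub>f\<close> meets every conjugacy class, and by Jordan's lemma it is
  all of \<open>GL\<^sub>n(q)\<close>.\<close>

section \<open>Algebras over a finite field\<close>

text \<open>The Frobenius matrix of a reduction is defined only after a basis of its roots is
  chosen, so a place locates a conjugacy class met by the Galois group and never a particular
  element; the group theory has to start from classes. A single place hits a prescribed class with a
  probability that is only bounded below, by 1 / (2 q^(n^2)). What matters is that this bound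
  depends neither on the degree of the place nor on d, so m independent places miss the class with
  probability at most the m-th power of a constant below 1. Different prime degrees are used because
  their fields meet only in F_q and a point outside F_q then has a full set of r distinct
  conjugates; a nonzero polynomial over F_q vanishing at all chosen points has degree at least the
  sum of the primes. Frobenius on coefficients acts on Laurent series and not on the algebraic
  closure in which the roots are defined, so the splitting field is first embedded into the Laurent
  series and the map is transported back.\<close>

lemma finite_field_power_card:
  fixes x :: "'a::{field,finite}"
  shows "x ^ CARD('a) = x"
proof (cases "x = 0")
  case False
  have "x * (\<Prod>y\<in>UNIV-{0}. x * y) = x * x ^ (CARD('a) - 1) * \<Prod>(UNIV-{0})"
    by (simp add: prod.distrib mult_ac)
  also have "x * x ^ (CARD('a) - 1) = x ^ Suc (CARD('a) - 1)"
    by (subst power_Suc) auto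
  also have "Suc (CARD('a) - 1) = CARD('a)"
    using finite_UNIV_card_ge_0[where ?'a = 'a] by simp
  \<comment> \<open>Multiplication by a nonzero \<open>x\<close> permutes the nonzero elements, so
    the nonzero product can be cancelled.\<close>
  also have "(\<Prod>y\<in>UNIV-{0}. x * y) = (\<Prod>y\<in>UNIV-{0}. y)"
    by (rule prod.reindex_bij_witness[of _ "\<lambda>y. y / x" "\<lambda>y. x * y"]) (use False in auto)
  finally show ?thesis
    by simp
qed (use finite_UNIV_card_ge_0[where ?'a = 'a] in auto)

lemma card_field_ge_2: "CARD('a::{field,finite}) \<ge> 2"
proof -
  have "card {0, 1 :: 'a} \<le> CARD('a)"
    by (rule card_mono) auto
  then show ?thesis
    by simp
qed

text \<open>\<open>(X + 1)\<^sup>q - X\<^sup>q - 1\<close> has degree less than \<open>q\<close> and vanishes on the whole field.\<close>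

lemma of_nat_choose_card_eq_0:
  assumes "0 < i" "i < CARD('a::{field,finite})"
  shows "(of_nat (CARD('a) choose i) :: 'a) = 0"
proof -
  define p :: "'a poly" where
    "p = (\<Sum>k\<in>{0<..<CARD('a)}. Polynomial.monom (of_nat (CARD('a) choose k)) k)"
  have val: "poly p x = 0" for x
  proof -
    have "(x + 1) ^ CARD('a) = (\<Sum>k\<le>CARD('a). of_nat (CARD('a) choose k) * x ^ k * 1 ^ (CARD('a) - k))"
      by (rule binomial_ring)
    also have "{..CARD('a)} = insert 0 (insert CARD('a) {0<..<CARD('a)})"
      by auto
    also have "(\<Sum>k\<in>\<dots>. of_nat (CARD('a) choose k) * x ^ k * 1 ^ (CARD('a) - k)) = 1 + x ^ CARD('a) + poly p x"
      by (simp add: p_def poly_sum poly_monom)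
    finally show ?thesis
      by (simp add: finite_field_power_card)
  qed
  have "p = 0"
  proof (rule ccontr)
    assume "p \<noteq> 0"
    have "Polynomial.degree p \<le> CARD('a) - 1"
      unfolding p_def by (rule degree_sum_le) (auto intro: order.trans[OF degree_monom_le])
    moreover have "CARD('a) \<le> Polynomial.degree p"
      using card_poly_roots_bound[OF \<open>p \<noteq> 0\<close>] val by simp
    ultimately show False
      using card_field_ge_2[where ?'a = 'a] by linarith
  qed
  moreover have "poly.coeff p i = of_nat (CARD('a) choose i)"
    using assms by (simp add: p_def coeff_sum coeff_monom if_distrib cong: if_cong)
  ultimately show ?thesis
    by simp
qed

text \<open>Ring and exponent base stay free because the same shape is needed over the rational
  functions, over two algebraic closures, and over power series and Laurent series.\<close>

definition qpoly :: "nat \<Rightarrow> nat \<Rightarrow> (nat \<Rightarrow> 'r::comm_ring_1) \<Rightarrow> 'r poly" where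
  "qpoly q n A = Polynomial.monom 1 (q ^ n) + (\<Sum>i<n. Polynomial.monom (A i) (q ^ i))"

lemma poly_qpoly: "poly (qpoly q n A) x = x ^ (q ^ n) + (\<Sum>i<n. A i * x ^ (q ^ i))"
  by (simp add: qpoly_def poly_monom poly_sum)

lemma degree_qpoly_sum_less:
  assumes "q \<ge> 2" "n > 0"
  shows "Polynomial.degree (\<Sum>i<n. Polynomial.monom (A i) (q ^ i)) < q ^ n"
proof -
  have "Polynomial.degree (\<Sum>i<n. Polynomial.monom (A i) (q ^ i)) \<le> q ^ (n - 1)"
    by (rule degree_sum_le) (use assms in \<open>auto intro!: order.trans[OF degree_monom_le] power_increasing\<close>)
  also have "\<dots> < q ^ n"
    using assms by (intro power_strict_increasing) auto
  finally show ?thesis .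
qed

lemma degree_qpoly:
  assumes "q \<ge> 2"
  shows "Polynomial.degree (qpoly q n A) = q ^ n"
proof (cases "n = 0")
  case False
  have "Polynomial.degree (\<Sum>i<n. Polynomial.monom (A i) (q ^ i)) < Polynomial.degree (Polynomial.monom (1::'a) (q ^ n))"
    using degree_qpoly_sum_less[OF assms, of n A] False by (simp add: degree_monom_eq)
  then show ?thesis
    by (simp add: qpoly_def degree_add_eq_left degree_monom_eq)
qed (simp add: qpoly_def degree_monom_eq)

lemma lead_coeff_qpoly:
  assumes "q \<ge> 2"
  shows "Polynomial.lead_coeff (qpoly q n A) = 1"
proof (cases "n = 0")
  case False
  have "poly.coeff (\<Sum>i<n. Polynomial.monom (A i) (q ^ i)) (q ^ n) = 0"
    by (rule coeff_eq_0) (use degree_qpoly_sum_less[OF assms] False in auto)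
  then show ?thesis
    unfolding degree_qpoly[OF assms] by (simp add: qpoly_def)
qed (simp add: qpoly_def degree_monom_eq)

lemma qpoly_nonzero: "q \<ge> 2 \<Longrightarrow> qpoly q n A \<noteq> 0"
  using lead_coeff_qpoly[of q n A] by fastforce

lemma map_poly_qpoly:
  assumes "h 0 = 0" "h 1 = 1" "\<And>x y. h (x + y) = h x + h y"
  shows "map_poly h (qpoly q n A) = qpoly q n (\<lambda>i. h (A i))"
proof (rule poly_eqI)
  have sum: "h (sum g S) = (\<Sum>i\<in>S. h (g i))" for g and S :: "nat set"
    by (induction S rule: infinite_finite_induct) (auto simp: assms)
  fix k
  have "h (if b then x else 0) = (if b then h x else 0)" for b x
    by (simp add: assms(1))
  then show "poly.coeff (map_poly h (qpoly q n A)) k = poly.coeff (qpoly q n (\<lambda>i. h (A i))) k"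
    by (simp add: qpoly_def coeff_map_poly assms sum coeff_sum coeff_monom)
qed

text \<open>A linear factor occurring twice would give a root of the derivative, so the multiset of
  factors is a set and its size, the degree, counts the roots.\<close>

lemma card_roots_alg_closed:
  fixes p :: "'k::alg_closed_field poly"
  assumes "p \<noteq> 0" "\<And>x. poly p x = 0 \<Longrightarrow> poly (pderiv p) x \<noteq> 0"
  shows "card {x. poly p x = 0} = Polynomial.degree p"
proof -
  obtain A where A: "size A = Polynomial.degree p"
    "p = Polynomial.smult (Polynomial.lead_coeff p) (\<Prod>x\<in>#A. [:-x, 1:])"
    using alg_closed_imp_factorization[OF assms(1)] by blast
  have lc: "Polynomial.lead_coeff p \<noteq> 0"
    using assms(1) by simp
  have "poly (\<Prod>x\<in>#B. [:-x, 1:]) z = 0 \<longleftrightarrow> z \<in># B" for B and z :: 'k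
    by (induction B) auto
  then have roots: "{x. poly p x = 0} = set_mset A"
    by (subst A(2)) (use lc in auto)
  have "count A x \<le> 1" if "x \<in># A" for x
  proof (rule ccontr)
    assume "\<not> count A x \<le> 1"
    then have "x \<in># A - {#x#}"
      by (simp add: in_diff_count)
    then obtain B where "A - {#x#} = add_mset x B"
      by (auto dest: multi_member_split)
    then have "A = add_mset x (add_mset x B)"
      using insert_DiffM[OF that] by simp
    then have "p = [:-x, 1:] * ([:-x, 1:] * Polynomial.smult (Polynomial.lead_coeff p) (\<Prod>x\<in>#B. [:-x, 1:]))"
      by (subst A(2)) simp
    then obtain r where p: "p = [:-x, 1:] * ([:-x, 1:] * r)"
      by blast
    have "poly p x = 0" "poly (pderiv p) x = 0"
      unfolding p by (simp_all only: pderiv_mult poly_add poly_mult) simp_all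
    then show False
      using assms(2) by blast
  qed
  then have "count A x = 1" if "x \<in># A" for x
    using that count_greater_eq_one_iff[of A x] by (simp add: order.eq_iff)
  then have "A = mset_set (set_mset A)"
    by (intro multiset_eqI) (auto simp: count_mset_set' not_in_iff)
  then have "size A = card (set_mset A)"
    using size_mset_set[of "set_mset A"] by simp
  then show ?thesis
    using A(1) roots by simp
qed

text \<open>An F_q-algebra is given by the map \<open>emb\<close> of scalars, so that the linear
  algebra is done once and instantiated for the algebraic closures of F_q and of F_q(t), for power
  series and for Laurent series. Power series are not a field, hence the sort
  \<open>idom\<close>.\<close>

locale fin_field_algebra =
  fixes emb :: "'a::{field,finite} \<Rightarrow> 'r::idom" and q :: nat
  assumes q_eq_card: "q = CARD('a)"
    and emb_add: "emb (x + y) = emb x + emb y"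
    and emb_mult: "emb (x * y) = emb x * emb y"
    and emb_1: "emb 1 = 1"
begin

lemma emb_0: "emb 0 = 0"
proof -
  have "emb 0 + emb 0 = emb 0 + 0"
    using emb_add[of 0 0] by simp
  then show ?thesis
    by (rule add_left_imp_eq)
qed

lemma emb_minus: "emb (- x) = - emb x"
  using emb_add[of x "- x"] emb_0 by (intro minus_unique[symmetric]) simp

lemma emb_diff: "emb (x - y) = emb x - emb y"
  using emb_add[of x "- y"] emb_minus[of y] by simp

lemma emb_sum: "emb (sum f A) = (\<Sum>x\<in>A. emb (f x))"
  by (induction A rule: infinite_finite_induct) (auto simp: emb_0 emb_add)

lemma emb_power: "emb (x ^ k) = emb x ^ k"
  by (induction k) (auto simp: emb_1 emb_mult)

lemma emb_of_nat: "emb (of_nat k) = of_nat k"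
  by (induction k) (auto simp: emb_0 emb_1 emb_add)

lemma emb_eq_0_iff: "emb x = 0 \<longleftrightarrow> x = 0"
proof
  assume "emb x = 0"
  then have "emb (x * inverse x) = 0"
    by (simp add: emb_mult)
  then show "x = 0"
    using emb_1 by (cases "x = 0") auto
qed (simp add: emb_0)

lemma q_ge_2: "q \<ge> 2"
  unfolding q_eq_card by (rule card_field_ge_2)

lemma q_power_pos: "q ^ k > 0"
  using q_ge_2 by simp

lemma of_nat_q: "(of_nat q :: 'r) = 0"
proof -
  have "(of_nat (q choose 1) :: 'a) = 0"
    using q_ge_2 unfolding q_eq_card by (intro of_nat_choose_card_eq_0) auto
  then show ?thesis
    using emb_of_nat[of q] emb_0 by simp
qed

lemma power_q_add: "(x + y) ^ q = x ^ q + (y::'r) ^ q"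
proof -
  have "(x + y) ^ q = (\<Sum>k\<le>q. of_nat (q choose k) * x ^ k * y ^ (q - k))"
    by (rule binomial_ring)
  also have "\<dots> = (\<Sum>k\<in>{0,q}. of_nat (q choose k) * x ^ k * y ^ (q - k))"
  proof (intro sum.mono_neutral_right ballI)
    fix k assume "k \<in> {..q} - {0, q}"
    then have "0 < k" "k < q"
      by auto
    then have "(of_nat (q choose k) :: 'r) = 0"
      using of_nat_choose_card_eq_0[of k, where ?'a = 'a, folded q_eq_card] emb_of_nat[of "q choose k"] emb_0 by simp
    then show "of_nat (q choose k) * x ^ k * y ^ (q - k) = 0"
      by simp
  qed auto
  finally show ?thesis
    using q_ge_2 by (simp add: add_ac)
qed

lemma power_qk_add: "(x + y) ^ (q ^ k) = x ^ (q ^ k) + (y::'r) ^ (q ^ k)"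
  by (induction k) (simp_all add: power_mult power_q_add power_Suc2 del: power_Suc)

lemma power_qk_0: "(0::'r) ^ (q ^ k) = 0"
  using q_power_pos by simp

lemma power_qk_minus: "(- x) ^ (q ^ k) = - ((x::'r) ^ (q ^ k))"
proof -
  have "x ^ (q ^ k) + (- x) ^ (q ^ k) = 0"
    using power_qk_add[of x "- x" k] power_qk_0 by simp
  then show ?thesis
    by (rule minus_unique[symmetric])
qed

lemma power_qk_diff: "(x - y) ^ (q ^ k) = x ^ (q ^ k) - (y::'r) ^ (q ^ k)"
  using power_qk_add[of x "- y" k] power_qk_minus[of y k] by simp

lemma power_qk_sum: "(sum f A) ^ (q ^ k) = (\<Sum>i\<in>A. (f i :: 'r) ^ (q ^ k))"
  using q_power_pos by (induction A rule: infinite_finite_induct) (auto simp: power_qk_add)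

lemma power_qk_eq_iff: "x ^ (q ^ k) = (y::'r) ^ (q ^ k) \<longleftrightarrow> x = y"
proof
  assume "x ^ (q ^ k) = y ^ (q ^ k)"
  then have "(x - y) ^ (q ^ k) = 0"
    by (simp add: power_qk_diff)
  then show "x = y"
    by simp
qed simp

lemma emb_power_qk: "emb c ^ (q ^ k) = emb c"
  using finite_field_power_card[of c] unfolding q_eq_card
  by (induction k) (simp_all add: power_mult power_Suc2 del: power_Suc flip: emb_power)

subsection \<open>Additive polynomials\<close>

abbreviation qpol :: "nat \<Rightarrow> (nat \<Rightarrow> 'r) \<Rightarrow> 'r poly" where
  "qpol n A \<equiv> qpoly q n A"

abbreviation qroots :: "nat \<Rightarrow> (nat \<Rightarrow> 'r) \<Rightarrow> 'r set" where
  "qroots n A \<equiv> {x. poly (qpol n A) x = 0}"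

lemma qpoly_add: "poly (qpol n A) (x + y) = poly (qpol n A) x + poly (qpol n A) y"
  by (simp add: poly_qpoly power_qk_add distrib_left sum.distrib)

lemma qpoly_scale: "poly (qpol n A) (emb c * x) = emb c * poly (qpol n A) x"
  by (simp add: poly_qpoly power_mult_distrib emb_power_qk sum_distrib_left algebra_simps)

lemma qpoly_diff: "poly (qpol n A) (x - y) = poly (qpol n A) x - poly (qpol n A) y"
  using qpoly_add[of n A "x - y" y] by simp

lemma qpoly_0: "poly (qpol n A) 0 = 0"
  using qpoly_diff[of n A 0 0] by simp

lemma finite_qroots: "finite (qroots n A)"
  by (intro poly_roots_finite qpoly_nonzero q_ge_2)

lemma card_qroots_le: "card (qroots n A) \<le> q ^ n"
  using card_poly_roots_bound[OF qpoly_nonzero[OF q_ge_2]] degree_qpoly[OF q_ge_2] by metis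

text \<open>Since q is zero in the ring, every monomial with exponent \<open>q ^ i\<close>,
  \<open>i > 0\<close>, has derivative zero.\<close>

lemma pderiv_qpoly:
  assumes "n > 0"
  shows "pderiv (qpol n A) = [:A 0:]"
proof -
  have pd: "pderiv (Polynomial.monom c (q ^ i)) = (if i = 0 then [:c:] else 0)" for c :: 'r and i
    by (auto simp: pderiv_monom of_nat_q monom_0)
  have "pderiv (sum f S) = (\<Sum>i\<in>S. pderiv (f i))" for f :: "nat \<Rightarrow> 'r poly" and S
    by (induction S rule: infinite_finite_induct) (auto simp: pderiv_add)
  then show ?thesis
    using assms by (simp add: qpoly_def pderiv_add pd)
qed

text \<open>The difference of two such monic polynomials has degree below \<open>q ^ n\<close> but
  at least \<open>q ^ n\<close> roots. A basis of the root space therefore determines the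
  polynomial, which is what the count of pairs needs.\<close>

lemma qpoly_coeffs_unique:
  assumes "finite Z" "card Z \<ge> q ^ n" "Z \<subseteq> qroots n A" "Z \<subseteq> qroots n B" "i < n"
  shows "A i = B i"
proof -
  have "n > 0"
    using assms by simp
  define p where "p = (\<Sum>i<n. Polynomial.monom (A i - B i) (q ^ i))"
  have p: "poly p x = 0" if "x \<in> Z" for x
  proof -
    have "poly p x = poly (qpol n A) x - poly (qpol n B) x"
      by (simp add: p_def poly_sum poly_monom poly_qpoly sum_subtractf algebra_simps)
    also have "\<dots> = 0"
      using that assms by (auto dest!: subsetD)
    finally show ?thesis .
  qed
  have "p = 0"
  proof (rule ccontr)
    assume "p \<noteq> 0"
    then have "q ^ n \<le> card {x. poly p x = 0}"
      using assms p by (intro order.trans[OF assms(2)] card_mono poly_roots_finite) auto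
    also have "\<dots> \<le> Polynomial.degree p"
      by (rule card_poly_roots_bound) fact
    also have "\<dots> < q ^ n"
      unfolding p_def by (rule degree_qpoly_sum_less) (use q_ge_2 \<open>n > 0\<close> in auto)
    finally show False
      by simp
  qed
  moreover have "poly.coeff p (q ^ i) = A i - B i"
    using assms(5) q_ge_2 by (simp add: p_def coeff_sum coeff_monom if_distrib power_inject_exp cong: if_cong)
  ultimately show ?thesis
    by simp
qed

subsection \<open>Bases and matrices\<close>

definition lincomb :: "nat \<Rightarrow> (nat \<Rightarrow> 'a) \<Rightarrow> (nat \<Rightarrow> 'r) \<Rightarrow> 'r" where
  "lincomb n c b = (\<Sum>i<n. emb (c i) * b i)"

definition lin_indep :: "nat \<Rightarrow> (nat \<Rightarrow> 'r) \<Rightarrow> bool" where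
  "lin_indep n b \<longleftrightarrow> (\<forall>c. lincomb n c b = 0 \<longrightarrow> (\<forall>i<n. c i = 0))"

definition lspan :: "nat \<Rightarrow> (nat \<Rightarrow> 'r) \<Rightarrow> 'r set" where
  "lspan n b = range (\<lambda>c. lincomb n c b)"

text \<open>The \<open>j\<close>-th entry of the row vector \<open>b\<close> times \<open>M\<close>:
  columns of \<open>M\<close> hold coordinates, as in \<open>galois_matrices\<close>.\<close>

definition tmul :: "nat \<Rightarrow> (nat \<Rightarrow> 'r) \<Rightarrow> 'a mat \<Rightarrow> nat \<Rightarrow> 'r" where
  "tmul n b M j = lincomb n (\<lambda>i. M $$ (i, j)) b"

lemma lincomb_cong:
  "(\<And>i. i < n \<Longrightarrow> c i = c' i) \<Longrightarrow> (\<And>i. i < n \<Longrightarrow> b i = b' i) \<Longrightarrow> lincomb n c b = lincomb n c' b'"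
  by (simp add: lincomb_def)

lemma tmul_cong: "(\<And>i. i < n \<Longrightarrow> b i = b' i) \<Longrightarrow> tmul n b M j = tmul n b' M j"
  unfolding tmul_def by (rule lincomb_cong) auto

lemma lincomb_diff: "lincomb n (\<lambda>i. c i - d i) b = lincomb n c b - lincomb n d b"
  by (simp add: lincomb_def emb_diff left_diff_distrib sum_subtractf)

lemma lincomb_power: "lincomb n c b ^ (q ^ k) = lincomb n c (\<lambda>i. b i ^ (q ^ k))"
  by (simp add: lincomb_def power_qk_sum power_mult_distrib emb_power_qk)

lemma lincomb_Kronecker: "i < n \<Longrightarrow> lincomb n (\<lambda>j. if j = i then 1 else 0) b = b i"
  by (simp add: lincomb_def if_distrib[of emb] emb_0 emb_1 if_distrib[of "\<lambda>x. x * _"] cong: if_cong)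

lemma lin_indepD: "lin_indep n b \<Longrightarrow> lincomb n c b = lincomb n d b \<Longrightarrow> i < n \<Longrightarrow> c i = d i"
  unfolding lin_indep_def using lincomb_diff[of n c d b] by fastforce

lemma lin_indep_cong: "(\<And>i. i < n \<Longrightarrow> b i = b' i) \<Longrightarrow> lin_indep n b \<longleftrightarrow> lin_indep n b'"
proof -
  assume "\<And>i. i < n \<Longrightarrow> b i = b' i"
  then have "lincomb n c b = lincomb n c b'" for c
    by (intro lincomb_cong) auto
  then show ?thesis
    by (simp add: lin_indep_def)
qed

lemma lspan_base: "i < n \<Longrightarrow> b i \<in> lspan n b"
  unfolding lspan_def using lincomb_Kronecker by (metis rangeI)

lemma lspan_PiE: "lspan n b = (\<lambda>c. lincomb n c b) ` ({..<n} \<rightarrow>\<^sub>E UNIV)"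
proof -
  have "lincomb n c b \<in> (\<lambda>c. lincomb n c b) ` ({..<n} \<rightarrow>\<^sub>E UNIV)" for c
    by (rule image_eqI[of _ _ "restrict c {..<n}"]) (auto intro!: lincomb_cong)
  then show ?thesis
    unfolding lspan_def by auto
qed

lemma finite_lspan: "finite (lspan n b)"
  unfolding lspan_PiE by (intro finite_imageI finite_PiE) auto

lemma card_lspan:
  assumes "lin_indep n b"
  shows "card (lspan n b) = q ^ n"
proof -
  have "inj_on (\<lambda>c. lincomb n c b) ({..<n} \<rightarrow>\<^sub>E UNIV)"
    by (rule inj_onI, rule PiE_ext) (use lin_indepD[OF assms] in auto)
  then show ?thesis
    unfolding lspan_PiE by (simp add: card_image card_PiE q_eq_card)
qed

lemma lincomb_closed:
  assumes "0 \<in> Z" "\<And>x y. x \<in> Z \<Longrightarrow> y \<in> Z \<Longrightarrow> x + y \<in> Z" "\<And>c x. x \<in> Z \<Longrightarrow> emb c * x \<in> Z"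
    and "\<And>i. i < n \<Longrightarrow> b i \<in> Z"
  shows "lincomb n c b \<in> Z"
proof -
  have "(\<Sum>i<m. emb (c i) * b i) \<in> Z" if "m \<le> n" for m
    using that by (induction m) (use assms in auto)
  then show ?thesis
    by (simp add: lincomb_def)
qed

lemma lincomb_qroots: "(\<And>i. i < m \<Longrightarrow> b i \<in> qroots n A) \<Longrightarrow> lincomb m c b \<in> qroots n A"
  by (rule lincomb_closed) (auto simp: qpoly_0 qpoly_add qpoly_scale)

lemma lin_indep_extend:
  assumes "lin_indep n b" "z \<notin> lspan n b"
  shows "lin_indep (Suc n) (b(n := z))"
  unfolding lin_indep_def
proof (intro allI impI)
  fix c i assume c: "lincomb (Suc n) c (b(n := z)) = 0" and i: "i < Suc n"
  have eq: "lincomb n c b + emb (c n) * z = 0"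
    using c by (simp add: lincomb_def)
  have cn: "c n = 0"
  proof (rule ccontr)
    assume "c n \<noteq> 0"
    then have "emb (inverse (c n)) * emb (c n) = 1"
      by (simp add: emb_1 flip: emb_mult)
    then have "z = emb (inverse (c n)) * (emb (c n) * z)"
      by (simp flip: mult.assoc)
    also have "emb (c n) * z = - lincomb n c b"
      using eq by (simp add: add_eq_0_iff)
    also have "emb (inverse (c n)) * - lincomb n c b = lincomb n (\<lambda>i. - inverse (c n) * c i) b"
      unfolding lincomb_def sum_negf[symmetric] sum_distrib_left
      by (simp add: emb_mult emb_minus mult.assoc)
    finally show False
      using assms(2) by (auto simp: lspan_def)
  qed
  then have "lincomb n c b = 0"
    using eq emb_0 by simp
  then show "c i = 0"
    using assms(1) i cn by (auto simp: lin_indep_def less_Suc_eq)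
qed

text \<open>An independent family of \<open>m < n\<close> vectors spans only \<open>q ^ m\<close>
  elements of \<open>Z\<close>, so another vector remains to be added; at \<open>m = n\<close> the
  cardinalities force the span to be \<open>Z\<close>.\<close>

lemma basis_exists:
  assumes Z: "finite Z" "card Z = q ^ n"
    and cl: "0 \<in> Z" "\<And>x y. x \<in> Z \<Longrightarrow> y \<in> Z \<Longrightarrow> x + y \<in> Z" "\<And>c x. x \<in> Z \<Longrightarrow> emb c * x \<in> Z"
  shows "\<exists>b. lin_indep n b \<and> lspan n b = Z"
proof -
  have sub: "lspan m b \<subseteq> Z" if "\<And>i. i < m \<Longrightarrow> b i \<in> Z" for m b
    using lincomb_closed[OF cl, of m b] that by (auto simp: lspan_def)
  have "\<exists>b. lin_indep m b \<and> (\<forall>i<m. b i \<in> Z)" if "m \<le> n" for m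
    using that
  proof (induction m)
    case 0
    show ?case
      by (auto simp: lin_indep_def)
  next
    case (Suc m)
    then obtain b where b: "lin_indep m b" "\<forall>i<m. b i \<in> Z"
      by auto
    have "card (lspan m b) < card Z"
      using card_lspan[OF b(1)] Z(2) Suc.prems q_ge_2 by (simp add: power_strict_increasing)
    then obtain z where "z \<in> Z" "z \<notin> lspan m b"
      by (metis card_mono finite_lspan leD subsetI)
    moreover have "(b(m := z)) i \<in> Z" if "i < Suc m" for i
      using that \<open>z \<in> Z\<close> b(2) by (auto simp: less_Suc_eq)
    ultimately show ?case
      using lin_indep_extend[OF b(1)] by blast
  qed
  then obtain b where b: "lin_indep n b" "\<forall>i<n. b i \<in> Z"
    by blast
  have "lspan n b = Z"
    by (rule card_subset_eq) (use Z sub[of n b] b card_lspan in auto)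
  then show ?thesis
    using b by blast
qed

section \<open>Matrices acting on families and change of basis\<close>

lemma lincomb_tmul:
  "lincomb n c (tmul n b M) = lincomb n (\<lambda>i. \<Sum>j<n. M $$ (i, j) * c j) b"
proof -
  have "lincomb n c (tmul n b M) = (\<Sum>j<n. \<Sum>i<n. emb (c j) * (emb (M $$ (i, j)) * b i))"
    by (simp add: lincomb_def tmul_def sum_distrib_left)
  also have "\<dots> = (\<Sum>i<n. \<Sum>j<n. emb (c j) * (emb (M $$ (i, j)) * b i))"
    by (rule sum.swap)
  also have "\<dots> = lincomb n (\<lambda>i. \<Sum>j<n. M $$ (i, j) * c j) b"
    by (simp add: lincomb_def emb_sum emb_mult sum_distrib_right sum_distrib_left mult_ac)
  finally show ?thesis .
qed

lemma tmul_tmul: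
  assumes "M \<in> carrier_mat n n" "N \<in> carrier_mat n n" "j < n"
  shows "tmul n (tmul n b M) N j = tmul n b (M * N) j"
  unfolding tmul_def[of n "tmul n b M" N] lincomb_tmul unfolding tmul_def
  by (rule lincomb_cong) (use assms in \<open>auto simp: scalar_prod_def lessThan_atLeast0\<close>)

lemma tmul_one: "j < n \<Longrightarrow> tmul n b (1\<^sub>m n) j = b j"
  unfolding tmul_def by (subst lincomb_Kronecker[symmetric, of j n b]) (auto intro!: lincomb_cong)

lemma tmul_inject:
  assumes "lin_indep n b" "M \<in> carrier_mat n n" "N \<in> carrier_mat n n"
    and "\<And>j. j < n \<Longrightarrow> tmul n b M j = tmul n b N j"
  shows "M = N"
proof (rule eq_matI)
  fix i j assume "i < dim_row N" "j < dim_col N"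
  then show "M $$ (i, j) = N $$ (i, j)"
    using assms lin_indepD[OF assms(1), of "\<lambda>i. M $$ (i, j)" "\<lambda>i. N $$ (i, j)" i]
    by (auto simp: tmul_def)
qed (use assms in auto)

lemma tmul_exists:
  assumes "\<And>j. j < n \<Longrightarrow> v j \<in> lspan n b"
  shows "\<exists>M\<in>carrier_mat n n. \<forall>j<n. v j = tmul n b M j"
proof -
  have "\<forall>j. \<exists>c. j < n \<longrightarrow> v j = lincomb n c b"
    using assms by (auto simp: lspan_def)
  then obtain c where c: "\<And>j. j < n \<Longrightarrow> v j = lincomb n (c j) b"
    by metis
  show ?thesis
    by (rule bexI[of _ "mat n n (\<lambda>(i, j). c j i)"]) (auto simp: tmul_def c intro!: lincomb_cong)
qed

text \<open>The definition leaves the size of the inverse open; it follows from the dimensions of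
  the two products.\<close>

lemma general_linear_iff:
  "M \<in> general_linear n \<longleftrightarrow>
     M \<in> carrier_mat n n \<and> (\<exists>N\<in>carrier_mat n n. M * N = 1\<^sub>m n \<and> N * M = 1\<^sub>m n)" for M :: "'a mat"
proof
  assume "M \<in> general_linear n"
  then obtain N where M: "M \<in> carrier_mat n n" and N: "M * N = 1\<^sub>m n" "N * M = 1\<^sub>m (dim_row N)"
    unfolding general_linear_def invertible_mat_def inverts_mat_def by auto
  from N(1) have "dim_col N = n"
    by (metis index_mult_mat(3) index_one_mat(3))
  moreover from N(2) M have "dim_row N = n"
    by (metis carrier_matD(2) index_mult_mat(3) index_one_mat(3))
  ultimately show "M \<in> carrier_mat n n \<and> (\<exists>N\<in>carrier_mat n n. M * N = 1\<^sub>m n \<and> N * M = 1\<^sub>m n)"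
    using M N by auto
next
  assume "M \<in> carrier_mat n n \<and> (\<exists>N\<in>carrier_mat n n. M * N = 1\<^sub>m n \<and> N * M = 1\<^sub>m n)"
  then show "M \<in> general_linear n"
    unfolding general_linear_def invertible_mat_def inverts_mat_def by (auto simp: square_mat.simps)
qed

lemma lin_indep_tmul:
  assumes "lin_indep n b" "M \<in> general_linear n"
  shows "lin_indep n (tmul n b M)"
proof -
  obtain N where M: "M \<in> carrier_mat n n" and N: "N \<in> carrier_mat n n" "N * M = 1\<^sub>m n"
    using assms(2) general_linear_iff by blast
  show ?thesis
    unfolding lin_indep_def
  proof (intro allI impI)
    fix c i assume "lincomb n c (tmul n b M) = 0" "i < n"
    then have "(\<Sum>j<n. M $$ (k, j) * c j) = 0" if "k < n" for k
      using assms(1) that unfolding lincomb_tmul lin_indep_def by blast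
    then have "M *\<^sub>v vec n c = 0\<^sub>v n"
      using M by (intro eq_vecI) (auto simp: scalar_prod_def lessThan_atLeast0)
    then have "(N * M) *\<^sub>v vec n c = 0\<^sub>v n"
      using assoc_mult_mat_vec[OF N(1) M, of "vec n c"] N by auto
    then show "c i = 0"
      using \<open>i < n\<close> N(2) by (metis index_vec index_zero_vec(1) one_mult_mat_vec vec_carrier)
  qed
qed

text \<open>Both families span \<open>q ^ n\<close> elements, so the inclusion of spans is an
  equality and \<open>b\<close> can in turn be expressed in \<open>b'\<close>; the two coordinate
  matrices are inverse to each other.\<close>

lemma general_linear_basis_change:
  assumes "lin_indep n b" "lin_indep n b'" "\<And>j. j < n \<Longrightarrow> b' j \<in> lspan n b"
  shows "\<exists>M\<in>general_linear n. \<forall>j<n. b' j = tmul n b M j"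
proof -
  obtain M where M: "M \<in> carrier_mat n n" "\<And>j. j < n \<Longrightarrow> b' j = tmul n b M j"
    using tmul_exists[of n b' b] assms(3) by metis
  have "lspan n b' \<subseteq> lspan n b"
  proof
    fix x assume "x \<in> lspan n b'"
    then obtain c where "x = lincomb n c b'"
      by (auto simp: lspan_def)
    also have "\<dots> = lincomb n c (tmul n b M)"
      by (rule lincomb_cong) (auto simp: M)
    finally show "x \<in> lspan n b"
      by (auto simp: lincomb_tmul lspan_def)
  qed
  then have "lspan n b' = lspan n b"
    by (intro card_subset_eq) (auto simp: finite_lspan card_lspan assms)
  then obtain N where N: "N \<in> carrier_mat n n" "\<And>j. j < n \<Longrightarrow> b j = tmul n b' N j"
    using tmul_exists[of n b b'] lspan_base[of _ n b] by metis
  have "M * N = 1\<^sub>m n"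
  proof (rule tmul_inject[OF assms(1)])
    fix j assume j: "j < n"
    have "tmul n b (M * N) j = tmul n (tmul n b M) N j"
      using M N j by (simp add: tmul_tmul)
    also have "\<dots> = tmul n b' N j"
      by (rule tmul_cong) (simp add: M)
    finally show "tmul n b (M * N) j = tmul n b (1\<^sub>m n) j"
      using N j by (simp add: tmul_one)
  qed (use M N in auto)
  then have "M \<in> general_linear n"
    unfolding general_linear_iff using M N mat_mult_left_right_inverse by blast
  then show ?thesis
    using M by blast
qed

end

lemma (in fin_field_algebra) qroots_subspace:
  "0 \<in> qroots n A" "x \<in> qroots n A \<Longrightarrow> y \<in> qroots n A \<Longrightarrow> x + y \<in> qroots n A"
  "x \<in> qroots n A \<Longrightarrow> emb c * x \<in> qroots n A"
  by (auto simp: qpoly_0 qpoly_add qpoly_scale)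

lemma (in fin_field_algebra) qroots_basis_exists:
  assumes "card (qroots n A) = q ^ n"
  shows "\<exists>b. lin_indep n b \<and> lspan n b = qroots n A"
  by (rule basis_exists[OF finite_qroots assms qroots_subspace])

text \<open>\<open>n\<close> independent roots already generate \<open>q ^ n\<close> of them, and
  the degree allows no more.\<close>

lemma (in fin_field_algebra) lspan_eq_qroots:
  assumes "lin_indep n b" "\<And>i. i < n \<Longrightarrow> b i \<in> qroots n A"
  shows "lspan n b = qroots n A"
proof (rule card_seteq)
  show "lspan n b \<subseteq> qroots n A"
    unfolding lspan_def using lincomb_qroots[of n b n A] assms(2) by auto
  show "card (qroots n A) \<le> card (lspan n b)"
    using card_lspan[OF assms(1)] card_qroots_le by simp
qed (rule finite_qroots)

locale fin_field_alg_closed = fin_field_algebra emb q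
  for emb :: "'a::{field,finite} \<Rightarrow> 'r::alg_closed_field" and q
begin

text \<open>The derivative is the constant \<open>A 0\<close>, so a nonzero linear coefficient makes
  all roots simple.\<close>

lemma card_qroots:
  assumes "n > 0" "A 0 \<noteq> 0"
  shows "card (qroots n A) = q ^ n"
  using card_roots_alg_closed[OF qpoly_nonzero[OF q_ge_2, of n A]] pderiv_qpoly[OF assms(1), of A]
    assms(2) degree_qpoly[OF q_ge_2, of n A] by simp

end

global_interpretation alg_closure: fin_field_alg_closed "to_ac :: 'a::{field,finite} \<Rightarrow> 'a alg_closure" "CARD('a)"
  by unfold_locales simp_all

section \<open>Frobenius elements over a finite field\<close>

lemma finite_carrier_mat: "finite (carrier_mat n m :: 'a::finite mat set)"
proof (rule finite_subset)
  show "(carrier_mat n m :: 'a mat set) \<subseteq> (\<lambda>f. mat n m f) ` ({..<n} \<times> {..<m} \<rightarrow>\<^sub>E UNIV)"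
  proof
    fix M :: "'a mat" assume "M \<in> carrier_mat n m"
    then show "M \<in> (\<lambda>f. mat n m f) ` ({..<n} \<times> {..<m} \<rightarrow>\<^sub>E UNIV)"
      by (intro image_eqI[of _ _ "restrict (\<lambda>p. M $$ p) ({..<n} \<times> {..<m})"] eq_matI) auto
  qed
  show "finite ((\<lambda>f. mat n m f) ` ({..<n} \<times> {..<m} \<rightarrow>\<^sub>E (UNIV :: 'a set)))"
    by (intro finite_imageI finite_PiE) auto
qed

lemma finite_general_linear: "finite (general_linear n :: 'a::{field,finite} mat set)"
  by (rule finite_subset[OF _ finite_carrier_mat]) (auto simp: general_linear_def)

lemma one_mat_general_linear: "1\<^sub>m n \<in> general_linear n"
  by (auto simp: general_linear_def invertible_mat_def inverts_mat_def square_mat.simps intro!: exI[of _ "1\<^sub>m n"])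

context fin_field_alg_closed
begin

text \<open>For \<open>r > 0\<close> this is the copy of the field with \<open>q ^ r\<close>
  elements; for \<open>r = 0\<close> it is the whole algebraically closed field.\<close>

definition fixed_field :: "nat \<Rightarrow> 'r set" where
  "fixed_field r = {x. x ^ (q ^ r) = x}"

text \<open>\<open>X ^ (q ^ r) - X\<close> is itself additive with linear coefficient
  \<open>-1\<close>, so its roots are already counted.\<close>

lemma fixed_field_eq_qroots:
  assumes "r > 0"
  shows "fixed_field r = qroots r (\<lambda>i. if i = 0 then - 1 else 0)"
proof -
  have "poly (qpol r (\<lambda>i. if i = 0 then - 1 else 0)) x = x ^ (q ^ r) - x" for x
  proof -
    have "(\<Sum>i<r. (if i = 0 then - 1 else 0) * x ^ (q ^ i)) = (\<Sum>i\<in>{0}. (if i = 0 then - 1 else 0) * x ^ (q ^ i))"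
      by (rule sum.mono_neutral_right) (use assms in auto)
    then show ?thesis
      by (simp add: poly_qpoly)
  qed
  then show ?thesis
    by (auto simp: fixed_field_def)
qed

lemma card_fixed_field: "r > 0 \<Longrightarrow> card (fixed_field r) = q ^ r"
  by (simp add: fixed_field_eq_qroots card_qroots)

lemma finite_fixed_field: "r > 0 \<Longrightarrow> finite (fixed_field r)"
  by (simp add: fixed_field_eq_qroots finite_qroots)

lemma emb_fixed_field: "emb c \<in> fixed_field r"
  by (simp add: fixed_field_def emb_power_qk)

lemma fixed_field_closed:
  "x \<in> fixed_field r \<Longrightarrow> y \<in> fixed_field r \<Longrightarrow> x + y \<in> fixed_field r"
  "x \<in> fixed_field r \<Longrightarrow> y \<in> fixed_field r \<Longrightarrow> x * y \<in> fixed_field r"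
  "0 \<in> fixed_field r"
  by (auto simp: fixed_field_def power_qk_add power_mult_distrib power_qk_0)

text \<open>Coefficients in the fixed field are unchanged by the \<open>q ^ r\<close>-power map,
  which therefore commutes with the polynomial and sends roots to roots.\<close>

lemma qpol_power:
  assumes "\<And>i. i < n \<Longrightarrow> A i \<in> fixed_field r"
  shows "poly (qpol n A) (x ^ (q ^ r)) = poly (qpol n A) x ^ (q ^ r)"
proof -
  have "(A i * x ^ (q ^ i)) ^ (q ^ r) = A i * (x ^ (q ^ r)) ^ (q ^ i)" if "i < n" for i
    using assms[OF that] by (simp add: fixed_field_def power_mult_distrib mult.commute flip: power_mult)
  then show ?thesis
    by (simp add: poly_qpoly power_qk_add power_qk_sum mult.commute[of "q ^ n"] flip: power_mult)
qed

definition frob_matrix :: "nat \<Rightarrow> nat \<Rightarrow> (nat \<Rightarrow> 'r) \<Rightarrow> 'a mat \<Rightarrow> bool" where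
  "frob_matrix r n A g \<longleftrightarrow> (\<exists>b. lin_indep n b \<and> (\<forall>j<n. b j \<in> qroots n A) \<and>
     (\<forall>j<n. b j ^ (q ^ r) = tmul n b g j))"

text \<open>The power map respects linear combinations over F_q and preserves the roots, so it
  carries a basis of the root space to another basis.\<close>

lemma frob_matrix_exists:
  assumes "\<And>i. i < n \<Longrightarrow> A i \<in> fixed_field r" "lin_indep n b" "\<And>j. j < n \<Longrightarrow> b j \<in> qroots n A"
  shows "\<exists>g\<in>general_linear n. \<forall>j<n. b j ^ (q ^ r) = tmul n b g j"
proof -
  have "lin_indep n (\<lambda>j. b j ^ (q ^ r))"
    using assms(2) by (simp add: lin_indep_def flip: lincomb_power)
  moreover have "b j ^ (q ^ r) \<in> lspan n b" if "j < n" for j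
  proof -
    have "lspan n b = qroots n A"
      by (rule lspan_eq_qroots[OF assms(2,3)])
    moreover have "poly (qpol n A) (b j ^ (q ^ r)) = poly (qpol n A) (b j) ^ (q ^ r)"
      by (rule qpol_power[OF assms(1)])
    ultimately show ?thesis
      using assms(3)[OF that] power_qk_0[of r] by simp
  qed
  ultimately show ?thesis
    by (rule general_linear_basis_change[OF assms(2)])
qed

text \<open>The solutions of \<open>v\<^sup>Q = v g\<close> span a space of dimension at most \<open>n\<close> over the algebraic
  closure; their coordinates in a basis consisting of solutions are fixed by the Frobenius map,
  because \<open>g\<close> is invertible.\<close>

lemma card_frobenius_solutions:
  assumes r: "r > 0" and g: "g \<in> general_linear n"
  shows "finite {v. (\<forall>i\<ge>n. v i = 0) \<and> (\<forall>j<n. v j ^ (q ^ r) = tmul n v g j)}" (is "finite ?\<Phi>")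
    and "card {v. (\<forall>i\<ge>n. v i = 0) \<and> (\<forall>j<n. v j ^ (q ^ r) = tmul n v g j)} \<le> (q ^ r) ^ n"
proof -
  define sc :: "'r \<Rightarrow> (nat \<Rightarrow> 'r) \<Rightarrow> nat \<Rightarrow> 'r" where "sc = (\<lambda>c f i. c * f i)"
  interpret V: vector_space sc
    by unfold_locales (auto simp: sc_def fun_eq_iff algebra_simps)
  have sum_app: "(\<Sum>w\<in>S. sc (u w) w) i = (\<Sum>w\<in>S. u w * w i)" for S u i
    by (induction S rule: infinite_finite_induct) (auto simp: sc_def)
  \<comment> \<open>The basis is taken from within the solution set, so each basis vector itself
    satisfies the Frobenius equation.\<close>
  obtain B where B: "B \<subseteq> ?\<Phi>" "V.independent B" "?\<Phi> \<subseteq> V.span B"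
    using V.maximal_independent_subset[of ?\<Phi>] by blast
  define E where "E = (\<lambda>i j. if j = i then 1 else 0 :: 'r) ` {..<n}"
  have "v \<in> V.span E" if v: "v \<in> ?\<Phi>" for v
  proof -
    have "v = (\<Sum>i<n. sc (v i) (\<lambda>j. if j = i then 1 else 0))"
    proof
      fix k
      have "(\<Sum>i\<in>S. sc (v i) (\<lambda>j. if j = i then 1 else 0)) k = (\<Sum>i\<in>S. if k = i then v i else 0)" for S
        by (induction S rule: infinite_finite_induct) (auto simp: sc_def)
      then show "v k = (\<Sum>i<n. sc (v i) (\<lambda>j. if j = i then 1 else 0)) k"
        using v by auto
    qed
    also have "\<dots> \<in> V.span E"
      by (intro V.span_sum V.span_scale V.span_base) (auto simp: E_def)
    finally show ?thesis .
  qed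
  then have "finite B \<and> card B \<le> card E"
    using B by (intro V.independent_span_bound) (auto simp: E_def)
  moreover have "card E \<le> n"
    unfolding E_def using card_image_le[of "{..<n}"] by fastforce
  ultimately have finB: "finite B" and cardB: "card B \<le> n"
    by auto
  have sub: "?\<Phi> \<subseteq> (\<lambda>u. \<Sum>w\<in>B. sc (u w) w) ` (B \<rightarrow>\<^sub>E fixed_field r)"
  proof
    fix v assume v: "v \<in> ?\<Phi>"
    then obtain u where u: "v = (\<Sum>w\<in>B. sc (u w) w)"
      using B(3) V.span_finite[OF finB] by blast
    have tm: "tmul n (\<lambda>i. \<Sum>w\<in>B. x w * w i) M j = (\<Sum>w\<in>B. x w * tmul n w M j)" for x M j
    proof -
      have "tmul n (\<lambda>i. \<Sum>w\<in>B. x w * w i) M j = (\<Sum>i<n. \<Sum>w\<in>B. x w * (emb (M $$ (i, j)) * w i))"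
        by (simp add: tmul_def lincomb_def sum_distrib_left mult_ac)
      also have "\<dots> = (\<Sum>w\<in>B. \<Sum>i<n. x w * (emb (M $$ (i, j)) * w i))"
        by (rule sum.swap)
      finally show ?thesis
        by (simp add: tmul_def lincomb_def sum_distrib_left)
    qed
    \<comment> \<open>Raising \<open>v\<close> to the power \<open>q ^ r\<close> in coordinates and
      comparing with \<open>v g\<close> shows that \<open>y g = 0\<close>. Invertibility of
      \<open>g\<close> and independence of \<open>B\<close> then give
      \<open>u w ^ (q ^ r) = u w\<close>.\<close>
    define y where "y = (\<lambda>i. \<Sum>w\<in>B. (u w ^ (q ^ r) - u w) * w i)"
    have vi: "v i = (\<Sum>w\<in>B. u w * w i)" for i
      unfolding u by (rule sum_app)
    have yg: "tmul n y g j = 0" if j: "j < n" for j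
    proof -
      have "(\<Sum>w\<in>B. u w ^ (q ^ r) * tmul n w g j) = (\<Sum>w\<in>B. (u w * w j) ^ (q ^ r))"
        by (rule sum.cong) (use B(1) j in \<open>auto simp: power_mult_distrib\<close>)
      also have "\<dots> = v j ^ (q ^ r)"
        by (simp add: vi power_qk_sum)
      also have "\<dots> = tmul n v g j"
        using v j by auto
      also have "\<dots> = tmul n (\<lambda>i. \<Sum>w\<in>B. u w * w i) g j"
        by (rule tmul_cong) (rule vi)
      also have "\<dots> = (\<Sum>w\<in>B. u w * tmul n w g j)"
        by (rule tm)
      finally show ?thesis
        unfolding y_def tm by (simp add: left_diff_distrib sum_subtractf)
    qed
    obtain h where h: "g \<in> carrier_mat n n" "h \<in> carrier_mat n n" "g * h = 1\<^sub>m n"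
      using g general_linear_iff by blast
    have y0: "y i = 0" for i
    proof (cases "i < n")
      case True
      have "y i = tmul n (tmul n y g) h i"
        using True h by (simp add: tmul_tmul tmul_one)
      also have "\<dots> = tmul n (\<lambda>_. 0) h i"
        by (rule tmul_cong) (rule yg)
      finally show ?thesis
        by (simp add: tmul_def lincomb_def)
    next
      case False
      then show ?thesis
        unfolding y_def using B(1) by (intro sum.neutral) auto
    qed
    have "(\<Sum>w\<in>B. sc (u w ^ (q ^ r) - u w) w) = 0"
      using y0 by (auto simp: fun_eq_iff sum_app y_def)
    then have uw: "u w \<in> fixed_field r" if "w \<in> B" for w
      using V.independentD[OF B(2) finB subset_refl, of "\<lambda>w. u w ^ (q ^ r) - u w" w] that
      by (simp add: fixed_field_def)
    show "v \<in> (\<lambda>u. \<Sum>w\<in>B. sc (u w) w) ` (B \<rightarrow>\<^sub>E fixed_field r)"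
      unfolding u by (rule image_eqI[of _ _ "restrict u B"]) (use uw in auto)
  qed
  have fin: "finite (B \<rightarrow>\<^sub>E fixed_field r)"
    using finB finite_fixed_field[OF r] by (intro finite_PiE) auto
  then show "finite ?\<Phi>"
    using sub finite_surj by blast
  have "card ?\<Phi> \<le> card (B \<rightarrow>\<^sub>E fixed_field r)"
    using sub fin by (rule surj_card_le[rotated])
  also have "\<dots> = (q ^ r) ^ card B"
    using finB r by (simp add: card_PiE card_fixed_field)
  also have "\<dots> \<le> (q ^ r) ^ n"
    using cardB q_power_pos by (intro power_increasing) (auto simp: Suc_le_eq)
  finally show "card ?\<Phi> \<le> (q ^ r) ^ n" .
qed

text \<open>Count the pairs \<open>(A, b)\<close> of a polynomial and a basis of its roots: each of the
  \<open>Q\<^sup>n - Q\<^bsup>n-1\<^esup>\<close> separable polynomials has \<open>|GL\<^sub>n(q)|\<close> bases, while each matrix arises from at most \<open>Q\<^sup>n\<close>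
  pairs, so no matrix can arise much less often than the average.\<close>

lemma card_frob_matrix:
  assumes r: "r > 0" and n: "n > 0" and g: "g \<in> general_linear n"
    and big: "q ^ r \<ge> 2 * card (general_linear n :: 'a mat set)"
  shows "(q ^ r) ^ n \<le> 2 * (q ^ n) ^ n *
    card {A \<in> PiE_dflt {..<n} 0 (\<lambda>_. fixed_field r). A 0 \<noteq> 0 \<and> frob_matrix r n A g}"
proof -
  define Q where "Q = q ^ r"
  define N where "N = card (general_linear n :: 'a mat set)"
  define T where "T = {A \<in> PiE_dflt {..<n} 0 (\<lambda>_. fixed_field r). A 0 \<noteq> 0}"
  define Bs where "Bs = (\<lambda>A. {b \<in> PiE_dflt {..<n} 0 (\<lambda>_. qroots n A). lin_indep n b})"
  \<comment> \<open>The pairs in which Frobenius acts on the chosen basis by \<open>h\<close>; they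
    cover all pairs as \<open>h\<close> runs over the general linear group.\<close>
  define S where "S = (\<lambda>h. {(A, b) \<in> Sigma T Bs. \<forall>j<n. b j ^ Q = tmul n b h j})"
  have finT: "finite T"
    unfolding T_def using finite_fixed_field[OF r] by (intro finite_Collect_conjI finite_PiE_dflt disjI1) auto
  have finP: "finite (PiE_dflt {..<n} 0 (\<lambda>_. qroots n A))" for A
    using finite_qroots by (intro finite_PiE_dflt) auto
  then have finB: "finite (Bs A)" for A
    unfolding Bs_def by simp
  have TD: "A 0 \<noteq> 0" "\<And>i. i < n \<Longrightarrow> A i \<in> fixed_field r" "\<And>i. i \<ge> n \<Longrightarrow> A i = 0" if "A \<in> T" for A
    using that by (auto simp: T_def PiE_dflt_def)
  have BD: "lin_indep n b" "\<And>i. i < n \<Longrightarrow> b i \<in> qroots n A" "\<And>i. i \<ge> n \<Longrightarrow> b i = 0" if "b \<in> Bs A" for A b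
    using that by (auto simp: Bs_def PiE_dflt_def)
  have cardT: "card T = (Q - 1) * Q ^ (n - 1)"
  proof -
    have "T = PiE_dflt {..<n} 0 (\<lambda>i. if i = 0 then fixed_field r - {0} else fixed_field r)"
      using n by (auto simp: T_def PiE_dflt_def split: if_splits)
    then have "card T = (\<Prod>i<n. card (if i = 0 then fixed_field r - {0} else fixed_field r))"
      using finite_fixed_field[OF r] by (simp add: card_PiE_dflt)
    also have "{..<n} = insert 0 {0<..<n}"
      using n by auto
    also have "(\<Prod>i\<in>insert 0 {0<..<n}. card (if i = 0 then fixed_field r - {0} else fixed_field r)) =
        (Q - 1) * (\<Prod>i\<in>{0<..<n}. Q)"
      using r by (simp add: card_fixed_field Q_def fixed_field_closed(3) card_Diff_singleton)
    finally show ?thesis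
      by simp
  qed
  have cardB: "N \<le> card (Bs A)" "card (Bs A) \<le> (q ^ n) ^ n" if A: "A \<in> T" for A
  proof -
    have cq: "card (qroots n A) = q ^ n"
      using card_qroots n TD(1)[OF A] by blast
    obtain b where b: "lin_indep n b" "lspan n b = qroots n A"
      using qroots_basis_exists[OF cq] by blast
    define f where "f = (\<lambda>M j. if j < n then tmul n b M j else 0)"
    have "inj_on f (general_linear n)"
      by (rule inj_onI, rule tmul_inject[OF b(1)]) (auto simp: f_def fun_eq_iff general_linear_def split: if_splits)
    moreover have "f ` general_linear n \<subseteq> Bs A"
    proof (rule image_subsetI)
      fix M :: "'a mat" assume M: "M \<in> general_linear n"
      have "lin_indep n (f M)"
        using lin_indep_cong[of n "f M" "tmul n b M"] lin_indep_tmul[OF b(1) M] by (simp add: f_def)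
      moreover have "f M j \<in> qroots n A" if "j < n" for j
        unfolding b(2)[symmetric] using that by (simp add: f_def tmul_def lspan_def)
      ultimately show "f M \<in> Bs A"
        by (auto simp: Bs_def PiE_dflt_def f_def)
    qed
    ultimately show "N \<le> card (Bs A)"
      unfolding N_def using finB by (intro card_inj_on_le)
    \<comment> \<open>A crude bound: each of the \<open>n\<close> basis vectors is one of
      \<open>q ^ n\<close> roots. This is the origin of \<open>(q ^ n) ^ n\<close> in the final
      constant.\<close>
    have "card (Bs A) \<le> card (PiE_dflt {..<n} 0 (\<lambda>_. qroots n A))"
      unfolding Bs_def using finP by (intro card_mono) auto
    then show "card (Bs A) \<le> (q ^ n) ^ n"
      using finite_qroots by (simp add: card_PiE_dflt cq)
  qed
  have finS: "finite (Sigma T Bs)"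
    using finT finB by auto
  have "N * ((Q - 1) * Q ^ (n - 1)) \<le> (\<Sum>A\<in>T. card (Bs A))"
    using sum_bounded_below[of T N "\<lambda>A. card (Bs A)"] cardB cardT by (simp add: mult.commute)
  also have "\<dots> = card (Sigma T Bs)"
    using finT finB by simp
  also have "Sigma T Bs \<subseteq> (\<Union>h\<in>general_linear n. S h)"
  proof
    fix p assume p: "p \<in> Sigma T Bs"
    then obtain A b where [simp]: "p = (A, b)" and Ab: "A \<in> T" "b \<in> Bs A"
      by auto
    show "p \<in> (\<Union>h\<in>general_linear n. S h)"
      using frob_matrix_exists[of n A r b] TD[OF Ab(1)] BD[OF Ab(2)] Ab by (auto simp: S_def Q_def)
  qed
  then have "card (Sigma T Bs) \<le> card (\<Union>h\<in>general_linear n. S h)"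
    by (intro card_mono finite_UN_I finite_general_linear finite_subset[OF _ finS]) (auto simp: S_def)
  also have "\<dots> \<le> (\<Sum>h\<in>general_linear n. card (S h))"
    by (intro card_UN_le finite_general_linear)
  also have "\<dots> = card (S g) + (\<Sum>h\<in>general_linear n - {g}. card (S h))"
    using finite_general_linear g by (rule sum.remove)
  also have "(\<Sum>h\<in>general_linear n - {g}. card (S h)) \<le> (\<Sum>h\<in>general_linear n - {g}. Q ^ n)"
  proof (rule sum_mono)
    fix h :: "'a mat" assume "h \<in> general_linear n - {g}"
    then have h: "h \<in> general_linear n"
      by simp
    \<comment> \<open>A basis determines its polynomial, so the pairs in \<open>S h\<close> are
      counted by their bases, and these solve the Frobenius equation for \<open>h\<close>.\<close>
    have "inj_on snd (S h)"
    proof (rule inj_onI)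
      fix x y assume xy: "x \<in> S h" "y \<in> S h" "snd x = snd y"
      then obtain A A' b where [simp]: "x = (A, b)" "y = (A', b)"
        and A: "A \<in> T" "b \<in> Bs A" and A': "A' \<in> T" "b \<in> Bs A'"
        by (cases x; cases y) (auto simp: S_def)
      have "A i = A' i" if "i < n" for i
      proof (rule qpoly_coeffs_unique[OF _ _ _ _ that])
        show "finite (lspan n b)" "q ^ n \<le> card (lspan n b)"
          using finite_lspan card_lspan[OF BD(1)[OF A(2)]] by auto
        show "lspan n b \<subseteq> qroots n A" "lspan n b \<subseteq> qroots n A'"
          using lspan_eq_qroots[OF BD(1,2)[OF A(2)]] lspan_eq_qroots[OF BD(1,2)[OF A'(2)]] by auto
      qed
      moreover have "A i = A' i" if "\<not> i < n" for i
        using that TD(3)[OF A(1)] TD(3)[OF A'(1)] by auto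
      ultimately show "x = y"
        by (auto simp: fun_eq_iff)
    qed
    moreover have "snd ` S h \<subseteq> {v. (\<forall>i\<ge>n. v i = 0) \<and> (\<forall>j<n. v j ^ (q ^ r) = tmul n v h j)}"
      using BD(3) by (auto simp: S_def Q_def)
    ultimately have "card (S h) \<le> card {v. (\<forall>i\<ge>n. v i = 0) \<and> (\<forall>j<n. v j ^ (q ^ r) = tmul n v h j)}"
      by (rule card_inj_on_le[OF _ _ card_frobenius_solutions(1)[OF r h]])
    also have "\<dots> \<le> Q ^ n"
      unfolding Q_def by (rule card_frobenius_solutions(2)[OF r h])
    finally show "card (S h) \<le> Q ^ n" .
  qed
  also have "\<dots> = (N - 1) * Q ^ n"
    using finite_general_linear g by (simp add: N_def card_Diff_singleton)
  also have "S g \<subseteq> Sigma {A \<in> T. frob_matrix r n A g} Bs"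
  proof
    fix p assume "p \<in> S g"
    then obtain A b where p: "p = (A, b)" "A \<in> T" "b \<in> Bs A" "\<forall>j<n. b j ^ (q ^ r) = tmul n b g j"
      by (auto simp: S_def Q_def)
    then have "frob_matrix r n A g"
      unfolding frob_matrix_def using BD(1,2)[OF p(3)] by blast
    then show "p \<in> Sigma {A \<in> T. frob_matrix r n A g} Bs"
      using p by simp
  qed
  then have "card (S g) \<le> card (Sigma {A \<in> T. frob_matrix r n A g} Bs)"
    using finT finB by (intro card_mono) auto
  also have "\<dots> = (\<Sum>A\<in>{A \<in> T. frob_matrix r n A g}. card (Bs A))"
    using finT finB by simp
  also have "\<dots> \<le> (q ^ n) ^ n * card {A \<in> T. frob_matrix r n A g}"
    using sum_bounded_above[of "{A \<in> T. frob_matrix r n A g}" "\<lambda>A. card (Bs A)" "(q ^ n) ^ n"] cardB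
    by (simp add: mult.commute)
  finally have *: "N * ((Q - 1) * Q ^ (n - 1)) \<le>
      (q ^ n) ^ n * card {A \<in> T. frob_matrix r n A g} + (N - 1) * Q ^ n"
    by simp
  have N1: "N \<ge> 1"
    unfolding N_def using g finite_general_linear[where ?'a = 'a] by (auto simp: Suc_le_eq card_gt_0_iff)
  have Q1: "Q \<ge> 1" "Q \<ge> 2 * N"
    using q_power_pos[of r] big by (auto simp: Q_def N_def Suc_le_eq)
  obtain m where m: "n = Suc m"
    using n by (cases n) auto
  have "N * (Q * Q ^ m) \<le> (q ^ n) ^ n * card {A \<in> T. frob_matrix r n A g} + (N - 1) * (Q * Q ^ m) + N * Q ^ m"
    using * Q1(1) by (simp add: m diff_mult_distrib diff_mult_distrib2)
  moreover have "N * (Q * Q ^ m) = Q * Q ^ m + (N - 1) * (Q * Q ^ m)"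
    using N1 by (cases N) auto
  \<comment> \<open>The deficit \<open>N * Q ^ (n - 1)\<close> caused by excluding
    \<open>A 0 = 0\<close> is at most half of \<open>Q ^ n\<close>; hence the factor 2 in the
    conclusion.\<close>
  moreover have "2 * (N * Q ^ m) \<le> Q * Q ^ m"
    using mult_right_mono[OF Q1(2), of "Q ^ m"] by simp
  ultimately have "Q ^ n \<le> 2 * ((q ^ n) ^ n * card {A \<in> T. frob_matrix r n A g})"
    unfolding m power_Suc by linarith
  moreover have "{A \<in> T. frob_matrix r n A g} =
      {A \<in> PiE_dflt {..<n} 0 (\<lambda>_. fixed_field r). A 0 \<noteq> 0 \<and> frob_matrix r n A g}"
    by (auto simp: T_def)
  ultimately show ?thesis
    by (simp add: Q_def mult.assoc)
qed

end

section \<open>Extending embeddings to splitting fields\<close>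

text \<open>Negatives come from the scalar \<open>-1\<close> and inverses from algebraicity over the
  base field, so these sets are the intermediate fields of the algebraic closure.\<close>

definition subalgebra :: "'k::field alg_closure set \<Rightarrow> bool" where
  "subalgebra E \<longleftrightarrow> range to_ac \<subseteq> E \<and> (\<forall>x\<in>E. \<forall>y\<in>E. x + y \<in> E \<and> x * y \<in> E)"

lemma subalgebraD:
  assumes "subalgebra E"
  shows "to_ac c \<in> E" "0 \<in> E" "1 \<in> E" "x \<in> E \<Longrightarrow> y \<in> E \<Longrightarrow> x + y \<in> E"
    "x \<in> E \<Longrightarrow> y \<in> E \<Longrightarrow> x * y \<in> E" "x \<in> E \<Longrightarrow> - x \<in> E" "x \<in> E \<Longrightarrow> y \<in> E \<Longrightarrow> x - y \<in> E"
proof -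
  have c: "to_ac c \<in> E" for c
    using assms by (auto simp: subalgebra_def)
  show add: "x \<in> E \<Longrightarrow> y \<in> E \<Longrightarrow> x + y \<in> E" and mult: "x \<in> E \<Longrightarrow> y \<in> E \<Longrightarrow> x * y \<in> E" for x y
    using assms by (auto simp: subalgebra_def)
  show "0 \<in> E" "1 \<in> E" "to_ac c \<in> E"
    using c[of 0] c[of 1] c[of c] by simp_all
  show minus: "- x \<in> E" if "x \<in> E" for x
    using mult[OF c[of "- 1"] that] by simp
  show "x - y \<in> E" if "x \<in> E" "y \<in> E"
    using add[OF that(1) minus[OF that(2)]] by simp
qed

lemma subalgebra_sum: "subalgebra E \<Longrightarrow> (\<And>i. i \<in> S \<Longrightarrow> f i \<in> E) \<Longrightarrow> sum f S \<in> E"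
  by (induction S rule: infinite_finite_induct) (auto simp: subalgebraD)

lemma subalgebra_power: "subalgebra E \<Longrightarrow> x \<in> E \<Longrightarrow> x ^ k \<in> E"
  by (induction k) (auto simp: subalgebraD)

text \<open>An intermediate field is a set and not a type, so its polynomials are those of the whole
  closure with restricted coefficients.\<close>

definition poly_over :: "'r::zero set \<Rightarrow> 'r poly set" where
  "poly_over E = {p. \<forall>i. poly.coeff p i \<in> E}"

lemma poly_in_subalgebra:
  assumes "subalgebra E" "p \<in> poly_over E" "x \<in> E"
  shows "poly p x \<in> E"
  unfolding poly_altdef using assms
  by (intro subalgebra_sum) (auto simp: poly_over_def subalgebraD subalgebra_power)

text \<open>The inverse of an algebraic element is a polynomial in it.\<close>

lemma subalgebra_inverse:
  assumes E: "subalgebra E" and x: "x \<in> E"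
  shows "inverse x \<in> E"
proof (cases "x = 0")
  case False
  have "inverse x \<in> E" if "p \<noteq> 0" "poly (map_poly to_ac p) x = 0" for p
    using that
  proof (induction "Polynomial.degree p" arbitrary: p rule: less_induct)
    case less
    obtain c r where p: "p = pCons c r"
      by (cases p)
    define R where "R = poly (map_poly to_ac r) x"
    have eq: "to_ac c + x * R = 0"
      using less.prems(2) by (simp add: p map_poly_pCons R_def)
    show ?case
    proof (cases "c = 0")
      case True
      then have "r \<noteq> 0" "R = 0"
        using less.prems(1) p eq \<open>x \<noteq> 0\<close> by auto
      then show ?thesis
        using less.hyps[of r] p by (simp add: R_def)
    next
      case False
      have "R \<in> E"
        unfolding R_def by (rule poly_in_subalgebra[OF E _ x])
          (auto simp: poly_over_def coeff_map_poly subalgebraD[OF E])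
      \<comment> \<open>The relation \<open>c + x R = 0\<close> exhibits the inverse of
        \<open>x\<close> as \<open>- R / c\<close>.\<close>
      moreover have "inverse x = to_ac (- inverse c) * R"
      proof -
        have "x * R = to_ac (- c)"
          using eq by (simp add: add_eq_0_iff2 add_eq_0_iff)
        have "x * (to_ac (- inverse c) * R) = to_ac (- inverse c) * (x * R)"
          by (rule mult.left_commute)
        also have "\<dots> = to_ac (- inverse c) * to_ac (- c)"
          by (simp only: \<open>x * R = to_ac (- c)\<close>)
        also have "\<dots> = to_ac (- inverse c * - c)"
          by (rule to_ac_mult[symmetric])
        also have "\<dots> = 1"
          using False by simp
        finally show ?thesis
          by (rule inverse_unique)
      qed
      ultimately show ?thesis
        by (simp only: subalgebraD(1,5)[OF E])
    qed
  qed
  then show ?thesis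
    using alg_closure_algebraic[of x] by metis
qed (use x in simp)

lemma poly_over_subalgebra:
  assumes "subalgebra E"
  shows "p \<in> poly_over E \<Longrightarrow> r \<in> poly_over E \<Longrightarrow> p + r \<in> poly_over E"
    "p \<in> poly_over E \<Longrightarrow> r \<in> poly_over E \<Longrightarrow> p - r \<in> poly_over E"
    "p \<in> poly_over E \<Longrightarrow> r \<in> poly_over E \<Longrightarrow> p * r \<in> poly_over E"
    "c \<in> E \<Longrightarrow> Polynomial.monom c k \<in> poly_over E" "0 \<in> poly_over E"
    "c \<in> E \<Longrightarrow> p \<in> poly_over E \<Longrightarrow> Polynomial.smult c p \<in> poly_over E"
    "map_poly to_ac t \<in> poly_over E"
  using subalgebraD[OF assms]
  by (auto simp: poly_over_def coeff_mult coeff_map_poly coeff_monom intro!: subalgebra_sum[OF assms])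

text \<open>Long division by a monic polynomial never leaves \<open>E\<close>: each step cancels the
  leading term by a monomial multiple of \<open>m\<close>.\<close>

lemma poly_over_division:
  assumes E: "subalgebra E" and m: "m \<in> poly_over E" "Polynomial.lead_coeff m = 1" "Polynomial.degree m > 0"
    and p: "p \<in> poly_over E"
  shows "\<exists>s\<in>poly_over E. \<exists>t\<in>poly_over E. p = m * s + t \<and> Polynomial.degree t < Polynomial.degree m"
  using p
proof (induction "Polynomial.degree p" arbitrary: p rule: less_induct)
  case less
  show ?case
  proof (cases "Polynomial.degree p < Polynomial.degree m")
    case True
    then show ?thesis
      using less.prems poly_over_subalgebra(5)[OF E] by (intro bexI[of _ 0] bexI[of _ p]) auto
  next
    case False
    define c where "c = Polynomial.monom (Polynomial.lead_coeff p) (Polynomial.degree p - Polynomial.degree m)"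
    define p' where "p' = p - m * c"
    have c: "c \<in> poly_over E"
      unfolding c_def using less.prems by (intro poly_over_subalgebra[OF E]) (auto simp: poly_over_def)
    have p': "p' \<in> poly_over E"
      unfolding p'_def by (intro poly_over_subalgebra[OF E] less.prems m c)
    have p0: "p \<noteq> 0"
      using False m(3) by auto
    have m0: "m \<noteq> 0"
      using m(2) by auto
    have c0: "c \<noteq> 0"
      using p0 by (simp add: c_def)
    have deg: "Polynomial.degree (m * c) = Polynomial.degree p"
      using m0 c0 False p0 by (simp add: degree_mult_eq) (simp add: c_def degree_monom_eq)
    have "Polynomial.lead_coeff c = Polynomial.lead_coeff p"
      using p0 by (simp add: c_def degree_monom_eq)
    then have lc: "Polynomial.lead_coeff (m * c) = Polynomial.lead_coeff p"
      using m(2) by (simp add: lead_coeff_mult)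
    have "Polynomial.degree p' < Polynomial.degree p"
    proof (rule degree_lessI)
      show "p' \<noteq> 0 \<or> 0 < Polynomial.degree p"
        using False m(3) by auto
      show "\<forall>k\<ge>Polynomial.degree p. poly.coeff p' k = 0"
      proof (intro allI impI)
        fix k assume "Polynomial.degree p \<le> k"
        then show "poly.coeff p' k = 0"
          using deg lc by (cases "k = Polynomial.degree p") (auto simp: p'_def coeff_eq_0)
      qed
    qed
    then obtain s t where "s \<in> poly_over E" "t \<in> poly_over E" "p' = m * s + t"
      "Polynomial.degree t < Polynomial.degree m"
      using less.hyps p' by blast
    then show ?thesis
      using c by (intro bexI[of _ "s + c"] bexI[of _ t])
        (auto simp: p'_def algebra_simps intro: poly_over_subalgebra[OF E])
  qed
qed

text \<open>Values outside \<open>E\<close> are arbitrary. When \<open>\<iota> 1 = 1\<close>, such a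
  map is automatically injective on an intermediate field.\<close>

definition embedding_on :: "'k::field alg_closure set \<Rightarrow> ('k \<Rightarrow> 'f::field) \<Rightarrow> ('k alg_closure \<Rightarrow> 'f) \<Rightarrow> bool" where
  "embedding_on E \<iota> h \<longleftrightarrow> (\<forall>x\<in>E. \<forall>y\<in>E. h (x + y) = h x + h y \<and> h (x * y) = h x * h y) \<and>
     (\<forall>c. h (to_ac c) = \<iota> c)"

lemma embedding_onD:
  assumes "embedding_on E \<iota> h" "\<iota> 1 = 1" "subalgebra E"
  shows "x \<in> E \<Longrightarrow> y \<in> E \<Longrightarrow> h (x + y) = h x + h y" "x \<in> E \<Longrightarrow> y \<in> E \<Longrightarrow> h (x * y) = h x * h y"
    "h (to_ac c) = \<iota> c" "h 0 = 0" "h 1 = 1" "x \<in> E \<Longrightarrow> h (- x) = - h x"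
    "x \<in> E \<Longrightarrow> y \<in> E \<Longrightarrow> h (x - y) = h x - h y" "inj_on h E"
proof -
  show add: "h (x + y) = h x + h y" and mult: "h (x * y) = h x * h y" if "x \<in> E" "y \<in> E" for x y
    using assms(1) that by (auto simp: embedding_on_def)
  show c: "h (to_ac c) = \<iota> c" for c
    using assms(1) by (auto simp: embedding_on_def)
  note E = subalgebraD[OF assms(3)]
  show 0: "h 0 = 0"
    using add[OF E(2,2)] by (metis add.right_neutral add_left_imp_eq)
  show 1: "h 1 = 1"
    using c[of 1] assms(2) by simp
  show minus: "h (- x) = - h x" if "x \<in> E" for x
    using add[OF that E(6)[OF that]] 0 by (intro minus_unique[symmetric]) simp
  show diff: "h (x - y) = h x - h y" if "x \<in> E" "y \<in> E" for x y
    using add[OF that(1) E(6)[OF that(2)]] minus[OF that(2)] by simp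
  show "inj_on h E"
  proof (rule inj_onI, rule ccontr)
    fix x y assume xy: "x \<in> E" "y \<in> E" "h x = h y" "x \<noteq> y"
    have "h ((x - y) * inverse (x - y)) = h (x - y) * h (inverse (x - y))"
      using xy by (intro mult subalgebra_inverse[OF assms(3)] E(7))
    then show False
      using xy 1 diff by simp
  qed
qed

lemma embedding_on_sum:
  assumes "embedding_on E \<iota> h" "\<iota> 1 = 1" "subalgebra E" "\<And>i. i \<in> S \<Longrightarrow> f i \<in> E"
  shows "h (sum f S) = (\<Sum>i\<in>S. h (f i))"
  using assms(4) by (induction S rule: infinite_finite_induct)
    (auto simp: embedding_onD[OF assms(1-3)] subalgebra_sum[OF assms(3)])

lemma map_poly_embedding_on:
  assumes h: "embedding_on E \<iota> h" "\<iota> 1 = 1" "subalgebra E" and p: "p \<in> poly_over E" "r \<in> poly_over E"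
  shows "map_poly h (p + r) = map_poly h p + map_poly h r"
    "map_poly h (p - r) = map_poly h p - map_poly h r"
    "map_poly h (p * r) = map_poly h p * map_poly h r"
proof -
  note D = embedding_onD[OF h]
  have E: "poly.coeff p i \<in> E" "poly.coeff r i \<in> E" for i
    using p by (auto simp: poly_over_def)
  show "map_poly h (p + r) = map_poly h p + map_poly h r"
    "map_poly h (p - r) = map_poly h p - map_poly h r"
    by (auto intro!: poly_eqI simp: coeff_map_poly D E)
  show "map_poly h (p * r) = map_poly h p * map_poly h r"
  proof (rule poly_eqI)
    fix k
    have "h (\<Sum>i\<le>k. poly.coeff p i * poly.coeff r (k - i)) = (\<Sum>i\<le>k. h (poly.coeff p i * poly.coeff r (k - i)))"
      by (rule embedding_on_sum[OF h]) (simp add: E subalgebraD[OF h(3)])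
    then show "poly.coeff (map_poly h (p * r)) k = poly.coeff (map_poly h p * map_poly h r) k"
      by (simp add: coeff_map_poly coeff_mult D E)
  qed
qed

text \<open>With \<open>m\<close> the minimal polynomial of \<open>z\<close> over \<open>E\<close>,
  polynomials in \<open>z\<close> are sent to polynomials in a root \<zeta> of the image of
  \<open>m\<close>. The target is not assumed algebraically closed: if the image of \<open>P\<close>
  has as many distinct roots as its degree, then so does each of its factors, in particular the
  image of \<open>m\<close>.\<close>

lemma extend_embedding:
  fixes P :: "'k::field poly" and \<iota> :: "'k \<Rightarrow> 'f::field"
  assumes h: "embedding_on E \<iota> h" "\<iota> 1 = 1" and E: "subalgebra E"
    and z: "poly (map_poly to_ac P) z = 0" and P: "map_poly \<iota> P \<noteq> 0"
    and split: "card {x. poly (map_poly \<iota> P) x = 0} = Polynomial.degree (map_poly \<iota> P)"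
  shows "\<exists>E' h'. subalgebra E' \<and> E \<subseteq> E' \<and> z \<in> E' \<and> embedding_on E' \<iota> h'"
proof -
  note D = embedding_onD[OF h E]
  note PE = poly_over_subalgebra[OF E]
  have i0: "\<iota> 0 = 0"
    using D(3)[of 0] D(4) by simp
  define M where "M = {p \<in> poly_over E. p \<noteq> 0 \<and> poly p z = 0}"
  define PP where "PP = map_poly to_ac P"
  from P have P0: "PP \<noteq> 0"
  proof (rule contrapos_nn)
    assume "PP = 0"
    then have "P = 0"
      by (simp add: PP_def poly_eq_iff coeff_map_poly)
    then show "map_poly \<iota> P = 0"
      by simp
  qed
  have "PP \<in> M"
    using P0 z PE(7) by (simp add: M_def PP_def)
  then obtain m0 where m0: "m0 \<in> M" "\<And>p. p \<in> M \<Longrightarrow> Polynomial.degree m0 \<le> Polynomial.degree p"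
    using arg_min_nat_lemma[of "\<lambda>p. p \<in> M" PP Polynomial.degree] by blast
  define m where "m = Polynomial.smult (inverse (Polynomial.lead_coeff m0)) m0"
  have lc0: "Polynomial.lead_coeff m0 \<noteq> 0"
    using m0 by (auto simp: M_def)
  have lcm: "Polynomial.lead_coeff m = 1" and degm: "Polynomial.degree m = Polynomial.degree m0"
    and mz: "poly m z = 0"
    using lc0 m0 by (auto simp: m_def M_def)
  have mE: "m \<in> poly_over E"
    unfolding m_def using m0 by (intro PE subalgebra_inverse[OF E]) (auto simp: M_def poly_over_def)
  have degpos: "Polynomial.degree m > 0"
  proof (rule ccontr)
    assume "\<not> Polynomial.degree m > 0"
    then obtain c where "m = [:c:]"
      by (auto elim: degree_eq_zeroE)
    then show False
      using lcm mz by simp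
  qed
  have dvd: "\<exists>s\<in>poly_over E. p = m * s" if p: "p \<in> poly_over E" "poly p z = 0" for p
  proof -
    obtain s t where st: "s \<in> poly_over E" "t \<in> poly_over E" "p = m * s + t"
      "Polynomial.degree t < Polynomial.degree m"
      using poly_over_division[OF E mE lcm degpos p(1)] by blast
    have "poly t z = 0"
      using p(2) mz by (simp add: st(3))
    then have "t = 0"
      using st(2,4) m0(2)[of t] degm by (auto simp: M_def)
    then show ?thesis
      using st by auto
  qed
  define H where "H = map_poly h"
  have Hpoly: "H (map_poly to_ac t) = map_poly \<iota> t" for t
    unfolding H_def by (rule poly_eqI) (simp add: coeff_map_poly D i0)
  obtain s where s: "s \<in> poly_over E" "PP = m * s"
    using dvd[of PP] PE(7) z by (auto simp: PP_def)
  have fact: "map_poly \<iota> P = H m * H s"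
    using map_poly_embedding_on(3)[OF h E mE s(1)] s(2) Hpoly[of P] by (simp add: H_def PP_def)
  have Hm0: "H m \<noteq> 0" "H s \<noteq> 0"
    using fact P by auto
  have "poly.coeff (H m) (Polynomial.degree m) = 1"
    using lcm D by (simp add: H_def coeff_map_poly)
  then have degH: "Polynomial.degree (H m) > 0"
    using degpos le_degree[of "H m" "Polynomial.degree m"] by simp
  \<comment> \<open>Otherwise all roots of the image of \<open>P\<close> would be roots of the
    cofactor \<open>H s\<close>, whose degree is too small.\<close>
  have "\<exists>\<zeta>. poly (H m) \<zeta> = 0"
  proof (rule ccontr)
    assume "\<nexists>\<zeta>. poly (H m) \<zeta> = 0"
    then have "{x. poly (map_poly \<iota> P) x = 0} = {x. poly (H s) x = 0}"
      by (auto simp: fact)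
    then have "Polynomial.degree (map_poly \<iota> P) \<le> Polynomial.degree (H s)"
      using split card_poly_roots_bound[OF Hm0(2)] by simp
    moreover have "Polynomial.degree (map_poly \<iota> P) = Polynomial.degree (H m) + Polynomial.degree (H s)"
      unfolding fact using Hm0 by (rule degree_mult_eq)
    ultimately show False
      using degH by simp
  qed
  then obtain \<zeta> where \<zeta>: "poly (H m) \<zeta> = 0"
    by blast
  \<comment> \<open>Polynomials with the same value at \<open>z\<close> differ by a multiple of
    \<open>m\<close>, so the value at \<zeta> does not depend on the representative picked by
    \<open>SOME\<close> in \<open>h'\<close>.\<close>
  have wd: "poly (H p) \<zeta> = poly (H r) \<zeta>" if "p \<in> poly_over E" "r \<in> poly_over E" "poly p z = poly r z" for p r
  proof -
    have "poly (p - r) z = 0"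
      using that by simp
    then have "\<exists>u\<in>poly_over E. p - r = m * u"
      by (intro dvd PE(2) that(1,2))
    then obtain u where u: "u \<in> poly_over E" "p - r = m * u"
      by blast
    have "H p - H r = H m * H u"
      using map_poly_embedding_on[OF h E] that mE u by (metis H_def)
    then have "poly (H p - H r) \<zeta> = poly (H m * H u) \<zeta>"
      by simp
    then show ?thesis
      using \<zeta> by simp
  qed
  define E' where "E' = (\<lambda>p. poly p z) ` poly_over E"
  define h' where "h' = (\<lambda>x. poly (H (SOME p. p \<in> poly_over E \<and> poly p z = x)) \<zeta>)"
  have h': "h' (poly p z) = poly (H p) \<zeta>" if "p \<in> poly_over E" for p
  proof -
    have "\<exists>r. r \<in> poly_over E \<and> poly r z = poly p z"
      using that by blast
    then have "(SOME r. r \<in> poly_over E \<and> poly r z = poly p z) \<in> poly_over E \<and>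
        poly (SOME r. r \<in> poly_over E \<and> poly r z = poly p z) z = poly p z"
      by (rule someI_ex)
    then show ?thesis
      unfolding h'_def using that by (intro wd) auto
  qed
  have const: "c \<in> E \<Longrightarrow> [:c:] \<in> poly_over E" for c
    using PE(4)[of c 0] by (simp add: monom_0)
  have "E \<subseteq> E'"
  proof
    fix c assume "c \<in> E"
    then show "c \<in> E'"
      unfolding E'_def by (intro image_eqI[of _ _ "[:c:]"] const) auto
  qed
  moreover have "z \<in> E'"
    unfolding E'_def using PE(4)[OF subalgebraD(3)[OF E], of 1]
    by (intro image_eqI[of _ _ "Polynomial.monom 1 1"]) (auto simp: poly_monom)
  moreover have "subalgebra E'"
    unfolding subalgebra_def
  proof (intro conjI ballI)
    show "range to_ac \<subseteq> E'"
      using \<open>E \<subseteq> E'\<close> subalgebraD(1)[OF E] by auto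
    fix x y assume "x \<in> E'" "y \<in> E'"
    then obtain p r where "x = poly p z" "y = poly r z" "p \<in> poly_over E" "r \<in> poly_over E"
      by (auto simp: E'_def)
    then show "x + y \<in> E'" "x * y \<in> E'"
      unfolding E'_def using PE(1)[of p r] PE(3)[of p r]
      by (auto intro: image_eqI[of _ _ "p + r"] image_eqI[of _ _ "p * r"])
  qed
  moreover have "embedding_on E' \<iota> h'"
    unfolding embedding_on_def
  proof (intro conjI ballI allI)
    fix x y assume "x \<in> E'" "y \<in> E'"
    then obtain p r where pr: "x = poly p z" "y = poly r z" "p \<in> poly_over E" "r \<in> poly_over E"
      by (auto simp: E'_def)
    have "h' (poly (p + r) z) = poly (H (p + r)) \<zeta>" "h' (poly (p * r) z) = poly (H (p * r)) \<zeta>"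
      by (rule h'[OF PE(1)[OF pr(3,4)]], rule h'[OF PE(3)[OF pr(3,4)]])
    then show "h' (x + y) = h' x + h' y" "h' (x * y) = h' x * h' y"
      using pr h' map_poly_embedding_on[OF h E pr(3,4)] by (simp_all add: H_def)
  next
    fix c
    have "h' (poly [:to_ac c:] z) = poly (H [:to_ac c:]) \<zeta>"
      by (intro h' const subalgebraD(1)[OF E])
    then show "h' (to_ac c) = \<iota> c"
      by (simp add: H_def map_poly_pCons D)
  qed
  ultimately show ?thesis
    by blast
qed

text \<open>Starting from the copy of the base field, the elements of \<open>Z\<close> are adjoined
  one at a time; a finite \<open>Z\<close> is enough since the roots generate the splitting
  field.\<close>

lemma embedding_of_roots_exists:
  fixes P :: "'k::field poly" and \<iota> :: "'k \<Rightarrow> 'f::field"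
  assumes \<iota>: "\<And>x y. \<iota> (x + y) = \<iota> x + \<iota> y" "\<And>x y. \<iota> (x * y) = \<iota> x * \<iota> y" "\<iota> 1 = 1"
    and P: "map_poly \<iota> P \<noteq> 0"
    and split: "card {x. poly (map_poly \<iota> P) x = 0} = Polynomial.degree (map_poly \<iota> P)"
    and Z: "finite Z" "Z \<subseteq> root_set P"
  shows "\<exists>E h. subalgebra E \<and> Z \<subseteq> E \<and> embedding_on E \<iota> h"
  using Z
proof (induction Z rule: finite_induct)
  case empty
  have "subalgebra (range to_ac :: 'k alg_closure set)"
    unfolding subalgebra_def by (auto simp flip: to_ac_add to_ac_mult)
  moreover have "embedding_on (range to_ac) \<iota> (\<lambda>x. \<iota> (of_ac x))"
    unfolding embedding_on_def by (auto simp: \<iota> simp flip: to_ac_add to_ac_mult)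
  ultimately show ?case
    by blast
next
  case (insert z Z)
  then obtain E h where E: "subalgebra E" "Z \<subseteq> E" "embedding_on E \<iota> h"
    by auto
  have "poly (map_poly to_ac P) z = 0"
    using insert.prems by (auto simp: root_set_def)
  then show ?case
    using extend_embedding[OF E(3) \<iota>(3) E(1) _ P split, of z] E(2) by (meson insert_subset order.trans)
qed

section \<open>Constructing elements of the Galois group\<close>

lemma ring_of_type_algebra_ops:
  fixes x y :: "'k::field"
  shows "x \<oplus>\<^bsub>ring_of_type_algebra\<^esub> y = x + y" "x \<otimes>\<^bsub>ring_of_type_algebra\<^esub> y = x * y"
    "\<one>\<^bsub>ring_of_type_algebra\<^esub> = (1 :: 'k)" "\<zero>\<^bsub>ring_of_type_algebra\<^esub> = (0 :: 'k)"
    "\<ominus>\<^bsub>ring_of_type_algebra\<^esub> x = - x" "x \<noteq> 0 \<Longrightarrow> inv\<^bsub>ring_of_type_algebra\<^esub> x = inverse x"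
proof -
  interpret field "ring_of_type_algebra :: 'k ring"
    by (rule field_from_type_algebra)
  show "x \<oplus>\<^bsub>ring_of_type_algebra\<^esub> y = x + y" "x \<otimes>\<^bsub>ring_of_type_algebra\<^esub> y = x * y"
    "\<one>\<^bsub>ring_of_type_algebra\<^esub> = (1 :: 'k)" "\<zero>\<^bsub>ring_of_type_algebra\<^esub> = (0 :: 'k)"
    by (simp_all add: ring_of_type_algebra_def)
  have "\<ominus>\<^bsub>ring_of_type_algebra\<^esub> (- x) = x"
    by (rule minus_equality) (simp_all add: ring_of_type_algebra_def)
  show "\<ominus>\<^bsub>ring_of_type_algebra\<^esub> x = - x"
    by (rule minus_equality) (simp_all add: ring_of_type_algebra_def)
  show "inv\<^bsub>ring_of_type_algebra\<^esub> x = inverse x" if "x \<noteq> 0"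
    by (rule comm_inv_char) (use that in \<open>simp_all add: ring_of_type_algebra_def\<close>)
qed

abbreviation split_carrier :: "'k::field poly \<Rightarrow> 'k alg_closure set" where
  "split_carrier f \<equiv> carrier (splitting_field f)"

lemma split_carrier_eq:
  "split_carrier f = generate_field ring_of_type_algebra (range to_ac \<union> root_set f)"
  by (simp add: splitting_field_def)

lemma subalgebra_split_carrier: "subalgebra (split_carrier f)"
  unfolding subalgebra_def split_carrier_eq
  using generate_field.incl[of _ "range to_ac \<union> root_set f" ring_of_type_algebra]
    generate_field.eng_add[of _ ring_of_type_algebra "range to_ac \<union> root_set f"]
    generate_field.eng_mult[of _ ring_of_type_algebra "range to_ac \<union> root_set f"]
  by (auto simp: ring_of_type_algebra_ops)

lemma root_set_subset_split_carrier: "root_set f \<subseteq> split_carrier f"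
  unfolding split_carrier_eq by (auto intro: generate_field.incl)

lemma split_carrier_least:
  assumes E: "subalgebra E" "root_set f \<subseteq> E"
  shows "split_carrier f \<subseteq> E"
proof
  fix x assume "x \<in> split_carrier f"
  then show "x \<in> E"
    unfolding split_carrier_eq
  proof (induction rule: generate_field.induct)
    case (incl h)
    then show ?case
      using E subalgebraD(1)[OF E(1)] by auto
  next
    case (m_inv h)
    then show ?case
      using subalgebra_inverse[OF E(1)] by (simp add: ring_of_type_algebra_ops)
  qed (simp_all add: ring_of_type_algebra_ops subalgebraD[OF E(1)])
qed

lemma galois_group_carrier:
  "\<sigma> \<in> carrier (galois_group f) \<longleftrightarrow>
     \<sigma> \<in> extensional (split_carrier f) \<and> bij_betw \<sigma> (split_carrier f) (split_carrier f) \<and>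
     (\<forall>x\<in>split_carrier f. \<forall>y\<in>split_carrier f. \<sigma> (x + y) = \<sigma> x + \<sigma> y \<and> \<sigma> (x * y) = \<sigma> x * \<sigma> y) \<and>
     (\<forall>c. \<sigma> (to_ac c) = to_ac c)" (is "?l \<longleftrightarrow> ?r")
proof -
  have ops: "x \<oplus>\<^bsub>splitting_field f\<^esub> y = x + y" "x \<otimes>\<^bsub>splitting_field f\<^esub> y = x * y"
    "\<one>\<^bsub>splitting_field f\<^esub> = 1" for x y
    by (simp_all add: splitting_field_def ring_of_type_algebra_ops)
  have "\<sigma> 1 = 1" if "\<forall>c. \<sigma> (to_ac c) = to_ac c"
    using that[rule_format, of 1] by simp
  then show ?thesis
    by (auto simp: galois_group_def Bij_def Ring.ring_hom_def ops bij_betw_def)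
qed

text \<open>The automorphism is \<Psi> conjugated by \<open>h\<close>. It suffices that \<Psi>
  preserves the images of the roots, because these generate the splitting field over the base field,
  whose image \<Psi> fixes.\<close>

lemma galois_element_of_embedding:
  fixes \<iota> :: "'k::field \<Rightarrow> 'f::field"
  assumes h: "embedding_on E \<iota> h" "\<iota> 1 = 1" and E: "subalgebra E" "root_set f \<subseteq> E"
    and \<Psi>: "\<And>x y. \<Psi> (x + y) = \<Psi> x + \<Psi> y" "\<And>x y. \<Psi> (x * y) = \<Psi> x * \<Psi> y" "\<And>c. \<Psi> (\<iota> c) = \<iota> c"
    and stable: "\<And>z. z \<in> root_set f \<Longrightarrow> \<Psi> (h z) \<in> h ` root_set f"
    and fin: "finite (root_set f)"
  shows "\<exists>\<sigma>\<in>carrier (galois_group f). \<forall>x\<in>split_carrier f. h (\<sigma> x) = \<Psi> (h x)"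
proof -
  define L where "L = split_carrier f"
  have L: "subalgebra L" "root_set f \<subseteq> L" "L \<subseteq> E"
    unfolding L_def using subalgebra_split_carrier root_set_subset_split_carrier split_carrier_least[OF E] by auto
  note D = embedding_onD[OF h E(1)]
  note LD = subalgebraD[OF L(1)]
  have LE: "x \<in> L \<Longrightarrow> x \<in> E" for x
    using L(3) by auto
  have inj: "inj_on h L"
    using D(8) L(3) by (rule inj_on_subset)
  have \<Psi>0: "\<Psi> 0 = 0" "\<Psi> 1 = 1"
    using \<Psi>(3)[of 0] \<Psi>(3)[of 1] D(3)[of 0] D(4) h(2) by simp_all
  have \<Psi>inj: "x = y" if "\<Psi> x = \<Psi> y" for x y
  proof (rule ccontr)
    assume "x \<noteq> y"
    have "\<Psi> (x - y) + \<Psi> y = \<Psi> x"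
      using \<Psi>(1)[of "x - y" y] by simp
    then have "\<Psi> (x - y) = 0"
      using that by simp
    moreover have "\<Psi> ((x - y) * inverse (x - y)) = \<Psi> (x - y) * \<Psi> (inverse (x - y))"
      by (rule \<Psi>(2))
    ultimately show False
      using \<open>x \<noteq> y\<close> \<Psi>0 by simp
  qed
  \<comment> \<open>The elements whose images \<Psi> keeps inside the image of \<open>L\<close> form
    a subalgebra containing the roots, hence all of \<open>L\<close>.\<close>
  have stableL: "\<Psi> (h x) \<in> h ` L" if "x \<in> L" for x
  proof -
    have "subalgebra {x \<in> L. \<Psi> (h x) \<in> h ` L}"
      unfolding subalgebra_def
    proof (intro conjI ballI)
      show "range to_ac \<subseteq> {x \<in> L. \<Psi> (h x) \<in> h ` L}"
        using LD(1) D(3) \<Psi>(3) by (auto intro!: image_eqI[of _ _ "to_ac _"])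
      fix x y assume "x \<in> {x \<in> L. \<Psi> (h x) \<in> h ` L}" "y \<in> {x \<in> L. \<Psi> (h x) \<in> h ` L}"
      then obtain x' y' where xy: "x \<in> L" "y \<in> L" "x' \<in> L" "y' \<in> L" "\<Psi> (h x) = h x'" "\<Psi> (h y) = h y'"
        by auto
      have "\<Psi> (h (x + y)) = h (x' + y')" "\<Psi> (h (x * y)) = h (x' * y')"
        using xy by (simp_all add: D LE \<Psi>)
      then show "x + y \<in> {x \<in> L. \<Psi> (h x) \<in> h ` L}" "x * y \<in> {x \<in> L. \<Psi> (h x) \<in> h ` L}"
        using xy LD by auto
    qed
    moreover have "root_set f \<subseteq> {x \<in> L. \<Psi> (h x) \<in> h ` L}"
      using L(2) stable by blast
    ultimately show ?thesis
      using split_carrier_least[of "{x \<in> L. \<Psi> (h x) \<in> h ` L}" f] that by (auto simp: L_def)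
  qed
  define \<sigma> where "\<sigma> = restrict (\<lambda>x. inv_into L h (\<Psi> (h x))) L"
  have \<sigma>: "\<sigma> x \<in> L" "h (\<sigma> x) = \<Psi> (h x)" if "x \<in> L" for x
    using stableL[OF that] that by (auto simp: \<sigma>_def inv_into_into f_inv_into_f)
  have \<sigma>I: "\<sigma> x = y" if "x \<in> L" "y \<in> L" "\<Psi> (h x) = h y" for x y
    using inj_onD[OF inj, of "\<sigma> x" y] \<sigma>[OF that(1)] that by simp
  have \<sigma>add: "\<sigma> (x + y) = \<sigma> x + \<sigma> y" and \<sigma>mult: "\<sigma> (x * y) = \<sigma> x * \<sigma> y" if "x \<in> L" "y \<in> L" for x y
    using that \<sigma> LD by (auto intro!: \<sigma>I simp: D \<Psi> LE)
  have \<sigma>c: "\<sigma> (to_ac c) = to_ac c" for c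
    by (intro \<sigma>I LD) (simp_all add: D \<Psi>)
  have \<sigma>inj: "inj_on \<sigma> L"
  proof (rule inj_onI)
    fix x y assume "x \<in> L" "y \<in> L" "\<sigma> x = \<sigma> y"
    then show "x = y"
      using \<sigma>(2) inj \<Psi>inj by (metis inj_onD)
  qed
  have "\<sigma> ` root_set f \<subseteq> root_set f"
  proof (rule image_subsetI)
    fix z assume z: "z \<in> root_set f"
    then obtain z' where "z' \<in> root_set f" "\<Psi> (h z) = h z'"
      using stable by blast
    then show "\<sigma> z \<in> root_set f"
      using z L(2) \<sigma>I[of z z'] by auto
  qed
  \<comment> \<open>For surjectivity: \<sigma> is injective on the finite set of roots, hence
    permutes it, so its image is a subalgebra containing all roots.\<close>
  then have roots: "\<sigma> ` root_set f = root_set f"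
    using fin \<sigma>inj L(2) by (intro endo_inj_surj) (auto intro: inj_on_subset)
  have "subalgebra (\<sigma> ` L)"
    unfolding subalgebra_def
  proof (intro conjI ballI)
    show "range to_ac \<subseteq> \<sigma> ` L"
      using \<sigma>c LD(1) by (metis image_eqI image_subsetI)
    fix x y assume "x \<in> \<sigma> ` L" "y \<in> \<sigma> ` L"
    then obtain x' y' where xy: "x' \<in> L" "y' \<in> L" "x = \<sigma> x'" "y = \<sigma> y'"
      by auto
    then have "x + y = \<sigma> (x' + y')" "x * y = \<sigma> (x' * y')"
      by (simp_all add: \<sigma>add \<sigma>mult)
    then show "x + y \<in> \<sigma> ` L" "x * y \<in> \<sigma> ` L"
      using xy LD(4,5) by auto
  qed
  then have "L \<subseteq> \<sigma> ` L"
    unfolding L_def by (rule split_carrier_least) (use roots L(2) in \<open>auto simp: L_def\<close>)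
  then have "bij_betw \<sigma> L L"
    using \<sigma>inj \<sigma>(1) by (auto simp: bij_betw_def)
  moreover have "\<sigma> \<in> extensional L"
    by (simp add: \<sigma>_def)
  ultimately have "\<sigma> \<in> carrier (galois_group f)"
    unfolding galois_group_carrier using \<sigma>add \<sigma>mult \<sigma>c by (auto simp: L_def)
  then show ?thesis
    using \<sigma>(2) by (auto simp: L_def)
qed

section \<open>Lifting roots to power series\<close>

no_notation Finite_Cartesian_Product.vec.vec_nth (infixl "$" 90)
no_notation Matrix.vec_index (infixl "$" 100)
notation fls_nth (infixl "$$" 75)

section \<open>Orders of vanishing of power series\<close>

lemma fps_mult_nth_eq_0:
  fixes a :: "'r::comm_ring_1 fps"
  assumes "\<And>j. j \<le> k \<Longrightarrow> D $ j = 0"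
  shows "(a * D) $ k = 0"
  unfolding fps_mult_nth by (rule sum.neutral) (use assms in auto)

lemma fps_mult_power_nth_eq_0:
  fixes a :: "'r::comm_ring_1 fps"
  assumes "\<And>j. j \<le> k \<Longrightarrow> D $ j = 0" "e > 0"
  shows "(a * D ^ e) $ k = 0"
proof -
  obtain e' where "e = Suc e'"
    using assms(2) by (cases e) auto
  then have "a * D ^ e = (a * D ^ e') * D"
    by (simp add: mult_ac)
  then show ?thesis
    using fps_mult_nth_eq_0[OF assms(1)] by simp
qed

text \<open>In every product of two coefficients of \<open>D\<close> with total index at most
  \<open>Suc m\<close>, one index is at most \<open>m\<close>. This removes all powers of a
  correction except the linear one.\<close>

lemma fps_mult_power_nth_Suc_eq_0:
  fixes a :: "'r::comm_ring_1 fps"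
  assumes "\<And>j. j \<le> m \<Longrightarrow> D $ j = 0" "e \<ge> 2"
  shows "(a * D ^ e) $ Suc m = 0"
proof -
  obtain e' where e: "e = e' + 2"
    using assms(2) by (metis add.commute le_Suc_ex)
  have "(D * D) $ j = 0" if "j \<le> Suc m" for j
    unfolding fps_mult_nth
  proof (rule sum.neutral, intro ballI)
    fix i assume "i \<in> {0..j}"
    then have "i \<le> m \<or> j - i \<le> m"
      using that by auto
    then show "D $ i * D $ (j - i) = 0"
      using assms(1) by auto
  qed
  then have "(a * D ^ e' * (D * D)) $ Suc m = 0"
    by (rule fps_mult_nth_eq_0)
  moreover have "a * D ^ e = a * D ^ e' * (D * D)"
    by (simp add: e power_add power2_eq_square)
  ultimately show ?thesis
    by simp
qed

lemma fps_power_nth_0: "(x ^ k) $ 0 = (x $ 0 :: 'r::comm_ring_1) ^ k"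
  by (induction k) simp_all

lemma fps_to_fls_mult: "fps_to_fls (x * y) = fps_to_fls x * fps_to_fls y" for x y :: "'r::comm_ring_1 fps"
  by (rule fls_times_fps_to_fls)

lemma fps_to_fls_power: "fps_to_fls (x ^ k) = fps_to_fls x ^ k" for x :: "'r::comm_ring_1 fps"
  by (induction k) (simp_all add: fps_to_fls_mult)

lemma fps_to_fls_sum: "fps_to_fls (sum f S) = (\<Sum>i\<in>S. fps_to_fls (f i))"
  for f :: "'i \<Rightarrow> 'r::comm_ring_1 fps"
  by (induction S rule: infinite_finite_induct) simp_all

lemma fps_to_fls_poly_qpoly:
  "poly (qpoly q n (\<lambda>i. fps_to_fls (A i))) (fps_to_fls Z) = fps_to_fls (poly (qpoly q n A) Z)"
  for Z :: "'r::comm_ring_1 fps"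
  by (simp add: poly_qpoly fps_to_fls_sum fps_to_fls_power fps_to_fls_mult)

context fin_field_alg_closed
begin

sublocale fps: fin_field_algebra "\<lambda>c. fps_const (emb c)" q
  by unfold_locales (simp_all add: q_eq_card emb_add emb_mult emb_1)

sublocale fls: fin_field_algebra "\<lambda>c. fls_const (emb c)" q
  by unfold_locales (simp_all add: q_eq_card emb_add emb_mult emb_1 fls_plus_const)

lemma qpoly_fps_nth_0:
  "poly (qpoly q n A) Z $ 0 = poly (qpol n (\<lambda>i. A i $ 0)) (Z $ 0)" for Z :: "'r fps"
  by (simp add: poly_qpoly fps_sum_nth fps_power_nth_0)

text \<open>A root of the reduced polynomial is corrected one coefficient at a time: since the
  polynomial is additive and its linear coefficient is a unit, adding \<open>c X\<^bsup>m+1\<^esup>\<close> changes the value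
  modulo \<open>X\<^bsup>m+2\<^esup>\<close> by \<open>A\<^sub>0 c X\<^bsup>m+1\<^esup>\<close> only.\<close>

lemma fps_root_lift:
  fixes A :: "nat \<Rightarrow> 'r fps"
  assumes n: "n > 0" and A0: "A 0 $ 0 \<noteq> 0" and z: "z \<in> qroots n (\<lambda>i. A i $ 0)"
  shows "\<exists>Z. Z \<in> fps.qroots n A \<and> Z $ 0 = z"
proof -
  define f where "f = poly (fps.qpol n A)"
  have f_add: "f (x + y) = f x + f y" and f_diff: "f (x - y) = f x - f y" for x y
    by (simp_all add: f_def fps.qpoly_add fps.qpoly_diff)
  have f_eq: "f x = x ^ (q ^ n) + (\<Sum>i<n. A i * x ^ (q ^ i))" for x
    by (simp add: f_def poly_qpoly)
  have small: "f D $ k = 0" if "\<And>j. j \<le> k \<Longrightarrow> D $ j = 0" for D k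
  proof -
    have "(D ^ (q ^ n)) $ k = 0"
      using fps_mult_power_nth_eq_0[of k D "q ^ n" 1] that q_power_pos by simp
    moreover have "(A i * D ^ (q ^ i)) $ k = 0" for i
      using fps_mult_power_nth_eq_0[of k D "q ^ i" "A i"] that q_power_pos by simp
    ultimately show ?thesis
      by (simp add: f_eq fps_sum_nth)
  qed
  have step: "f (fps_const c * fps_X ^ Suc m) $ Suc m = A 0 $ 0 * c" for c m
  proof -
    define D where "D = fps_const c * fps_X ^ Suc m"
    have D: "D $ j = 0" if "j \<le> m" for j
      using that by (simp add: D_def fps_X_power_mult_right_nth del: power_Suc)
    have e: "q ^ i \<ge> 2" if "i > 0" for i
      using that q_ge_2 self_le_power[of q i] by linarith
    have "(D ^ (q ^ n)) $ Suc m = 0"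
      using fps_mult_power_nth_Suc_eq_0[of m D "q ^ n" 1] D e n by simp
    moreover have "(\<Sum>i<n. (A i * D ^ (q ^ i)) $ Suc m) = (\<Sum>i\<in>{0}. (A i * D ^ (q ^ i)) $ Suc m)"
      using n D e by (intro sum.mono_neutral_right) (auto intro!: fps_mult_power_nth_Suc_eq_0)
    moreover have "(A 0 * D) $ Suc m = A 0 $ 0 * c"
      unfolding D_def mult.assoc[symmetric] fps_X_power_mult_right_nth by simp
    ultimately show ?thesis
      unfolding D_def[symmetric] by (simp add: f_eq fps_sum_nth)
  qed
  \<comment> \<open>A Newton step: the derivative is the constant \<open>A 0\<close>, so the error
    in degree \<open>Suc m\<close> is divided by its constant term.\<close>
  define Zs where "Zs = rec_nat (fps_const z)
    (\<lambda>m Y. Y - fps_const (f Y $ Suc m / A 0 $ 0) * fps_X ^ Suc m)"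
  have Zs0: "Zs 0 = fps_const z"
    and ZsS: "Zs (Suc m) = Zs m - fps_const (f (Zs m) $ Suc m / A 0 $ 0) * fps_X ^ Suc m" for m
    by (simp_all add: Zs_def)
  have stable: "Zs (Suc m) $ k = Zs m $ k" if "k \<le> m" for k m
    using that by (simp add: ZsS fps_X_power_mult_right_nth del: power_Suc)
  have root: "f (Zs m) $ k = 0" if "k \<le> m" for k m
    using that
  proof (induction m arbitrary: k)
    case 0
    then show ?case
      using z by (simp add: Zs0 f_def qpoly_fps_nth_0)
  next
    case (Suc m)
    define c where "c = f (Zs m) $ Suc m / A 0 $ 0"
    have eq: "f (Zs (Suc m)) $ k = f (Zs m) $ k - f (fps_const c * fps_X ^ Suc m) $ k"
      by (simp only: ZsS f_diff fps_sub_nth c_def)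
    show ?case
    proof (cases "k = Suc m")
      case True
      show ?thesis
        unfolding eq unfolding True step using A0 by (simp add: c_def)
    next
      case False
      then have "f (fps_const c * fps_X ^ Suc m) $ k = 0"
        using Suc.prems by (intro small) (simp add: fps_X_power_mult_right_nth del: power_Suc)
      then show ?thesis
        unfolding eq using Suc False by simp
    qed
  qed
  \<comment> \<open>The \<open>k\<close>-th coefficient no longer changes from stage
    \<open>k\<close> on, so the diagonal is the limit of the approximations.\<close>
  define Z where "Z = Abs_fps (\<lambda>k. Zs k $ k)"
  have Zs_Z: "Zs m $ k = Z $ k" if "k \<le> m" for m k
    using that by (induction m rule: dec_induct) (simp_all add: Z_def stable)
  have "f Z $ k = 0" for k
  proof -
    have "f Z $ k = f (Z - Zs k) $ k + f (Zs k) $ k"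
      using f_add[of "Z - Zs k" "Zs k"] by (metis diff_add_cancel fps_add_nth)
    then show ?thesis
      using small[of k "Z - Zs k"] root[of k k] Zs_Z by simp
  qed
  then have "f Z = 0"
    by (simp add: fps_eq_iff)
  moreover have "Z $ 0 = z"
    by (simp add: Z_def Zs0)
  ultimately show ?thesis
    by (auto simp: f_def)
qed

text \<open>By lifting, reduction maps the roots onto the \<open>q ^ n\<close> roots of the reduced
  polynomial, and there are at most \<open>q ^ n\<close> roots to begin with, so it is a
  bijection.\<close>

lemma fps_qroots:
  fixes A :: "nat \<Rightarrow> 'r fps"
  assumes n: "n > 0" and A0: "A 0 $ 0 \<noteq> 0"
  shows "card (fps.qroots n A) = q ^ n" "inj_on (\<lambda>Z. Z $ 0) (fps.qroots n A)"
proof -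
  have img: "(\<lambda>Z. Z $ 0) ` fps.qroots n A = qroots n (\<lambda>i. A i $ 0)"
  proof
    show "(\<lambda>Z. Z $ 0) ` fps.qroots n A \<subseteq> qroots n (\<lambda>i. A i $ 0)"
      by (auto simp flip: qpoly_fps_nth_0)
    show "qroots n (\<lambda>i. A i $ 0) \<subseteq> (\<lambda>Z. Z $ 0) ` fps.qroots n A"
      using fps_root_lift[OF n, of A] A0 by blast
  qed
  have c: "card (qroots n (\<lambda>i. A i $ 0)) = q ^ n"
    using A0 by (intro card_qroots n)
  have "q ^ n \<le> card (fps.qroots n A)"
    using card_image_le[OF fps.finite_qroots, of "\<lambda>Z. Z $ 0" n A] unfolding img c .
  then show card: "card (fps.qroots n A) = q ^ n"
    using fps.card_qroots_le[of n A] by simp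
  show "inj_on (\<lambda>Z. Z $ 0) (fps.qroots n A)"
    by (rule eq_card_imp_inj_on[OF fps.finite_qroots]) (simp only: img c card)
qed

text \<open>The target of the embedding has to be a field, hence Laurent series. The power series
  roots already exhaust the degree, so no root has a pole.\<close>

lemma fls_qroots:
  fixes A :: "nat \<Rightarrow> 'r fps"
  assumes n: "n > 0" and A0: "A 0 $ 0 \<noteq> 0"
  shows "fls.qroots n (\<lambda>i. fps_to_fls (A i)) = fps_to_fls ` fps.qroots n A"
    "card (fls.qroots n (\<lambda>i. fps_to_fls (A i))) = q ^ n"
proof -
  have inj: "inj_on fps_to_fls (fps.qroots n A)"
    by (rule inj_onI) simp
  have "fps_to_fls ` fps.qroots n A \<subseteq> fls.qroots n (\<lambda>i. fps_to_fls (A i))"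
    by (auto simp: fps_to_fls_poly_qpoly)
  then have "fps_to_fls ` fps.qroots n A = fls.qroots n (\<lambda>i. fps_to_fls (A i))"
    by (rule card_seteq[OF fls.finite_qroots])
      (use fls.card_qroots_le fps_qroots(1)[OF n, of A] A0 in \<open>simp add: card_image[OF inj]\<close>)
  then show "fls.qroots n (\<lambda>i. fps_to_fls (A i)) = fps_to_fls ` fps.qroots n A"
    by simp
  then show "card (fls.qroots n (\<lambda>i. fps_to_fls (A i))) = q ^ n"
    using fps_qroots(1)[OF n, of A] A0 by (simp add: card_image[OF inj])
qed

subsection \<open>The Frobenius map on coefficients\<close>

definition fps_frob :: "nat \<Rightarrow> 'r fps \<Rightarrow> 'r fps" where
  "fps_frob r x = Abs_fps (\<lambda>i. (x $ i) ^ (q ^ r))"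

definition fls_frob :: "nat \<Rightarrow> 'r fls \<Rightarrow> 'r fls" where
  "fls_frob r x = Abs_fls (\<lambda>i. (x $$ i) ^ (q ^ r))"

lemma fps_frob_nth: "fps_frob r x $ i = (x $ i) ^ (q ^ r)"
  by (simp add: fps_frob_def)

lemma fls_frob_nth: "fls_frob r x $$ i = (x $$ i) ^ (q ^ r)"
proof -
  have "\<forall>\<^sub>\<infinity>m. (x $$ (- int m)) ^ (q ^ r) = 0"
    using MOST_fls_neg_nth_eq_0[of x] by (rule eventually_mono) (use power_qk_0 in simp)
  then show ?thesis
    by (simp add: fls_frob_def)
qed

lemma fls_frob_fps_to_fls: "fls_frob r (fps_to_fls x) = fps_to_fls (fps_frob r x)"
  by (rule fls_eqI) (use power_qk_0 in \<open>auto simp: fls_frob_nth fps_frob_nth\<close>)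

lemma fls_frob_add: "fls_frob r (x + y) = fls_frob r x + fls_frob r y"
  by (rule fls_eqI) (simp add: fls_frob_nth power_qk_add)

text \<open>A coefficient of a product is a sum whose range depends on the subdegrees; as these are
  preserved, multiplicativity can be checked term by term.\<close>

lemma fls_subdegree_frob: "fls_subdegree (fls_frob r x) = fls_subdegree x"
proof (cases "x = 0")
  case True
  then have "fls_frob r x = 0"
    by (intro fls_eqI) (use power_qk_0 in \<open>simp add: fls_frob_nth\<close>)
  then show ?thesis
    using True by simp
next
  case False
  then show ?thesis
    by (intro fls_subdegree_eqI) (use power_qk_0 in \<open>auto simp: fls_frob_nth\<close>)
qed

lemma fls_frob_mult: "fls_frob r (x * y) = fls_frob r x * fls_frob r y"
  by (rule fls_eqI)
    (simp add: fls_frob_nth fls_times_nth(2) fls_subdegree_frob power_qk_sum power_mult_distrib)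

lemma fls_frob_divide:
  assumes "y \<noteq> 0" "fls_frob r x = x" "fls_frob r y = y"
  shows "fls_frob r (x / y) = x / y"
proof -
  have "x = fls_frob r (x / y * y)"
    using assms by simp
  also have "\<dots> = fls_frob r (x / y) * y"
    unfolding fls_frob_mult using assms by simp
  finally show ?thesis
    using assms(1) by (simp add: field_simps)
qed

subsection \<open>Expanding rational functions at a point\<close>

text \<open>The Taylor expansion at \<alpha>: the series variable stands for
  \<open>t - \<alpha>\<close>.\<close>

definition poly_at :: "'r \<Rightarrow> 'a poly \<Rightarrow> 'r fps" where
  "poly_at \<alpha> p = fps_of_poly (pcompose (map_poly emb p) [:\<alpha>, 1:])"

lemma map_poly_emb:
  "map_poly emb (p + s) = map_poly emb p + map_poly emb s"
  "map_poly emb (p * s) = map_poly emb p * map_poly emb s"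
  "map_poly emb p = 0 \<longleftrightarrow> p = 0"
  by (auto intro!: poly_eqI simp: coeff_map_poly emb_add emb_mult emb_0 emb_sum coeff_mult
      poly_eq_iff emb_eq_0_iff)

lemma poly_at_add: "poly_at \<alpha> (p + s) = poly_at \<alpha> p + poly_at \<alpha> s"
  by (simp add: poly_at_def map_poly_emb pcompose_add fps_of_poly_add)

lemma poly_at_mult: "poly_at \<alpha> (p * s) = poly_at \<alpha> p * poly_at \<alpha> s"
  by (simp add: poly_at_def map_poly_emb pcompose_mult fps_of_poly_mult)

lemma poly_at_eq_0_iff: "poly_at \<alpha> p = 0 \<longleftrightarrow> p = 0"
proof -
  have "poly_at \<alpha> p = 0 \<longleftrightarrow> pcompose (map_poly emb p) [:\<alpha>, 1:] = 0"
    unfolding poly_at_def using fps_of_poly_eq_iff[of _ 0] by simp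
  then show ?thesis
    by (simp add: pcompose_eq_0_iff map_poly_emb)
qed

lemma poly_at_const: "poly_at \<alpha> [:c:] = fps_const (emb c)"
  by (simp add: poly_at_def map_poly_pCons emb_0 fps_of_poly_const)

lemma poly_at_nth_0: "poly_at \<alpha> p $ 0 = poly (map_poly emb p) \<alpha>"
  by (simp add: poly_at_def poly_pcompose flip: poly_0_coeff_0)

text \<open>The coefficients of \<open>p\<close> lie in F_q and \<alpha> lies in the field with
  \<open>q ^ r\<close> elements, so the Taylor coefficients lie there too.\<close>

lemma fps_frob_poly_at:
  assumes "\<alpha> \<in> fixed_field r"
  shows "fps_frob r (poly_at \<alpha> p) = poly_at \<alpha> p"
proof -
  have "poly.coeff (pcompose (map_poly emb p) [:\<alpha>, 1:]) k \<in> fixed_field r" for k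
  proof (induction p arbitrary: k)
    case 0
    show ?case
      by (simp add: fixed_field_closed)
  next
    case (pCons c p)
    have "pcompose (map_poly emb (pCons c p)) [:\<alpha>, 1:] =
        [:emb c:] + (Polynomial.smult \<alpha> (pcompose (map_poly emb p) [:\<alpha>, 1:]) +
          pCons 0 (pcompose (map_poly emb p) [:\<alpha>, 1:]))"
      by (simp add: map_poly_pCons emb_0 pcompose_pCons)
    then show ?case
      using pCons.IH assms
      by (auto simp: coeff_pCons emb_fixed_field fixed_field_closed split: nat.split)
  qed
  then show ?thesis
    by (intro fps_ext) (simp add: fps_frob_nth poly_at_def fixed_field_def)
qed

text \<open>Laurent series allow for denominators that vanish at \<alpha>; independence of the
  chosen fraction is \<open>rat_at_Fract\<close>.\<close>

definition rat_at :: "'r \<Rightarrow> 'a poly fract \<Rightarrow> 'r fls" where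
  "rat_at \<alpha> x = (SOME y. \<exists>p s. s \<noteq> 0 \<and> x = Fract p s \<and> y = fps_to_fls (poly_at \<alpha> p) / fps_to_fls (poly_at \<alpha> s))"

lemma rat_at_Fract:
  assumes "s \<noteq> 0"
  shows "rat_at \<alpha> (Fract p s) = fps_to_fls (poly_at \<alpha> p) / fps_to_fls (poly_at \<alpha> s)"
  unfolding rat_at_def
proof (rule some_equality)
  show "\<exists>p' s'. s' \<noteq> 0 \<and> Fract p s = Fract p' s' \<and> fps_to_fls (poly_at \<alpha> p) / fps_to_fls (poly_at \<alpha> s) =
      fps_to_fls (poly_at \<alpha> p') / fps_to_fls (poly_at \<alpha> s')"
    using assms by blast
  fix y assume "\<exists>p' s'. s' \<noteq> 0 \<and> Fract p s = Fract p' s' \<and> y = fps_to_fls (poly_at \<alpha> p') / fps_to_fls (poly_at \<alpha> s')"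
  then obtain p' s' where ps: "s' \<noteq> 0" "Fract p s = Fract p' s'"
    "y = fps_to_fls (poly_at \<alpha> p') / fps_to_fls (poly_at \<alpha> s')"
    by blast
  have "p * s' = p' * s"
    using ps(2) assms ps(1) by (simp add: eq_fract)
  then have "fps_to_fls (poly_at \<alpha> p) * fps_to_fls (poly_at \<alpha> s') = fps_to_fls (poly_at \<alpha> p') * fps_to_fls (poly_at \<alpha> s)"
    by (simp flip: fps_to_fls_mult poly_at_mult)
  then show "y = fps_to_fls (poly_at \<alpha> p) / fps_to_fls (poly_at \<alpha> s)"
    using ps(1,3) assms by (simp add: frac_eq_eq poly_at_eq_0_iff)
qed

lemma rat_at_hom:
  "rat_at \<alpha> (x + y) = rat_at \<alpha> x + rat_at \<alpha> y"
  "rat_at \<alpha> (x * y) = rat_at \<alpha> x * rat_at \<alpha> y"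
  "rat_at \<alpha> (to_fract p) = fps_to_fls (poly_at \<alpha> p)"
  "rat_at \<alpha> 1 = 1"
proof -
  obtain p s p' s' where xy: "x = Fract p s" "s \<noteq> 0" "y = Fract p' s'" "s' \<noteq> 0"
    by (cases x; cases y) auto
  show "rat_at \<alpha> (x + y) = rat_at \<alpha> x + rat_at \<alpha> y"
    using xy by (simp add: rat_at_Fract poly_at_add poly_at_mult fps_to_fls_mult add_frac_eq poly_at_eq_0_iff)
  show "rat_at \<alpha> (x * y) = rat_at \<alpha> x * rat_at \<alpha> y"
    using xy by (simp add: rat_at_Fract poly_at_mult fps_to_fls_mult)
  have one: "poly_at \<alpha> 1 = 1"
    using poly_at_const[of \<alpha> 1] by (simp add: emb_1 one_pCons)
  show frac: "rat_at \<alpha> (to_fract p) = fps_to_fls (poly_at \<alpha> p)" for p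
    by (simp add: to_fract_def rat_at_Fract one)
  show "rat_at \<alpha> 1 = 1"
    using frac[of 1] one by simp
qed

lemma fls_frob_rat_at:
  assumes "\<alpha> \<in> fixed_field r"
  shows "fls_frob r (rat_at \<alpha> x) = rat_at \<alpha> x"
proof -
  obtain p s where x: "x = Fract p s" "s \<noteq> 0"
    by (cases x) auto
  show ?thesis
    unfolding x(1) rat_at_Fract[OF x(2)] using x(2)
    by (intro fls_frob_divide) (simp_all add: poly_at_eq_0_iff fls_frob_fps_to_fls fps_frob_poly_at[OF assms])
qed

end

section \<open>Frobenius elements of the Galois group\<close>

global_interpretation ratfun: fin_field_alg_closed
  "\<lambda>c :: 'a::{field,finite}. to_ac (to_fract [:c:])" "CARD('a)"
proof
  fix x y :: 'a
  have "[:x + y:] = [:x:] + [:y:]" "[:x * y:] = [:x:] * [:y:]" "[:1:] = (1 :: 'a poly)"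
    by simp_all
  then show "to_ac (to_fract [:x + y:]) = to_ac (to_fract [:x:]) + to_ac (to_fract [:y:])"
    "to_ac (to_fract [:x * y:]) = to_ac (to_fract [:x:]) * to_ac (to_fract [:y:])"
    "to_ac (to_fract [:1 :: 'a:]) = 1"
    by (simp_all only: to_fract_add to_fract_mult to_fract_1 to_ac_add to_ac_mult to_ac_1)
qed simp

lemma additive_poly_eq_qpoly: "additive_poly n a = qpoly CARD('a) n (\<lambda>i. to_fract (a i))"
  for a :: "nat \<Rightarrow> 'a::{field,finite} poly"
  by (simp add: additive_poly_def qpoly_def)

lemma root_set_additive_poly:
  "root_set (additive_poly n a) = ratfun.qroots n (\<lambda>i. to_ac (to_fract (a i)))"
  for a :: "nat \<Rightarrow> 'a::{field,finite} poly"
  by (simp add: root_set_def additive_poly_eq_qpoly map_poly_qpoly)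

text \<open>Through \<open>h\<close> the roots become power series, and Frobenius on their
  coefficients is transported back to \<sigma>. Reduction at \<alpha> is injective on the roots and
  turns the action of \<sigma> into the power map on the reduced roots.\<close>

lemma frobenius_in_galois_group:
  fixes a :: "nat \<Rightarrow> 'a::{field,finite} poly"
  defines "A \<equiv> \<lambda>\<alpha> i. poly (map_poly to_ac (a i)) \<alpha>"
  assumes n: "n > 0" and \<alpha>: "\<alpha> \<in> alg_closure.fixed_field r" and A0: "A \<alpha> 0 \<noteq> 0"
    and frob: "alg_closure.frob_matrix r n (A \<alpha>) g"
  shows "\<exists>\<beta>. ratfun.lin_indep n \<beta> \<and> (\<forall>j<n. \<beta> j \<in> root_set (additive_poly n a)) \<and>
    (\<exists>\<sigma>\<in>carrier (galois_group (additive_poly n a)). \<forall>j<n. \<sigma> (\<beta> j) = ratfun.tmul n \<beta> g j)"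
proof -
  define f where "f = additive_poly n a"
  define \<iota> where "\<iota> = alg_closure.rat_at \<alpha>"
  define B where "B = (\<lambda>i. alg_closure.poly_at \<alpha> (a i))"
  define W where "W = alg_closure.fps.qroots n B"
  have \<iota>: "\<iota> (x + y) = \<iota> x + \<iota> y" "\<iota> (x * y) = \<iota> x * \<iota> y" "\<iota> 1 = 1"
    "\<iota> (to_fract p) = fps_to_fls (alg_closure.poly_at \<alpha> p)" for x y p
    by (simp_all add: \<iota>_def alg_closure.rat_at_hom)
  have \<iota>0: "\<iota> 0 = 0"
    using \<iota>(1)[of 0 0] by (metis add.right_neutral add_left_imp_eq)
  have B0: "B i $ 0 = A \<alpha> i" for i
    by (simp add: B_def A_def alg_closure.poly_at_nth_0)
  have B00: "B 0 $ 0 \<noteq> 0"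
    using A0 by (simp add: B0)
  have q2: "CARD('a) \<ge> 2"
    by (rule card_field_ge_2)
  have map\<iota>: "map_poly \<iota> f = qpoly CARD('a) n (\<lambda>i. fps_to_fls (B i))"
    unfolding f_def additive_poly_eq_qpoly by (subst map_poly_qpoly) (simp_all add: \<iota> \<iota>0 B_def)
  have Wfls: "alg_closure.fls.qroots n (\<lambda>i. fps_to_fls (B i)) = fps_to_fls ` W"
    "card (alg_closure.fls.qroots n (\<lambda>i. fps_to_fls (B i))) = CARD('a) ^ n"
    unfolding W_def by (rule alg_closure.fls_qroots[where A = B, OF n B00])+
  have split: "card {x. poly (map_poly \<iota> f) x = 0} = Polynomial.degree (map_poly \<iota> f)"
    unfolding map\<iota> degree_qpoly[OF q2] by (rule Wfls(2))
  have roots_f: "root_set f = ratfun.qroots n (\<lambda>i. to_ac (to_fract (a i)))"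
    unfolding f_def by (rule root_set_additive_poly)
  have fin: "finite (root_set f)"
    unfolding roots_f by (rule ratfun.finite_qroots)
  have "a 0 \<noteq> 0"
    using A0 by (auto simp: A_def)
  then have card: "card (root_set f) = CARD('a) ^ n"
    unfolding roots_f by (intro ratfun.card_qroots n) simp
  obtain E h where E: "subalgebra E" "root_set f \<subseteq> E" "embedding_on E \<iota> h"
    using embedding_of_roots_exists[OF \<iota>(1-3) _ split fin subset_refl] qpoly_nonzero[OF q2] map\<iota>
    by metis
  note D = embedding_onD[OF E(3) \<iota>(3) E(1)]
  note ED = subalgebraD[OF E(1)]
  have hpow: "h (x ^ k) = h x ^ k" if "x \<in> E" for x k
    by (induction k) (simp_all add: D that subalgebra_power[OF E(1)])
  have "h z \<in> fps_to_fls ` W" if z: "z \<in> root_set f" for z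
  proof -
    have zE: "z \<in> E"
      using z E(2) by auto
    have "h (z ^ (CARD('a) ^ n) + (\<Sum>i<n. to_ac (to_fract (a i)) * z ^ (CARD('a) ^ i))) =
        h z ^ (CARD('a) ^ n) + (\<Sum>i<n. fps_to_fls (B i) * h z ^ (CARD('a) ^ i))"
      by (subst D(1) embedding_on_sum[OF E(3) \<iota>(3) E(1)];
          simp add: D ED hpow zE subalgebra_power[OF E(1)] subalgebra_sum[OF E(1)] \<iota>(4) B_def
            embedding_on_sum[OF E(3) \<iota>(3) E(1)])
    moreover have "z ^ (CARD('a) ^ n) + (\<Sum>i<n. to_ac (to_fract (a i)) * z ^ (CARD('a) ^ i)) = 0"
      using z unfolding roots_f by (simp add: poly_qpoly)
    ultimately show ?thesis
      unfolding Wfls(1)[symmetric] by (simp add: poly_qpoly D)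
  qed
  \<comment> \<open>\<open>h\<close> is injective and both sets have the same number of elements, so
    the inclusion is an equality.\<close>
  then have hroots: "h ` root_set f = fps_to_fls ` W"
    using Wfls card card_image[OF inj_on_subset[OF D(8) E(2)]]
    by (intro card_seteq) (auto simp: W_def alg_closure.fps.finite_qroots)
  define \<Psi> where "\<Psi> = (alg_closure.fps_frob r :: 'a alg_closure fps \<Rightarrow> _)"
  \<comment> \<open>The coefficients \<open>B i\<close> are fixed by Frobenius, so it commutes with
    the polynomial.\<close>
  have \<Psi>W: "\<Psi> Z \<in> W" if Z: "Z \<in> W" for Z
  proof -
    have "alg_closure.fls_frob r (poly (qpoly CARD('a) n (\<lambda>i. fps_to_fls (B i))) x) =
        poly (qpoly CARD('a) n (\<lambda>i. fps_to_fls (B i))) (alg_closure.fls_frob r x)" for x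
    proof -
      have zero: "alg_closure.fls_frob r (0 :: 'a alg_closure fls) = 0"
        using alg_closure.fls_frob_add[of r 0 0] by (metis add.right_neutral add_left_imp_eq)
      have s: "alg_closure.fls_frob r (sum F S) = (\<Sum>i\<in>S. alg_closure.fls_frob r (F i))" for F :: "nat \<Rightarrow> 'a alg_closure fls" and S
      proof (induction S rule: infinite_finite_induct)
        case (insert i S)
        then show ?case
          by (simp add: alg_closure.fls_frob_add)
      qed (use zero in simp_all)
      have one: "alg_closure.fls_frob r (1 :: 'a alg_closure fls) = 1"
        using alg_closure.fls_frob_rat_at[OF \<alpha>, of 1] by (simp add: alg_closure.rat_at_hom)
      have p: "alg_closure.fls_frob r (y ^ k) = alg_closure.fls_frob r y ^ k" for y :: "'a alg_closure fls" and k
        by (induction k) (simp_all add: one alg_closure.fls_frob_mult)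
      have "alg_closure.fls_frob r (fps_to_fls (B i)) = fps_to_fls (B i)" for i
        by (simp add: B_def alg_closure.fls_frob_fps_to_fls alg_closure.fps_frob_poly_at[OF \<alpha>])
      then show ?thesis
        by (simp add: poly_qpoly alg_closure.fls_frob_add alg_closure.fls_frob_mult s p)
    qed
    from this[of "fps_to_fls Z"] have "poly (qpoly CARD('a) n (\<lambda>i. fps_to_fls (B i))) (fps_to_fls (\<Psi> Z)) = alg_closure.fls_frob r 0"
      using Z by (simp add: \<Psi>_def W_def fps_to_fls_poly_qpoly flip: alg_closure.fls_frob_fps_to_fls)
    moreover have "alg_closure.fls_frob r (0 :: 'a alg_closure fls) = 0"
      using alg_closure.fls_frob_add[of r 0 0] by (metis add.right_neutral add_left_imp_eq)
    ultimately show ?thesis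
      by (simp add: W_def fps_to_fls_poly_qpoly)
  qed
  have "\<exists>\<sigma>\<in>carrier (galois_group f). \<forall>x\<in>split_carrier f. h (\<sigma> x) = alg_closure.fls_frob r (h x)"
  proof (rule galois_element_of_embedding[OF E(3) \<iota>(3) E(1,2) alg_closure.fls_frob_add alg_closure.fls_frob_mult _ _ fin])
    show "alg_closure.fls_frob r (\<iota> c) = \<iota> c" for c
      unfolding \<iota>_def by (rule alg_closure.fls_frob_rat_at[OF \<alpha>])
    fix z assume "z \<in> root_set f"
    then obtain Z where "Z \<in> W" "h z = fps_to_fls Z"
      using hroots by blast
    then show "alg_closure.fls_frob r (h z) \<in> h ` root_set f"
      using \<Psi>W unfolding hroots by (simp add: alg_closure.fls_frob_fps_to_fls \<Psi>_def)
  qed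
  then obtain \<sigma> where \<sigma>: "\<sigma> \<in> carrier (galois_group f)" "\<And>x. x \<in> split_carrier f \<Longrightarrow> h (\<sigma> x) = alg_closure.fls_frob r (h x)"
    by blast
  obtain b where b: "alg_closure.lin_indep n b" "\<And>j. j < n \<Longrightarrow> b j \<in> alg_closure.qroots n (A \<alpha>)"
    "\<And>j. j < n \<Longrightarrow> b j ^ (CARD('a) ^ r) = alg_closure.tmul n b g j"
    using frob unfolding alg_closure.frob_matrix_def by blast
  \<comment> \<open>Each vector of the reduced basis is lifted to a power series root and pulled
    back through \<open>h\<close>.\<close>
  have "\<forall>j. \<exists>\<beta> Z. j < n \<longrightarrow> \<beta> \<in> root_set f \<and> Z \<in> W \<and> h \<beta> = fps_to_fls Z \<and> Z $ 0 = b j"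
  proof
    fix j
    show "\<exists>\<beta> Z. j < n \<longrightarrow> \<beta> \<in> root_set f \<and> Z \<in> W \<and> h \<beta> = fps_to_fls Z \<and> Z $ 0 = b j"
    proof (cases "j < n")
      case True
      then obtain Z where Z: "Z \<in> W" "Z $ 0 = b j"
        using alg_closure.fps_root_lift[where A = B, OF n B00, of "b j"] b(2)[OF True] unfolding B0 W_def by blast
      then obtain \<beta> where "\<beta> \<in> root_set f" "h \<beta> = fps_to_fls Z"
        using hroots by (metis (no_types, lifting) imageE imageI)
      then show ?thesis
        using Z by blast
    qed simp
  qed
  then obtain \<beta> Z where \<beta>: "\<And>j. j < n \<Longrightarrow> \<beta> j \<in> root_set f" and Z: "\<And>j. j < n \<Longrightarrow> Z j \<in> W"
    "\<And>j. j < n \<Longrightarrow> h (\<beta> j) = fps_to_fls (Z j)" "\<And>j. j < n \<Longrightarrow> Z j $ 0 = b j"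
    by metis
  have \<beta>E: "\<beta> j \<in> E" "\<beta> j \<in> split_carrier f" if "j < n" for j
    using \<beta>[OF that] E(2) root_set_subset_split_carrier by auto
  have hlin: "h (ratfun.lincomb n c \<beta>) = fps_to_fls (alg_closure.fps.lincomb n c Z)" for c
  proof -
    have "h (ratfun.lincomb n c \<beta>) = (\<Sum>i<n. h (to_ac (to_fract [:c i:]) * \<beta> i))"
      unfolding ratfun.lincomb_def
      by (rule embedding_on_sum[OF E(3) \<iota>(3) E(1)]) (simp add: ED \<beta>E)
    also have "\<dots> = (\<Sum>i<n. fps_to_fls (fps_const (to_ac (c i)) * Z i))"
      by (rule sum.cong) (simp_all add: D ED \<beta>E Z \<iota>(4) alg_closure.poly_at_const fps_to_fls_mult)
    finally show ?thesis
      by (simp add: alg_closure.fps.lincomb_def fps_to_fls_sum)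
  qed
  have lin0: "alg_closure.fps.lincomb n c Z $ 0 = alg_closure.lincomb n c b" for c
    by (simp add: alg_closure.fps.lincomb_def alg_closure.lincomb_def fps_sum_nth Z)
  have linE: "ratfun.lincomb n c \<beta> \<in> E" for c
    unfolding ratfun.lincomb_def by (intro subalgebra_sum[OF E(1)] ED) (simp_all add: \<beta>E)
  \<comment> \<open>Scalars become constant series, so a relation among the \<beta> yields the same
    relation among the constant terms \<open>b\<close>.\<close>
  have "ratfun.lin_indep n \<beta>"
    unfolding ratfun.lin_indep_def
  proof (intro allI impI)
    fix c i assume "ratfun.lincomb n c \<beta> = 0" "i < n"
    then have "alg_closure.fps.lincomb n c Z = 0"
      using hlin[of c] D(4) by simp
    then have "alg_closure.lincomb n c b = 0"
      using lin0[of c] by simp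
    then show "c i = 0"
      using b(1) \<open>i < n\<close> by (simp add: alg_closure.lin_indep_def)
  qed
  moreover have "\<sigma> (\<beta> j) = ratfun.tmul n \<beta> g j" if j: "j < n" for j
  proof -
    \<comment> \<open>Both sides are power series roots with the same constant term, and reduction
      is injective on roots.\<close>
    have "\<Psi> (Z j) = alg_closure.fps.lincomb n (\<lambda>i. g $$ (i, j)) Z"
    proof (rule inj_onD[OF alg_closure.fps_qroots(2)[where A = B, OF n B00]])
      show "\<Psi> (Z j) $ 0 = alg_closure.fps.lincomb n (\<lambda>i. g $$ (i, j)) Z $ 0"
        using b(3)[OF j] Z(3)[OF j] by (simp add: \<Psi>_def alg_closure.fps_frob_nth lin0 alg_closure.tmul_def)
      show "\<Psi> (Z j) \<in> alg_closure.fps.qroots n B"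
        using \<Psi>W[OF Z(1)[OF j]] by (simp add: W_def)
      show "alg_closure.fps.lincomb n (\<lambda>i. g $$ (i, j)) Z \<in> alg_closure.fps.qroots n B"
        by (rule alg_closure.fps.lincomb_qroots) (use Z(1) in \<open>simp add: W_def\<close>)
    qed
    then have "h (\<sigma> (\<beta> j)) = h (ratfun.tmul n \<beta> g j)"
      using \<sigma>(2)[OF \<beta>E(2)[OF j]] Z(2)[OF j]
      by (simp add: ratfun.tmul_def hlin alg_closure.fls_frob_fps_to_fls \<Psi>_def)
    moreover have "\<sigma> (\<beta> j) \<in> E"
      using \<sigma>(1) \<beta>E(2)[OF j] split_carrier_least[OF E(1,2)]
      unfolding galois_group_carrier bij_betw_def by blast
    ultimately show ?thesis
      using inj_onD[OF D(8)] linE by (metis ratfun.tmul_def)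
  qed
  ultimately show ?thesis
    using \<beta> \<sigma>(1) unfolding f_def by blast
qed

section \<open>A subgroup meeting every conjugacy class\<close>

text \<open>Left multiplication by \<open>h\<close> is injective on the finite set \<open>H\<close>,
  hence onto; solving \<open>h \<otimes> x = h\<close> yields the unit and
  \<open>h \<otimes> x = \<one>\<close> the inverse.\<close>

lemma (in group) finite_mult_closed_subgroup:
  assumes "finite H" "H \<noteq> {}" "H \<subseteq> carrier G" "\<And>x y. x \<in> H \<Longrightarrow> y \<in> H \<Longrightarrow> x \<otimes> y \<in> H"
  shows "subgroup H G"
proof (rule subgroupI)
  fix h assume h: "h \<in> H"
  have img: "(\<lambda>x. h \<otimes> x) ` H = H"
    using assms h by (intro endo_inj_surj) (auto intro!: inj_onI simp: subset_iff)
  have surj: "\<exists>x\<in>H. h \<otimes> x = y" if "y \<in> H" for y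
  proof -
    have "y \<in> (\<lambda>x. h \<otimes> x) ` H"
      using that by (simp only: img)
    then show ?thesis
      by blast
  qed
  then have one: "\<one> \<in> H"
    using h assms(3) by (metis l_cancel_one subsetD)
  then show "inv h \<in> H"
    using surj[OF one] h assms(3) by (metis inv_equality inv_inv inv_closed subsetD)
qed (use assms in auto)

text \<open>Jordan's lemma. Count the pairs \<open>(x, g)\<close> with \<open>g\<^sup>-\<^sup>1 x g \<in> H\<close>: every \<open>g\<close> contributes \<open>|H|\<close> of
  them, and every \<open>x\<close> at least \<open>|H|\<close>, with \<open>x = 1\<close> contributing \<open>|G|\<close>.\<close>

lemma (in group) subgroup_meeting_conjugacy_classes:
  assumes fin: "finite (carrier G)" and H: "subgroup H G"
    and meets: "\<And>x. x \<in> carrier G \<Longrightarrow> \<exists>g\<in>carrier G. inv g \<otimes> x \<otimes> g \<in> H"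
  shows "H = carrier G"
proof -
  have HG: "H \<subseteq> carrier G"
    by (rule subgroup.subset[OF H])
  have finH: "finite H"
    using HG fin by (rule finite_subset)
  define N where "N = (\<lambda>x. {g \<in> carrier G. inv g \<otimes> x \<otimes> g \<in> H})"
  have finN: "finite (N x)" for x
    unfolding N_def using fin by simp
  have N: "card H \<le> card (N x)" if x: "x \<in> carrier G" for x
  proof -
    obtain g where g: "g \<in> carrier G" "inv g \<otimes> x \<otimes> g \<in> H"
      using meets[OF x] by blast
    \<comment> \<open>Along with \<open>g\<close> the set \<open>N x\<close> contains the whole
      coset \<open>g H\<close>, which supplies \<open>card H\<close> elements.\<close>
    have "g \<otimes> h \<in> N x" if h: "h \<in> H" for h
    proof -
      have hG: "h \<in> carrier G"
        using h HG by auto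
      have "inv (g \<otimes> h) \<otimes> x \<otimes> (g \<otimes> h) = inv h \<otimes> (inv g \<otimes> x \<otimes> g) \<otimes> h"
        using g x hG by (simp add: inv_mult_group m_assoc)
      also have "\<dots> \<in> H"
        using g h subgroup.m_closed[OF H] subgroup.m_inv_closed[OF H] by blast
      finally show ?thesis
        using g hG by (simp add: N_def)
    qed
    then show ?thesis
      using finN g HG by (intro card_inj_on_le[of "\<lambda>h. g \<otimes> h"]) (auto intro!: inj_onI simp: subset_iff)
  qed
  have N1: "N \<one> = carrier G"
    using subgroup.one_closed[OF H] by (auto simp: N_def)
  have conj: "card {x \<in> carrier G. inv g \<otimes> x \<otimes> g \<in> H} \<le> card H" if g: "g \<in> carrier G" for g
  proof (rule card_inj_on_le[of "\<lambda>x. inv g \<otimes> x \<otimes> g"])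
    show "inj_on (\<lambda>x. inv g \<otimes> x \<otimes> g) {x \<in> carrier G. inv g \<otimes> x \<otimes> g \<in> H}"
      using g by (intro inj_onI) simp
  qed (use finH in auto)
  have one: "\<one> \<in> carrier G"
    by simp
  have "card (carrier G) + (card (carrier G) - 1) * card H \<le> card (N \<one>) + (\<Sum>x\<in>carrier G - {\<one>}. card (N x))"
    using sum_bounded_below[of "carrier G - {\<one>}" "card H" "\<lambda>x. card (N x)"] N fin
    by (simp add: N1 card_Diff_singleton)
  also have "\<dots> = (\<Sum>x\<in>carrier G. card (N x))"
    by (rule sum.remove[OF fin one, symmetric])
  also have "\<dots> = card (Sigma (carrier G) N)"
    using fin finN by simp
  also have "\<dots> \<le> card (Sigma (carrier G) (\<lambda>g. {x \<in> carrier G. inv g \<otimes> x \<otimes> g \<in> H}))"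
    by (rule card_inj_on_le[of "\<lambda>(x, g). (g, x)"]) (use fin in \<open>auto simp: N_def intro!: inj_onI\<close>)
  also have "\<dots> = (\<Sum>g\<in>carrier G. card {x \<in> carrier G. inv g \<otimes> x \<otimes> g \<in> H})"
    using fin by simp
  also have "\<dots> \<le> card (carrier G) * card H"
    using sum_bounded_above[of "carrier G" _ "card H"] conj by simp
  finally have "card (carrier G) + (card (carrier G) - 1) * card H \<le> card (carrier G) * card H" .
  moreover have "card (carrier G) \<ge> 1"
    using fin one by (auto simp: Suc_le_eq card_gt_0_iff)
  ultimately have "card (carrier G) \<le> card H"
    by (cases "card (carrier G)") auto
  then show ?thesis
    using fin HG by (rule card_seteq[rotated 2])
qed

lemma general_linear_eq_Units:
  "general_linear n = Units (ring_mat TYPE('a::{field,finite}) n ())"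
  unfolding Units_def ring_mat_simps using ratfun.general_linear_iff by blast

text \<open>Conjugacy is written \<open>M * P = P * g\<close>, which avoids inverse matrices; in the
  unit group of the matrix ring, the inverse of \<open>P\<close> is the element that conjugates
  \<open>g\<close> into \<open>H\<close>.\<close>

lemma general_linear_meeting_conjugacy_classes:
  fixes H :: "'a::{field,finite} mat set"
  assumes H: "H \<subseteq> general_linear n" "\<And>M N. M \<in> H \<Longrightarrow> N \<in> H \<Longrightarrow> M * N \<in> H"
    and meets: "\<And>g. g \<in> general_linear n \<Longrightarrow> \<exists>P\<in>general_linear n. \<exists>M\<in>H. M * P = P * g"
  shows "H = general_linear n"
proof -
  let ?R = "ring_mat TYPE('a) n ()"
  interpret R: ring ?R
    by (rule ring_mat)
  interpret G: group "units_of ?R"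
    by (rule R.units_group)
  have car: "carrier (units_of ?R) = general_linear n"
    by (simp add: units_of_def general_linear_eq_Units)
  have mult: "x \<otimes>\<^bsub>units_of ?R\<^esub> y = x * y" for x y :: "'a mat"
    by (simp add: units_of_def ring_mat_simps)
  have "H = carrier (units_of ?R)"
  proof (rule G.subgroup_meeting_conjugacy_classes)
    show "finite (carrier (units_of ?R))"
      unfolding car by (rule finite_general_linear)
    have "H \<noteq> {}"
      using meets[OF one_mat_general_linear] by auto
    then show "subgroup H (units_of ?R)"
      using H finite_subset[OF H(1) finite_general_linear]
      by (intro G.finite_mult_closed_subgroup) (auto simp: car mult)
    fix g assume "g \<in> carrier (units_of ?R)"
    then have g: "g \<in> general_linear n"
      by (simp add: car)
    then obtain P M where PM: "P \<in> general_linear n" "M \<in> H" "M * P = P * g"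
      using meets by blast
    have M: "M \<in> general_linear n"
      using PM(2) H(1) by auto
    let ?P = "inv\<^bsub>units_of ?R\<^esub> P"
    have P: "P \<in> carrier (units_of ?R)" "M \<in> carrier (units_of ?R)" "g \<in> carrier (units_of ?R)"
      using PM(1) M g by (simp_all add: car)
    have "inv\<^bsub>units_of ?R\<^esub> ?P \<otimes>\<^bsub>units_of ?R\<^esub> g \<otimes>\<^bsub>units_of ?R\<^esub> ?P =
        (P \<otimes>\<^bsub>units_of ?R\<^esub> g) \<otimes>\<^bsub>units_of ?R\<^esub> ?P"
      using P by simp
    also have "P \<otimes>\<^bsub>units_of ?R\<^esub> g = M \<otimes>\<^bsub>units_of ?R\<^esub> P"
      using PM(3) by (simp add: mult)
    also have "(M \<otimes>\<^bsub>units_of ?R\<^esub> P) \<otimes>\<^bsub>units_of ?R\<^esub> ?P = M"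
      using P by (simp add: G.m_assoc)
    finally show "\<exists>x\<in>carrier (units_of ?R). inv\<^bsub>units_of ?R\<^esub> x \<otimes>\<^bsub>units_of ?R\<^esub> g \<otimes>\<^bsub>units_of ?R\<^esub> x \<in> H"
      using PM(2) P(1) G.inv_closed by metis
  qed
  then show ?thesis
    by (simp add: car)
qed

section \<open>Matrices of the Galois action on the root space\<close>

lemma root_basisI:
  fixes b :: "nat \<Rightarrow> 'a::{field,finite} poly fract alg_closure"
  assumes b: "ratfun.lin_indep n b" "ratfun.lspan n b = root_set f"
  shows "root_basis f n b"
proof -
  have inj: "inj_on b {..<n}"
  proof (rule inj_onI, rule ccontr)
    fix i j assume ij: "i \<in> {..<n}" "j \<in> {..<n}" "b i = b j" "i \<noteq> j"
    then have "ratfun.lincomb n (\<lambda>k. if k = i then 1 else 0) b = ratfun.lincomb n (\<lambda>k. if k = j then 1 else 0) b"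
      by (simp add: ratfun.lincomb_Kronecker)
    from ratfun.lin_indepD[OF b(1) this, of i] show False
      using ij by simp
  qed
  \<comment> \<open>\<open>b\<close> is injective by independence, so sums over its image, as in
    \<open>const_scale\<close>, become sums over indices.\<close>
  have sum: "(\<Sum>v\<in>b ` {..<n}. const_scale (u v) v) = ratfun.lincomb n (\<lambda>i. u (b i)) b" for u
    by (simp add: sum.reindex[OF inj] ratfun.lincomb_def const_scale_def)
  have "const_scale.independent (b ` {..<n})"
    unfolding const_scale.dependent_finite[OF finite_imageI[OF finite_lessThan]] sum
    using b(1) by (auto simp: ratfun.lin_indep_def)
  moreover have "const_scale.span (b ` {..<n}) = ratfun.lspan n b"
  proof -
    have "ratfun.lincomb n c b = ratfun.lincomb n (\<lambda>i. (c \<circ> inv_into {..<n} b) (b i)) b" for c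
      by (rule ratfun.lincomb_cong) (simp_all add: inj)
    then have "range (\<lambda>u. ratfun.lincomb n (\<lambda>i. u (b i)) b) = ratfun.lspan n b"
      unfolding ratfun.lspan_def by (auto intro!: image_eqI[of _ _ "_ \<circ> inv_into {..<n} b"])
    then show ?thesis
      unfolding const_scale.span_finite[OF finite_imageI[OF finite_lessThan]] sum .
  qed
  ultimately show ?thesis
    using inj b(2) by (simp add: root_basis_def)
qed

lemma galois_lincomb:
  fixes b :: "nat \<Rightarrow> 'a::{field,finite} poly fract alg_closure"
  assumes \<sigma>: "\<sigma> \<in> carrier (galois_group f)" and b: "\<And>i. i < n \<Longrightarrow> b i \<in> split_carrier f"
  shows "\<sigma> (ratfun.lincomb n c b) = ratfun.lincomb n c (\<lambda>i. \<sigma> (b i))"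
proof -
  have "embedding_on (split_carrier f) to_ac \<sigma>"
    using \<sigma> unfolding galois_group_carrier embedding_on_def by blast
  note h = this to_ac_1 subalgebra_split_carrier
  have c: "to_ac c \<in> split_carrier f" for c
    by (rule subalgebraD(1)[OF subalgebra_split_carrier])
  show ?thesis
    unfolding ratfun.lincomb_def
    by (subst embedding_on_sum[OF h])
      (auto simp: b c embedding_onD[OF h] subalgebraD[OF subalgebra_split_carrier])
qed

lemma galois_group_compose:
  assumes "\<sigma> \<in> carrier (galois_group f)" "\<tau> \<in> carrier (galois_group f)"
  shows "compose (split_carrier f) \<sigma> \<tau> \<in> carrier (galois_group f)"
proof -
  note L = subalgebraD[OF subalgebra_split_carrier[of f]]
  have \<sigma>: "bij_betw \<sigma> (split_carrier f) (split_carrier f)" "\<And>c. \<sigma> (to_ac c) = to_ac c"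
    "\<And>x y. x \<in> split_carrier f \<Longrightarrow> y \<in> split_carrier f \<Longrightarrow> \<sigma> (x + y) = \<sigma> x + \<sigma> y \<and> \<sigma> (x * y) = \<sigma> x * \<sigma> y"
    and \<tau>: "bij_betw \<tau> (split_carrier f) (split_carrier f)" "\<And>c. \<tau> (to_ac c) = to_ac c"
    "\<And>x y. x \<in> split_carrier f \<Longrightarrow> y \<in> split_carrier f \<Longrightarrow> \<tau> (x + y) = \<tau> x + \<tau> y \<and> \<tau> (x * y) = \<tau> x * \<tau> y"
    using assms unfolding galois_group_carrier by blast+
  have "\<tau> x \<in> split_carrier f" if "x \<in> split_carrier f" for x
    using \<tau>(1) that by (auto simp: bij_betw_def)
  then show ?thesis
    unfolding galois_group_carrier using bij_betw_compose[OF \<tau>(1) \<sigma>(1)]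
    by (auto simp: compose_def L \<sigma>(2,3) \<tau>(2,3))
qed

text \<open>In one fixed basis \<open>b\<close> the matrices form a multiplicatively closed set. An
  automorphism with matrix \<open>g\<close> in another basis has a conjugate of \<open>g\<close> as
  its matrix in \<open>b\<close>, so every class is met.\<close>

lemma galois_group_is_GL_if_meets_classes:
  fixes a :: "nat \<Rightarrow> 'a::{field,finite} poly" and n :: nat
  defines "f \<equiv> additive_poly n a"
  assumes meets: "\<And>g. g \<in> general_linear n \<Longrightarrow>
    \<exists>\<beta>. ratfun.lin_indep n \<beta> \<and> (\<forall>j<n. \<beta> j \<in> root_set f) \<and>
    (\<exists>\<sigma>\<in>carrier (galois_group f). \<forall>j<n. \<sigma> (\<beta> j) = ratfun.tmul n \<beta> g j)"
  shows "galois_group_is_GL n f"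
proof -
  \<comment> \<open>The hypothesis for the identity matrix already supplies a basis of the root
    space.\<close>
  obtain b where b: "ratfun.lin_indep n b" "\<And>j. j < n \<Longrightarrow> b j \<in> root_set f"
    using meets[OF one_mat_general_linear] by blast
  have roots: "root_set f = ratfun.qroots n (\<lambda>i. to_ac (to_fract (a i)))"
    unfolding f_def by (rule root_set_additive_poly)
  have span: "ratfun.lspan n b' = root_set f" if "ratfun.lin_indep n b'" "\<And>j. j < n \<Longrightarrow> b' j \<in> root_set f" for b'
    unfolding roots by (rule ratfun.lspan_eq_qroots) (use that in \<open>simp_all add: roots\<close>)
  have span_b: "ratfun.lspan n b = root_set f"
    using b by (intro span)
  have L: "root_set f \<subseteq> split_carrier f"
    by (rule root_set_subset_split_carrier)
  define H where "H = galois_matrices f n b"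
  have H_iff: "M \<in> H \<longleftrightarrow> M \<in> carrier_mat n n \<and> (\<exists>\<sigma>\<in>carrier (galois_group f). \<forall>j<n. \<sigma> (b j) = ratfun.tmul n b M j)" for M
    by (simp add: H_def galois_matrices_def ratfun.tmul_def ratfun.lincomb_def const_scale_def)
  have bL: "b j \<in> split_carrier f" if "j < n" for j
    using b(2)[OF that] L by auto
  have gal_root: "\<sigma> z \<in> root_set f" if \<sigma>: "\<sigma> \<in> carrier (galois_group f)" and z: "z \<in> root_set f" for \<sigma> z
  proof -
    have emb: "embedding_on (split_carrier f) to_ac \<sigma>"
      using \<sigma> unfolding galois_group_carrier embedding_on_def by blast
    note D = embedding_onD[OF emb to_ac_1 subalgebra_split_carrier]
    note S = subalgebraD[OF subalgebra_split_carrier[of f]]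
    have zL: "z \<in> split_carrier f"
      using z L by auto
    have pow: "\<sigma> (z ^ k) = \<sigma> z ^ k" for k
      by (induction k) (simp_all add: D zL subalgebra_power[OF subalgebra_split_carrier])
    have "Polynomial.degree (map_poly to_ac f) = Polynomial.degree f"
      by (rule degree_map_poly) simp
    then have val: "poly (map_poly to_ac f) w = (\<Sum>i\<le>Polynomial.degree f. to_ac (poly.coeff f i) * w ^ i)" for w
      by (simp add: poly_altdef coeff_map_poly)
    have "\<sigma> (poly (map_poly to_ac f) z) = poly (map_poly to_ac f) (\<sigma> z)"
      unfolding val by (subst embedding_on_sum[OF emb to_ac_1 subalgebra_split_carrier])
        (simp_all add: D S zL pow subalgebra_power[OF subalgebra_split_carrier])
    then show ?thesis
      using z D(4) by (simp add: root_set_def)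
  qed
  have "H = general_linear n"
  proof (rule general_linear_meeting_conjugacy_classes)
    show "H \<subseteq> general_linear n"
    proof
      fix M assume "M \<in> H"
      then obtain \<sigma> where M: "M \<in> carrier_mat n n" and \<sigma>: "\<sigma> \<in> carrier (galois_group f)"
        "\<And>j. j < n \<Longrightarrow> \<sigma> (b j) = ratfun.tmul n b M j"
        unfolding H_iff by blast
      have inj: "inj_on \<sigma> (split_carrier f)" and c: "\<And>c. \<sigma> (to_ac c) = to_ac c"
        using \<sigma>(1) unfolding galois_group_carrier bij_betw_def by auto
      have "ratfun.lin_indep n (\<lambda>j. \<sigma> (b j))"
        unfolding ratfun.lin_indep_def
      proof (intro allI impI)
        fix c i assume "ratfun.lincomb n c (\<lambda>j. \<sigma> (b j)) = 0" "i < n"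
        then have "\<sigma> (ratfun.lincomb n c b) = \<sigma> 0"
          using galois_lincomb[OF \<sigma>(1) bL] \<open>\<And>c. \<sigma> (to_ac c) = to_ac c\<close>[of 0] by simp
        moreover have "ratfun.lincomb n c b \<in> split_carrier f"
          using span_b L by (auto simp: ratfun.lspan_def)
        ultimately have "ratfun.lincomb n c b = 0"
          using inj_onD[OF inj] subalgebraD(2)[OF subalgebra_split_carrier] by blast
        then show "c i = 0"
          using b(1) \<open>i < n\<close> by (simp add: ratfun.lin_indep_def)
      qed
      moreover have "\<sigma> (b j) \<in> ratfun.lspan n b" if "j < n" for j
        unfolding span_b by (rule gal_root[OF \<sigma>(1) b(2)[OF that]])
      ultimately obtain M' where M': "M' \<in> general_linear n" "\<And>j. j < n \<Longrightarrow> \<sigma> (b j) = ratfun.tmul n b M' j"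
        using ratfun.general_linear_basis_change[OF b(1)] by blast
      have "M = M'"
        by (rule ratfun.tmul_inject[OF b(1) M]) (use M' \<sigma>(2) in \<open>auto simp: general_linear_def\<close>)
      then show "M \<in> general_linear n"
        using M' by simp
    qed
    fix M N assume "M \<in> H" "N \<in> H"
    then obtain \<sigma> \<tau> where M: "M \<in> carrier_mat n n" "\<sigma> \<in> carrier (galois_group f)"
        "\<And>j. j < n \<Longrightarrow> \<sigma> (b j) = ratfun.tmul n b M j"
      and N: "N \<in> carrier_mat n n" "\<tau> \<in> carrier (galois_group f)"
        "\<And>j. j < n \<Longrightarrow> \<tau> (b j) = ratfun.tmul n b N j"
      unfolding H_iff by blast
    have "compose (split_carrier f) \<sigma> \<tau> (b j) = ratfun.tmul n b (M * N) j" if j: "j < n" for j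
    proof -
      have "compose (split_carrier f) \<sigma> \<tau> (b j) = \<sigma> (ratfun.lincomb n (\<lambda>i. N $$ (i, j)) b)"
        using bL[OF j] N(3)[OF j] by (simp add: compose_def ratfun.tmul_def)
      also have "\<dots> = ratfun.lincomb n (\<lambda>i. N $$ (i, j)) (\<lambda>i. \<sigma> (b i))"
        by (rule galois_lincomb[OF M(2) bL])
      also have "\<dots> = ratfun.tmul n (ratfun.tmul n b M) N j"
        unfolding ratfun.tmul_def[of n "ratfun.tmul n b M"] by (rule ratfun.lincomb_cong) (simp_all add: M(3))
      also have "\<dots> = ratfun.tmul n b (M * N) j"
        by (rule ratfun.tmul_tmul[OF M(1) N(1) j])
      finally show ?thesis .
    qed
    then show "M * N \<in> H"
      unfolding H_iff using galois_group_compose[OF M(2) N(2)] M(1) N(1) by auto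
  next
    fix g :: "'a mat" assume g: "g \<in> general_linear n"
    obtain \<beta> \<sigma> where \<beta>: "ratfun.lin_indep n \<beta>" "\<And>j. j < n \<Longrightarrow> \<beta> j \<in> root_set f"
      and \<sigma>: "\<sigma> \<in> carrier (galois_group f)" "\<And>j. j < n \<Longrightarrow> \<sigma> (\<beta> j) = ratfun.tmul n \<beta> g j"
      using meets[OF g] by blast
    obtain P where P: "P \<in> general_linear n" "\<And>j. j < n \<Longrightarrow> \<beta> j = ratfun.tmul n b P j"
      using ratfun.general_linear_basis_change[OF b(1) \<beta>(1)] \<beta>(2) span_b by blast
    obtain M where M: "M \<in> carrier_mat n n" "\<And>j. j < n \<Longrightarrow> \<sigma> (b j) = ratfun.tmul n b M j"
      using ratfun.tmul_exists[of n "\<lambda>j. \<sigma> (b j)" b] gal_root[OF \<sigma>(1) b(2)] span_b by auto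
    have PC: "P \<in> carrier_mat n n" "g \<in> carrier_mat n n"
      using P(1) g by (auto simp: general_linear_def)
    \<comment> \<open>Both products hold the coordinates with respect to \<open>b\<close> of
      \<sigma> applied to the family \<beta>.\<close>
    have "M * P = P * g"
    proof (rule ratfun.tmul_inject[OF b(1)])
      fix j assume j: "j < n"
      have "ratfun.tmul n b (M * P) j = ratfun.tmul n (ratfun.tmul n b M) P j"
        using M(1) PC(1) j by (simp add: ratfun.tmul_tmul)
      also have "\<dots> = ratfun.lincomb n (\<lambda>i. P $$ (i, j)) (\<lambda>i. \<sigma> (b i))"
        unfolding ratfun.tmul_def[of n "ratfun.tmul n b M"] by (rule ratfun.lincomb_cong) (simp_all add: M(2))
      also have "\<dots> = \<sigma> (ratfun.tmul n b P j)"
        unfolding ratfun.tmul_def by (rule galois_lincomb[OF \<sigma>(1) bL, symmetric])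
      also have "\<dots> = ratfun.tmul n \<beta> g j"
        using P(2)[OF j] \<sigma>(2)[OF j] by simp
      also have "\<dots> = ratfun.tmul n (ratfun.tmul n b P) g j"
        by (rule ratfun.tmul_cong) (rule P(2))
      also have "\<dots> = ratfun.tmul n b (P * g) j"
        by (rule ratfun.tmul_tmul[OF PC j])
      finally show "ratfun.tmul n b (M * P) j = ratfun.tmul n b (P * g) j" .
    qed (use M PC in auto)
    moreover have "M \<in> H"
      unfolding H_iff using M \<sigma>(1) by blast
    ultimately show "\<exists>P\<in>general_linear n. \<exists>M\<in>H. M * P = P * g"
      using P(1) by blast
  qed
  moreover have "root_basis f n b"
    by (rule root_basisI[OF b(1) span_b])
  ultimately show ?thesis
    unfolding galois_group_is_GL_def H_def by blast
qed

section \<open>Reduction at several places\<close>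

hide_const (open) Divisibility.prime

context fin_field_alg_closed
begin

lemma fixed_field_mult: "x \<in> fixed_field r \<Longrightarrow> x \<in> fixed_field (r * k)"
proof (induction k)
  case (Suc k)
  then show ?case
    by (simp add: fixed_field_def power_add power_mult)
qed (simp add: fixed_field_def)

text \<open>The Euclidean algorithm on exponents: an element fixed by the power maps for
  \<open>m\<close> and \<open>n\<close> is fixed by the one for \<open>m mod n\<close>.\<close>

lemma fixed_field_gcd: "x \<in> fixed_field r \<Longrightarrow> x \<in> fixed_field s \<Longrightarrow> x \<in> fixed_field (gcd r s)"
proof (induction r s rule: gcd_nat_induct)
  case (step m n)
  have "q ^ m = q ^ (n * (m div n)) * q ^ (m mod n)"
    by (simp flip: power_add)
  then have "x ^ (q ^ m) = (x ^ (q ^ (n * (m div n)))) ^ (q ^ (m mod n))"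
    by (simp add: power_mult)
  then have "x \<in> fixed_field (m mod n)"
    using step.prems fixed_field_mult[OF step.prems(2), of "m div n"] by (simp add: fixed_field_def)
  then show ?case
    using step by (metis gcd_red_nat)
qed simp

lemma fixed_field_power: "x ^ (q ^ k) \<in> fixed_field r \<longleftrightarrow> x \<in> fixed_field r"
proof -
  have "(x ^ (q ^ k)) ^ (q ^ r) = (x ^ (q ^ r)) ^ (q ^ k)"
    by (simp add: mult.commute flip: power_mult)
  then show ?thesis
    by (simp add: fixed_field_def power_qk_eq_iff)
qed

text \<open>Fields of different prime degrees meet only in the ground field, which the points avoid.
  For one prime \<open>r\<close>, two equal conjugates would put the point into the field of degree
  \<open>gcd r (l - k) = 1\<close>.\<close>

lemma conjugates_distinct:
  assumes R: "\<And>r. r \<in> R \<Longrightarrow> prime r" and \<alpha>: "\<And>r. r \<in> R \<Longrightarrow> \<alpha> r \<in> fixed_field r - fixed_field 1"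
  shows "inj_on (\<lambda>(r, k). \<alpha> r ^ (q ^ k)) (Sigma R (\<lambda>r. {..<r}))"
proof (rule inj_onI, clarify)
  fix r k s l
  assume r: "r \<in> R" "k < r" and s: "s \<in> R" "l < s" and eq: "\<alpha> r ^ (q ^ k) = \<alpha> s ^ (q ^ l)"
  have rs: "r = s"
  proof (rule ccontr)
    assume "r \<noteq> s"
    then have "gcd r s = 1"
      using R r s by (simp add: primes_coprime)
    moreover have "\<alpha> r ^ (q ^ k) \<in> fixed_field r"
      using \<alpha>[OF r(1)] by (simp add: fixed_field_power)
    moreover have "\<alpha> r ^ (q ^ k) \<in> fixed_field s"
      unfolding eq using \<alpha>[OF s(1)] by (simp add: fixed_field_power)
    ultimately have "\<alpha> r ^ (q ^ k) \<in> fixed_field 1"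
      using fixed_field_gcd by metis
    then show False
      using \<alpha>[OF r(1)] by (simp add: fixed_field_power)
  qed
  have le: "\<not> k < l" if "\<alpha> r ^ (q ^ k) = \<alpha> r ^ (q ^ l)" "l < r" for k l
  proof
    assume kl: "k < l"
    have "q ^ l = q ^ (l - k) * q ^ k"
      using kl by (simp flip: power_add)
    then have "(\<alpha> r ^ (q ^ (l - k))) ^ (q ^ k) = \<alpha> r ^ (q ^ k)"
      using that(1) by (simp flip: power_mult)
    then have "\<alpha> r \<in> fixed_field (l - k)"
      by (simp add: power_qk_eq_iff fixed_field_def)
    then have "\<alpha> r \<in> fixed_field (gcd r (l - k))"
      using \<alpha>[OF r(1)] by (intro fixed_field_gcd) auto
    moreover have "gcd r (l - k) = 1"
      using R[OF r(1)] kl that(2) by (metis coprime_iff_gcd_eq_1 diff_is_0_eq dvd_imp_le leD less_imp_diff_less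
          not_gr_zero prime_imp_coprime)
    ultimately show False
      using \<alpha>[OF r(1)] by simp
  qed
  show "r = s \<and> k = l"
    using rs le[of k l] le[of l k] eq r s by (metis linorder_neqE_nat)
qed

lemma poly_emb_power: "poly (map_poly emb p) (x ^ (q ^ k)) = poly (map_poly emb p) x ^ (q ^ k)"
proof -
  have "(emb c * x ^ i) ^ (q ^ k) = emb c * (x ^ (q ^ k)) ^ i" for c i
    by (simp add: power_mult_distrib emb_power_qk mult.commute flip: power_mult)
  then show ?thesis
    by (simp add: poly_altdef power_qk_sum coeff_map_poly emb_0)
qed

text \<open>\<open>p\<close> has coefficients in F_q, so with each point it vanishes at all its
  conjugates. These are \<open>\<Sum>R\<close> distinct roots, too many for its degree.\<close>

lemma poly_eq_0_if_vanishes: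
  assumes R: "finite R" "\<And>r. r \<in> R \<Longrightarrow> prime r" and \<alpha>: "\<And>r. r \<in> R \<Longrightarrow> \<alpha> r \<in> fixed_field r - fixed_field 1"
    and p: "\<And>k. k \<ge> \<Sum>R \<Longrightarrow> poly.coeff p k = 0" "\<And>r. r \<in> R \<Longrightarrow> poly (map_poly emb p) (\<alpha> r) = 0"
  shows "p = 0"
proof (rule ccontr)
  assume p0: "p \<noteq> 0"
  let ?S = "Sigma R (\<lambda>r. {..<r})" and ?p = "map_poly emb p"
  have p': "?p \<noteq> 0"
    using p0 by (simp add: map_poly_emb)
  have "\<Sum>R = card ?S"
    using R(1) by simp
  also have "\<dots> = card ((\<lambda>(r, k). \<alpha> r ^ (q ^ k)) ` ?S)"
    by (rule card_image[symmetric], rule conjugates_distinct) (use R \<alpha> in auto)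
  also have "\<dots> \<le> card {x. poly ?p x = 0}"
    using p' p(2) power_qk_0 by (intro card_mono poly_roots_finite) (auto simp: poly_emb_power)
  also have "\<dots> \<le> Polynomial.degree ?p"
    using p' by (rule card_poly_roots_bound)
  also have "\<dots> \<le> Polynomial.degree p"
    by (intro degree_le) (simp add: coeff_map_poly emb_0 coeff_eq_0)
  finally have "poly.coeff p (Polynomial.degree p) = 0"
    by (rule p(1))
  then show False
    using p0 by simp
qed

section \<open>Counting coefficient tuples by their reductions\<close>

definition reduce :: "(nat \<Rightarrow> 'a poly) \<Rightarrow> 'r \<Rightarrow> nat \<Rightarrow> 'r" where
  "reduce a x = (\<lambda>i. poly (map_poly emb (a i)) x)"

text \<open>A tuple of polynomials of degree at most \<open>d\<close> is determined by its high coefficients together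
  with its values at the chosen points.\<close>

lemma card_reduce_le:
  assumes R: "finite R" "\<And>r. r \<in> R \<Longrightarrow> prime r" and \<alpha>: "\<And>r. r \<in> R \<Longrightarrow> \<alpha> r \<in> fixed_field r - fixed_field 1"
    and Bad: "\<And>r. r \<in> R \<Longrightarrow> finite (Bad r)"
  shows "card {a \<in> PiE_dflt {..<n} 0 (\<lambda>_. {p. Polynomial.degree p \<le> d}). \<forall>r\<in>R. reduce a (\<alpha> r) \<in> Bad r}
    \<le> q ^ (n * (Suc d - \<Sum>R)) * (\<Prod>r\<in>R. card (Bad r))" (is "card ?S \<le> _")
proof -
  define F where "F = (\<lambda>a. (\<lambda>(i, k)\<in>{..<n} \<times> {\<Sum>R..d}. poly.coeff (a i) k, \<lambda>r\<in>R. reduce a (\<alpha> r)))"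
  let ?T = "(({..<n} \<times> {\<Sum>R..d}) \<rightarrow>\<^sub>E (UNIV :: 'a set)) \<times> (\<Pi>\<^sub>E r\<in>R. Bad r)"
  have finT: "finite ?T"
    using R(1) Bad by (intro finite_cartesian_product finite_PiE) auto
  have "inj_on F ?S"
  proof (rule inj_onI)
    fix a b assume ab: "a \<in> ?S" "b \<in> ?S" "F a = F b"
    have deg: "Polynomial.degree (a i) \<le> d" "Polynomial.degree (b i) \<le> d" for i
      using ab by (cases "i < n"; force simp: PiE_dflt_def)+
    \<comment> \<open>Equal high coefficients push the degree of the difference below
      \<open>\<Sum>R\<close>, and equal values make it vanish at all chosen points.\<close>
    have "a i - b i = 0" if i: "i < n" for i
    proof (rule poly_eq_0_if_vanishes[of R \<alpha>])
      fix k assume k: "\<Sum>R \<le> k"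
      show "poly.coeff (a i - b i) k = 0"
      proof (cases "k \<le> d")
        case True
        have "fst (F a) (i, k) = fst (F b) (i, k)"
          using ab(3) by simp
        then show ?thesis
          using k i True by (simp add: F_def)
      next
        case False
        then show ?thesis
          using deg[of i] by (simp add: coeff_eq_0)
      qed
    next
      fix r assume r: "r \<in> R"
      have "snd (F a) r i = snd (F b) r i"
        using ab(3) by simp
      moreover have "map_poly emb (a i - b i) = map_poly emb (a i) - map_poly emb (b i)"
        by (rule poly_eqI) (simp add: coeff_map_poly emb_0 emb_diff)
      ultimately show "poly (map_poly emb (a i - b i)) (\<alpha> r) = 0"
        using r by (simp add: F_def reduce_def)
    qed (use R \<alpha> in auto)
    moreover have "a i = b i" if "\<not> i < n" for i
      using ab that by (auto simp: PiE_dflt_def)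
    ultimately show "a = b"
      by (metis eq_iff_diff_eq_0 ext)
  qed
  moreover have "F ` ?S \<subseteq> ?T"
  proof (rule image_subsetI)
    fix a assume "a \<in> ?S"
    then have "\<forall>r\<in>R. reduce a (\<alpha> r) \<in> Bad r"
      by simp
    then show "F a \<in> ?T"
      unfolding F_def by (intro SigmaI restrict_PiE_iff[THEN iffD2]) simp_all
  qed
  ultimately have "card ?S \<le> card ?T"
    using finT by (rule card_inj_on_le)
  also have "\<dots> = q ^ (n * (Suc d - \<Sum>R)) * (\<Prod>r\<in>R. card (Bad r))"
    using R(1) by (simp add: card_cartesian_product card_PiE q_eq_card)
  finally show ?thesis .
qed

text \<open>Independence of the reductions as a counting bound: at each place at most the fraction 1
  - \<delta> of the reduced tuples is bad, and \<open>card_reduce_le\<close> lets these fractions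
  multiply.\<close>

lemma prob_not_frob_le:
  assumes R: "finite R" "\<And>r. r \<in> R \<Longrightarrow> prime r" and \<alpha>: "\<And>r. r \<in> R \<Longrightarrow> \<alpha> r \<in> fixed_field r - fixed_field 1"
    and big: "\<And>r. r \<in> R \<Longrightarrow> q ^ r \<ge> 2 * card (general_linear n :: 'a mat set)"
    and n: "n > 0" and g: "g \<in> general_linear n" and d: "\<Sum>R \<le> Suc d"
  shows "real (card {a \<in> PiE_dflt {..<n} 0 (\<lambda>_. {p. Polynomial.degree p \<le> d}).
      \<forall>r\<in>R. \<not> (reduce a (\<alpha> r) 0 \<noteq> 0 \<and> frob_matrix r n (reduce a (\<alpha> r)) g)})
    \<le> (1 - 1 / (2 * real ((q ^ n) ^ n))) ^ card R * real (q ^ (n * Suc d))"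
proof -
  \<comment> \<open>The proportion of good tuples guaranteed by \<open>card_frob_matrix\<close>; it
    is the same for every \<open>r\<close>.\<close>
  define \<delta> where "\<delta> = 1 / (2 * real ((q ^ n) ^ n))"
  define Tup where "Tup = (\<lambda>r. PiE_dflt {..<n} (0 :: 'r) (\<lambda>_. fixed_field r))"
  define Bad where "Bad = (\<lambda>r. {A \<in> Tup r. \<not> (A 0 \<noteq> 0 \<and> frob_matrix r n A g)})"
  have rpos: "r > 0" if "r \<in> R" for r
    using R(2)[OF that] by (rule prime_gt_0_nat)
  have finX: "finite (Tup r)" if "r \<in> R" for r
    unfolding Tup_def using finite_fixed_field[OF rpos[OF that]] by auto
  have cardX: "card (Tup r) = (q ^ r) ^ n" if "r \<in> R" for r
    unfolding Tup_def using finite_fixed_field[OF rpos[OF that]] card_fixed_field[OF rpos[OF that]]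
    by (simp add: card_PiE_dflt)
  have qpos: "real (q ^ k) > 0" for k
    using q_power_pos[of k] by simp
  have Bad: "real (card (Bad r)) \<le> (1 - \<delta>) * real ((q ^ r) ^ n)" if r: "r \<in> R" for r
  proof -
    define Good where "Good = {A \<in> Tup r. A 0 \<noteq> 0 \<and> frob_matrix r n A g}"
    have "real ((q ^ r) ^ n) \<le> real (2 * (q ^ n) ^ n * card Good)"
      unfolding Good_def Tup_def using card_frob_matrix[OF rpos[OF r] n g big[OF r]] by (rule of_nat_mono)
    then have "\<delta> * real ((q ^ r) ^ n) \<le> real (card Good)"
      unfolding \<delta>_def using q_power_pos[of n] by (simp add: field_simps)
    moreover have "Bad r = Tup r - Good" "Good \<subseteq> Tup r"
      by (auto simp: Bad_def Good_def)
    then have "real (card (Bad r)) = real (card (Tup r)) - real (card Good)"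
      using finX[OF r] by (simp add: card_Diff_subset finite_subset card_mono of_nat_diff)
    ultimately show ?thesis
      using cardX[OF r] by (simp add: algebra_simps)
  qed
  have red: "reduce a (\<alpha> r) \<in> Tup r" if "r \<in> R" "a \<in> PiE_dflt {..<n} 0 (\<lambda>_. {p. Polynomial.degree p \<le> d})" for a r
  proof -
    have "poly (map_poly emb p) (\<alpha> r) \<in> fixed_field r" for p
      using poly_emb_power[of p "\<alpha> r" r] \<alpha>[OF that(1)] by (simp add: fixed_field_def)
    then show ?thesis
      using that(2) by (auto simp: Tup_def PiE_dflt_def reduce_def)
  qed
  have "{a \<in> PiE_dflt {..<n} 0 (\<lambda>_. {p. Polynomial.degree p \<le> d}).
      \<forall>r\<in>R. \<not> (reduce a (\<alpha> r) 0 \<noteq> 0 \<and> frob_matrix r n (reduce a (\<alpha> r)) g)} =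
    {a \<in> PiE_dflt {..<n} 0 (\<lambda>_. {p. Polynomial.degree p \<le> d}). \<forall>r\<in>R. reduce a (\<alpha> r) \<in> Bad r}" (is "?L = ?M")
    using red by (auto simp: Bad_def)
  then have "real (card ?L) = real (card ?M)"
    by simp
  also have "\<dots> \<le> real (q ^ (n * (Suc d - \<Sum>R)) * (\<Prod>r\<in>R. card (Bad r)))"
    by (rule of_nat_mono, rule card_reduce_le) (use R \<alpha> finX in \<open>auto simp: Bad_def\<close>)
  also have "\<dots> = real (q ^ (n * (Suc d - \<Sum>R))) * (\<Prod>r\<in>R. real (card (Bad r)))"
    by simp
  also have "\<dots> \<le> real (q ^ (n * (Suc d - \<Sum>R))) * (\<Prod>r\<in>R. (1 - \<delta>) * real ((q ^ r) ^ n))"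
    by (intro mult_left_mono prod_mono) (use Bad in auto)
  also have "(\<Prod>r\<in>R. (1 - \<delta>) * real ((q ^ r) ^ n)) = (1 - \<delta>) ^ card R * real (q ^ (n * \<Sum>R))"
  proof -
    have "(\<Prod>r\<in>R. (q ^ r) ^ n) = q ^ (n * \<Sum>R)"
      by (simp add: sum_distrib_left power_sum mult.commute flip: power_mult)
    then have "real (\<Prod>r\<in>R. (q ^ r) ^ n) = real (q ^ (n * \<Sum>R))"
      by simp
    then show ?thesis
      by (simp add: prod.distrib)
  qed
  also have "real (q ^ (n * (Suc d - \<Sum>R))) * ((1 - \<delta>) ^ card R * real (q ^ (n * \<Sum>R))) =
      (1 - \<delta>) ^ card R * real (q ^ (n * (Suc d - \<Sum>R) + n * \<Sum>R))"
    by (simp add: power_add)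
  \<comment> \<open>The truncated subtraction is exact by assumption \<open>d\<close>, so high
    coefficients and reductions together account for all tuples.\<close>
  also have "n * (Suc d - \<Sum>R) + n * \<Sum>R = n * Suc d"
    using d by (simp flip: distrib_left)
  finally show ?thesis
    unfolding \<delta>_def .
qed

end

section \<open>The limit\<close>

lemma one_minus_half_inverse:
  fixes x :: real
  assumes "1 \<le> x"
  shows "0 \<le> 1 - 1 / (2 * x)" "1 - 1 / (2 * x) < 1"
  using assms by (simp_all add: field_simps)

section \<open>The uniform distribution on coefficient tuples\<close>

lemma card_degree_le: "CARD('a) ^ Suc d \<le> card {p :: 'a::{field,finite} poly. Polynomial.degree p \<le> d}"
proof -
  define F :: "(nat \<Rightarrow> 'a) \<Rightarrow> 'a poly" where "F = (\<lambda>f. \<Sum>k\<le>d. Polynomial.monom (f k) k)"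
  have coeff: "poly.coeff (F f) k = (if k \<le> d then f k else 0)" for f k
    by (simp add: F_def coeff_sum coeff_monom if_distrib cong: if_cong)
  have "inj_on F ({..d} \<rightarrow>\<^sub>E UNIV)"
  proof (rule inj_onI, rule PiE_ext)
    fix f g k assume "F f = F g" "k \<in> {..d}"
    then show "f k = g k"
      using coeff[of f k] coeff[of g k] by simp
  qed
  moreover have "F ` ({..d} \<rightarrow>\<^sub>E UNIV) \<subseteq> {p. Polynomial.degree p \<le> d}"
    by (auto intro!: degree_le simp: coeff)
  ultimately have "card ({..d} \<rightarrow>\<^sub>E (UNIV :: 'a set)) \<le> card {p :: 'a poly. Polynomial.degree p \<le> d}"
    using finite_degree_le by (rule card_inj_on_le)
  then show ?thesis
    by (simp add: card_PiE)
qed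

text \<open>Independent uniform coordinates are uniform on the product set, so probabilities become
  quotients of cardinalities. The last bound turns a count of bad tuples into a fraction of the
  sample space.\<close>

lemma prob_random_coeffs:
  fixes P :: "(nat \<Rightarrow> 'a::{field,finite} poly) set" and n d :: nat
  defines "S \<equiv> PiE_dflt {..<n} 0 (\<lambda>_. {p :: 'a poly. Polynomial.degree p \<le> d})"
  shows "measure_pmf.prob (random_coeffs n d) P = card (S \<inter> P) / card S"
    and "finite S" "S \<noteq> {}" "CARD('a) ^ (n * Suc d) \<le> card S"
proof -
  have ne: "{p :: 'a poly. Polynomial.degree p \<le> d} \<noteq> {}"
    by (auto intro: exI[of _ 0])
  show S: "finite S" "S \<noteq> {}"
    unfolding S_def using finite_degree_le ne by (auto simp: PiE_dflt_empty_iff)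
  have "random_coeffs n d = pmf_of_set S"
    unfolding random_coeffs_def S_def using finite_degree_le ne by (intro Pi_pmf_of_set) auto
  then show "measure_pmf.prob (random_coeffs n d) P = card (S \<inter> P) / card S"
    using S by (simp add: measure_pmf_of_set)
  have "CARD('a) ^ (n * Suc d) = (CARD('a) ^ Suc d) ^ n"
    by (subst mult.commute) (rule power_mult)
  also have "\<dots> \<le> card {p :: 'a poly. Polynomial.degree p \<le> d} ^ n"
    by (rule power_mono[OF card_degree_le]) simp
  also have "\<dots> = card S"
    unfolding S_def using finite_degree_le by (subst card_PiE_dflt) auto
  finally show "CARD('a) ^ (n * Suc d) \<le> card S" .
qed

text \<open>A union bound over all \<open>g\<close>: outside the bad sets every matrix of the
  general linear group is a Frobenius matrix at some place in \<open>R\<close>.\<close>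

lemma prob_galois_group_is_GL_ge:
  assumes n: "n > 0" and R: "finite R" "\<And>r. r \<in> R \<Longrightarrow> prime r"
    and big: "\<And>r. r \<in> R \<Longrightarrow> CARD('a) ^ r \<ge> 2 * card (general_linear n :: 'a mat set)"
    and d: "\<Sum>R \<le> Suc d"
  shows "1 - real (card (general_linear n :: 'a mat set)) * (1 - 1 / (2 * real ((CARD('a) ^ n) ^ n))) ^ card R
    \<le> measure_pmf.prob (random_coeffs n d :: (nat \<Rightarrow> 'a::{field,finite} poly) pmf)
        {a. galois_group_is_GL n (additive_poly n a)}"
proof -
  define S where "S = PiE_dflt {..<n} 0 (\<lambda>_. {p :: 'a poly. Polynomial.degree p \<le> d})"
  define c where "c = (1 - 1 / (2 * real ((CARD('a) ^ n) ^ n))) ^ card R"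
  define P where "P = {a :: nat \<Rightarrow> 'a poly. galois_group_is_GL n (additive_poly n a)}"
  let ?GL = "general_linear n :: 'a mat set"
  note S = prob_random_coeffs[where ?'a = 'a and n = n and d = d, folded S_def]
  \<comment> \<open>A point of degree \<open>r\<close> exists because the field of degree
    \<open>r\<close> is larger than the ground field.\<close>
  have "\<exists>x. x \<in> alg_closure.fixed_field r - (alg_closure.fixed_field 1 :: 'a alg_closure set)" if r: "r \<in> R" for r
  proof (rule ccontr)
    assume "\<nexists>x. x \<in> alg_closure.fixed_field r - (alg_closure.fixed_field 1 :: 'a alg_closure set)"
    then have "card (alg_closure.fixed_field r :: 'a alg_closure set) \<le> card (alg_closure.fixed_field 1 :: 'a alg_closure set)"
      by (intro card_mono alg_closure.finite_fixed_field) auto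
    moreover have "card (alg_closure.fixed_field r :: 'a alg_closure set) = CARD('a) ^ r"
      "card (alg_closure.fixed_field 1 :: 'a alg_closure set) = CARD('a) ^ 1"
      using prime_gt_0_nat[OF R(2)[OF r]] by (intro alg_closure.card_fixed_field; simp)+
    moreover have "CARD('a) ^ 1 < CARD('a) ^ r"
      using prime_gt_1_nat[OF R(2)[OF r]] card_field_ge_2[where ?'a = 'a] by (intro power_strict_increasing) auto
    ultimately show False
      by simp
  qed
  then obtain \<alpha> where \<alpha>: "\<And>r. r \<in> R \<Longrightarrow> \<alpha> r \<in> alg_closure.fixed_field r - (alg_closure.fixed_field 1 :: 'a alg_closure set)"
    by metis
  define N where "N = (\<lambda>g :: 'a mat. {a \<in> S. \<forall>r\<in>R. \<not> (alg_closure.reduce a (\<alpha> r) 0 \<noteq> 0 \<and>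
      alg_closure.frob_matrix r n (alg_closure.reduce a (\<alpha> r)) g)})"
  have N: "real (card (N g)) \<le> c * real (card S)" if g: "g \<in> ?GL" for g
  proof -
    have "real (card (N g)) \<le> c * real (CARD('a) ^ (n * Suc d))"
      unfolding N_def S_def c_def by (rule alg_closure.prob_not_frob_le) (use R \<alpha> big n g d in auto)
    also have "\<dots> \<le> c * real (card S)"
    proof (intro mult_left_mono of_nat_mono S(4))
      have "1 \<le> real ((CARD('a) ^ n) ^ n)"
        using card_field_ge_2[where ?'a = 'a] by simp
      then show "0 \<le> c"
        unfolding c_def by (intro zero_le_power) (rule one_minus_half_inverse(1))
    qed
    finally show ?thesis .
  qed
  have "S - P \<subseteq> (\<Union>g\<in>?GL. N g)"
  proof
    fix a assume a: "a \<in> S - P"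
    show "a \<in> (\<Union>g\<in>?GL. N g)"
    proof (rule ccontr)
      assume not: "a \<notin> (\<Union>g\<in>?GL. N g)"
      have "galois_group_is_GL n (additive_poly n a)"
      proof (rule galois_group_is_GL_if_meets_classes)
        fix g :: "'a mat" assume "g \<in> general_linear n"
        then obtain r where r: "r \<in> R" "alg_closure.reduce a (\<alpha> r) 0 \<noteq> 0"
          "alg_closure.frob_matrix r n (alg_closure.reduce a (\<alpha> r)) g"
          using not a by (auto simp: N_def)
        show "\<exists>\<beta>. ratfun.lin_indep n \<beta> \<and> (\<forall>j<n. \<beta> j \<in> root_set (additive_poly n a)) \<and>
            (\<exists>\<sigma>\<in>carrier (galois_group (additive_poly n a)). \<forall>j<n. \<sigma> (\<beta> j) = ratfun.tmul n \<beta> g j)"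
          using r \<alpha>[OF r(1)] unfolding alg_closure.reduce_def
          by (intro frobenius_in_galois_group[OF n, of "\<alpha> r" r]) auto
      qed
      then show False
        using a by (simp add: P_def)
    qed
  qed
  then have "card (S - P) \<le> card (\<Union>g\<in>?GL. N g)"
    using S(2) by (intro card_mono finite_UN_I finite_general_linear) (auto simp: N_def)
  also have "\<dots> \<le> (\<Sum>g\<in>?GL. card (N g))"
    by (rule card_UN_le[OF finite_general_linear])
  finally have "real (card (S - P)) \<le> (\<Sum>g\<in>?GL. real (card (N g)))"
    by (simp flip: of_nat_sum)
  also have "\<dots> \<le> real (card ?GL) * (c * real (card S))"
    by (rule sum_bounded_above) (rule N)
  finally have bad: "real (card (S - P)) \<le> real (card ?GL) * c * real (card S)"
    by (simp add: mult.assoc)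
  have pos: "real (card S) > 0"
    using S(2,3) by (simp add: card_gt_0_iff)
  have "card S = card (S \<inter> P) + card (S - P)"
    using S(2) by (rule card_Int_Diff)
  then have "real (card (S \<inter> P)) = real (card S) - real (card (S - P))"
    by simp
  then have "(1 - real (card ?GL) * c) * real (card S) \<le> real (card (S \<inter> P))"
    using bad by (simp add: left_diff_distrib)
  then have "1 - real (card ?GL) * c \<le> real (card (S \<inter> P)) / real (card S)"
    using pos by (simp add: pos_le_divide_eq)
  then show ?thesis
    unfolding P_def[symmetric] S(1) c_def .
qed

theorem theorem9p1:
  fixes n :: nat
  assumes "n > 0"
  shows "(\<lambda>d. measure_pmf.prob
            (random_coeffs n d :: (nat \<Rightarrow> 'a::{field,finite} poly) pmf)
            {a. galois_group_is_GL n (additive_poly n a)}) \<longlonglongrightarrow> 1"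
proof (rule tendstoI)
  fix e :: real assume e: "e > 0"
  define G where "G = card (general_linear n :: 'a mat set)"
  define c where "c = 1 - 1 / (2 * real ((CARD('a) ^ n) ^ n))"
  have "1 \<le> real ((CARD('a) ^ n) ^ n)"
    using card_field_ge_2[where ?'a = 'a] by simp
  then have c: "0 \<le> c" "c < 1"
    unfolding c_def by (rule one_minus_half_inverse)+
  then have "(\<lambda>m. real G * c ^ m) \<longlonglongrightarrow> real G * 0"
    by (intro tendsto_mult tendsto_const LIMSEQ_realpow_zero)
  then have "eventually (\<lambda>m. real G * c ^ m < e) sequentially"
    using e by (intro order_tendstoD(2)[where y = "real G * 0"]) simp_all
  \<comment> \<open>The number of places depends on \<open>e\<close>, \<open>n\<close> and the
    field, but not on the primes or on the degree bound.\<close>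
  then obtain m where m: "real G * c ^ m < e"
    by (auto simp: eventually_sequentially)
  \<comment> \<open>A prime \<open>r\<close> above \<open>2 * G\<close> satisfies
    \<open>2 * G \<le> 2 ^ r\<close>, which secures the size condition of
    \<open>card_frob_matrix\<close>.\<close>
  have "infinite ({p::nat. prime p} - {..2 * G})"
    using primes_infinite by (intro Diff_infinite_finite) auto
  then obtain R where R: "R \<subseteq> {p::nat. prime p} - {..2 * G}" "finite R" "card R = m"
    using infinite_arbitrarily_large by metis
  have big: "2 * card (general_linear n :: 'a mat set) \<le> CARD('a) ^ r" if "r \<in> R" for r
  proof -
    have "2 * G \<le> r"
      using that R(1) by auto
    also have "r \<le> 2 ^ r"
      by (rule less_imp_le) (rule less_exp)
    also have "\<dots> \<le> CARD('a) ^ r"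
      using card_field_ge_2[where ?'a = 'a] by (intro power_mono) auto
    finally show ?thesis
      by (simp add: G_def)
  qed
  \<comment> \<open>Once the degree bound reaches the total degree of the places, the reductions at
    all of them can be prescribed jointly.\<close>
  have "eventually (\<lambda>d. \<Sum>R \<le> d) sequentially"
    by (rule eventually_ge_at_top)
  then show "eventually (\<lambda>d. dist (measure_pmf.prob
            (random_coeffs n d :: (nat \<Rightarrow> 'a poly) pmf)
            {a. galois_group_is_GL n (additive_poly n a)}) 1 < e) sequentially"
  proof (rule eventually_mono)
    fix d assume d: "\<Sum>R \<le> d"
    let ?p = "measure_pmf.prob (random_coeffs n d :: (nat \<Rightarrow> 'a poly) pmf)
            {a. galois_group_is_GL n (additive_poly n a)}"
    have "1 - real G * c ^ card R \<le> ?p"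
      unfolding G_def c_def
      by (rule prob_galois_group_is_GL_ge[OF assms R(2)]) (use R(1) big d in auto)
    moreover have "?p \<le> 1"
      by (rule measure_pmf.prob_le_1)
    ultimately show "dist ?p 1 < e"
      using m R(3) by (simp add: dist_real_def)
  qed
qed

end
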